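(* Let $M$ be a $C^\infty$ real hypersurface in $\mathbb{C}^2$ and $p\in M$. If there exists an $\mathcal{N}$-canonical coordinate for $M$ at $p$, then the following seven conditions are equivalent: (1) $\Delta_1(M,p)=\infty$; (2) $\Delta_1^{\rm reg}(M,p)=\infty$; (3) there exists $\gamma\in\Gamma^{\rm reg}$ tangent to $M$ at $p$ to infinite order; (4) there exists $\gamma\in\Gamma$ tangent to $M$ at $p$ to infinite order; (5) there exists a holomorphic coordinate $(z_1,z_2)$ at $p$ with $p=0$ such that a local defining function for $M$ in this coordinate is not convenient; (6) there exists a holomorphic coordinate $(z_1,z_2)$ at $p$ with $p=0$ such that the Newton polyhedron of a local defining function $r$ for $M$ in this coordinate is $\{(\xi_1,\xi_2)\in\mathbb{R}_+^2:\xi_2\ge1\}$; (7) the Bloom-Graham type of $M$ at $p$ is infinity.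
   Context: A local defining function $r$ for $M$ near $p$ is a real-valued $C^\infty$ function with $M=\{r=0\}$ near $p$ and $\nabla r\ne0$ on $M$. $\operatorname{ord}(h)$ denotes order of vanishing at $0$. $\Gamma$: germs of nonconstant holomorphic maps $\gamma:(\mathbb{C},0)\to(\mathbb{C}^2,p)$ (good parametrization). $\Delta_1(M,p)=\sup_{\gamma\in\Gamma}\operatorname{ord}(r\circ\gamma)/\operatorname{ord}(\gamma-p)$; $\Gamma^{\rm reg}=\{\gamma\in\Gamma:\operatorname{ord}(\gamma-p)=1\}$; $\Delta_1^{\rm reg}(M,p)=\sup_{\gamma\in\Gamma^{\rm reg}}\operatorname{ord}(r\circ\gamma)$. $\gamma$ is tangent to $M$ at $p$ to infinite order if $(r\circ\gamma)(t)=O(t^N)$ for all $N$. Newton polyhedron: for real-valued smooth $F$ near $0\in\mathbb{C}^2$ with Taylor series $\sum C_{\alpha\beta}z^\alpha\bar z^\beta$, $\mathcal{N}_+(F)$ is the convex hull of $\bigcup_{C_{\alpha\beta}\ne0}(\alpha+\beta+\mathbb{R}_+^2)$; $F$ is convenient if $\mathcal{N}_+(F)$ meets every coordinate axis. For a compact face $\kappa$, $F_\kappa=\sum_{\alpha+\beta\in\kappa}C_{\alpha\beta}z^\alpha\bar z^\beta$ and $\Gamma_\kappa$ is the set of curves $t\mapsto(c_1t^{a_1},c_2t^{a_2})$, $c\in(\mathbb{C}\setminus\{0\})^2$, $a\in\mathbb{N}^2$ with $\{\xi\in\mathcal{N}_+(F):a_1\xi_1+a_2\xi_2=l\}=\kappa$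 for some $l\in\mathbb{N}$. $F$ is $\mathcal{N}$-nondegenerate if $F_\kappa\circ\gamma\not\equiv0$ for all compact faces $\kappa$ and all $\gamma\in\Gamma_\kappa$. A holomorphic coordinate centered at $p$ is $\mathcal{N}$-canonical if a local defining function of $M$ in it is $\mathcal{N}$-nondegenerate. Bloom-Graham type is infinity if for every $m$ there is a one-dimensional complex submanifold $X\ni p$ with $r|_X$ vanishing to order at least $m$ at $p$. *)

theory Defs
  imports "HOL-Analysis.Analysis" "HOL-Library.Extended_Real"
begin

type_synonym C2 = "complex \<times> complex"

fun Ck_on :: "nat \<Rightarrow> 'a::euclidean_space set \<Rightarrow> ('a \<Rightarrow> 'b::real_normed_vector) \<Rightarrow> bool" where
  "Ck_on 0 S f = continuous_on S f"
| "Ck_on (Suc k) S f =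
     (f differentiable_on S \<and> (\<forall>v. Ck_on k S (\<lambda>x. frechet_derivative f (at x) v)))"

definition smooth_on :: "'a::euclidean_space set \<Rightarrow> ('a \<Rightarrow> 'b::real_normed_vector) \<Rightarrow> bool" where
  "smooth_on S f \<longleftrightarrow> (\<forall>k. Ck_on k S f)"

definition local_defining_function :: "C2 set \<Rightarrow> C2 \<Rightarrow> (C2 \<Rightarrow> real) \<Rightarrow> bool" where
  "local_defining_function S q \<rho> \<longleftrightarrow>
     (\<exists>W. open W \<and> q \<in> W \<and> smooth_on W \<rho> \<and> S \<inter> W = {x\<in>W. \<rho> x = 0} \<and>
          (\<forall>x\<in>S \<inter> W. frechet_derivative \<rho> (at x) \<noteq> (\<lambda>_. 0)))"

definition real_hypersurface :: "C2 set \<Rightarrow> bool" where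
  "real_hypersurface M \<longleftrightarrow> (\<forall>q\<in>M. \<exists>\<rho>. local_defining_function M q \<rho>)"

definition vord :: "(complex \<Rightarrow> 'a::real_normed_vector) \<Rightarrow> enat" where
  "vord h = Sup {enat N | N. \<exists>C. eventually (\<lambda>t. norm (h t) \<le> C * norm t ^ N) (nhds 0)}"

definition holo_curve :: "real \<Rightarrow> (complex \<Rightarrow> C2) \<Rightarrow> bool" where
  "holo_curve e \<gamma> \<longleftrightarrow> (\<lambda>t. fst (\<gamma> t)) holomorphic_on ball 0 e \<and> (\<lambda>t. snd (\<gamma> t)) holomorphic_on ball 0 e"

text \<open>Representatives of germs of nonconstant holomorphic maps (C,0) -> (C^2,p).\<close>
definition Gamma :: "C2 \<Rightarrow> (complex \<Rightarrow> C2) set" where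
  "Gamma p = {\<gamma>. \<gamma> 0 = p \<and> (\<exists>e>0. holo_curve e \<gamma> \<and> (\<exists>t\<in>ball 0 e. \<gamma> t \<noteq> p))}"

definition Gamma_reg :: "C2 \<Rightarrow> (complex \<Rightarrow> C2) set" where
  "Gamma_reg p = {\<gamma>\<in>Gamma p. vord (\<lambda>t. \<gamma> t - p) = 1}"

definition Delta1 :: "C2 \<Rightarrow> (C2 \<Rightarrow> real) \<Rightarrow> ereal" where
  "Delta1 p r = (SUP \<gamma>\<in>Gamma p. ereal_of_enat (vord (r \<circ> \<gamma>)) / ereal_of_enat (vord (\<lambda>t. \<gamma> t - p)))"

definition Delta1_reg :: "C2 \<Rightarrow> (C2 \<Rightarrow> real) \<Rightarrow> enat" where
  "Delta1_reg p r = (SUP \<gamma>\<in>Gamma_reg p. vord (r \<circ> \<gamma>))"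

definition tangent_inf_order :: "(C2 \<Rightarrow> real) \<Rightarrow> (complex \<Rightarrow> C2) \<Rightarrow> bool" where
  "tangent_inf_order r \<gamma> \<longleftrightarrow>
     (\<forall>N::nat. \<exists>C. eventually (\<lambda>t. \<bar>r (\<gamma> t)\<bar> \<le> C * norm t ^ N) (nhds 0))"

definition holo2_on :: "(C2 \<Rightarrow> C2) \<Rightarrow> C2 set \<Rightarrow> bool" where
  "holo2_on \<Phi> U \<longleftrightarrow>
     (\<forall>x\<in>U. \<exists>L. (\<Phi> has_derivative L) (at x) \<and>
        (\<forall>c v. L (c * fst v, c * snd v) = (c * fst (L v), c * snd (L v))))"

definition holo_coord :: "C2 \<Rightarrow> (C2 \<Rightarrow> C2) \<Rightarrow> C2 set \<Rightarrow> bool" where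
  "holo_coord p \<Phi> U \<longleftrightarrow>
     open U \<and> p \<in> U \<and> holo2_on \<Phi> U \<and> inj_on \<Phi> U \<and> open (\<Phi> ` U) \<and>
     (\<exists>\<Psi>. holo2_on \<Psi> (\<Phi> ` U) \<and> (\<forall>x\<in>U. \<Psi> (\<Phi> x) = x)) \<and> \<Phi> p = (0, 0)"

definition pd :: "C2 \<Rightarrow> (C2 \<Rightarrow> complex) \<Rightarrow> C2 \<Rightarrow> complex" where
  "pd v f = (\<lambda>x. frechet_derivative f (at x) v)"

definition dz1 :: "(C2 \<Rightarrow> complex) \<Rightarrow> C2 \<Rightarrow> complex" where
  "dz1 f = (\<lambda>x. (pd (1, 0) f x - \<i> * pd (\<i>, 0) f x) / 2)"
definition dzb1 :: "(C2 \<Rightarrow> complex) \<Rightarrow> C2 \<Rightarrow> complex" where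
  "dzb1 f = (\<lambda>x. (pd (1, 0) f x + \<i> * pd (\<i>, 0) f x) / 2)"
definition dz2 :: "(C2 \<Rightarrow> complex) \<Rightarrow> C2 \<Rightarrow> complex" where
  "dz2 f = (\<lambda>x. (pd (0, 1) f x - \<i> * pd (0, \<i>) f x) / 2)"
definition dzb2 :: "(C2 \<Rightarrow> complex) \<Rightarrow> C2 \<Rightarrow> complex" where
  "dzb2 f = (\<lambda>x. (pd (0, 1) f x + \<i> * pd (0, \<i>) f x) / 2)"

definition taylor_coeff :: "(C2 \<Rightarrow> real) \<Rightarrow> nat \<times> nat \<Rightarrow> nat \<times> nat \<Rightarrow> complex" where
  "taylor_coeff F \<alpha> \<beta> =
     ((dz1 ^^ fst \<alpha>) ((dz2 ^^ snd \<alpha>) ((dzb1 ^^ fst \<beta>) ((dzb2 ^^ snd \<beta>) (\<lambda>z. complex_of_real (F z)))))) (0, 0)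
     / of_nat (fact (fst \<alpha>) * fact (snd \<alpha>) * fact (fst \<beta>) * fact (snd \<beta>))"

definition mono :: "C2 \<Rightarrow> nat \<times> nat \<Rightarrow> nat \<times> nat \<Rightarrow> complex" where
  "mono z \<alpha> \<beta> = fst z ^ fst \<alpha> * snd z ^ snd \<alpha> * cnj (fst z) ^ fst \<beta> * cnj (snd z) ^ snd \<beta>"

definition exps :: "nat \<times> nat \<Rightarrow> nat \<times> nat \<Rightarrow> real \<times> real" where
  "exps \<alpha> \<beta> = (real (fst \<alpha> + fst \<beta>), real (snd \<alpha> + snd \<beta>))"

definition newton_poly :: "(C2 \<Rightarrow> real) \<Rightarrow> (real \<times> real) set" where
  "newton_poly F = convex hull
     (\<Union>{ {(fst (exps \<alpha> \<beta>) + x, snd (exps \<alpha> \<beta>) + y) | x y. x \<ge> 0 \<and> y \<ge> 0}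
         | \<alpha> \<beta>. taylor_coeff F \<alpha> \<beta> \<noteq> 0})"

definition convenient :: "(C2 \<Rightarrow> real) \<Rightarrow> bool" where
  "convenient F \<longleftrightarrow> (\<exists>x. (x, 0) \<in> newton_poly F) \<and> (\<exists>y. (0, y) \<in> newton_poly F)"

definition compact_face :: "(real \<times> real) set \<Rightarrow> (real \<times> real) set \<Rightarrow> bool" where
  "compact_face \<kappa> N \<longleftrightarrow> \<kappa> face_of N \<and> compact \<kappa> \<and> \<kappa> \<noteq> {}"

definition face_part :: "(C2 \<Rightarrow> real) \<Rightarrow> (real \<times> real) set \<Rightarrow> C2 \<Rightarrow> complex" where
  "face_part F \<kappa> z = (\<Sum>(\<alpha>, \<beta>)\<in>{(\<alpha>, \<beta>). exps \<alpha> \<beta> \<in> \<kappa>}. taylor_coeff F \<alpha> \<beta> * mono z \<alpha> \<beta>)"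

definition Gamma_face :: "(real \<times> real) set \<Rightarrow> (real \<times> real) set \<Rightarrow> (complex \<Rightarrow> C2) set" where
  "Gamma_face N \<kappa> = {\<gamma>. \<exists>c1 c2 (a1::nat) (a2::nat) (l::nat). c1 \<noteq> 0 \<and> c2 \<noteq> 0 \<and>
       \<gamma> = (\<lambda>t. (c1 * t ^ a1, c2 * t ^ a2)) \<and>
       {\<xi>\<in>N. real a1 * fst \<xi> + real a2 * snd \<xi> = real l} = \<kappa>}"

definition N_nondegenerate :: "(C2 \<Rightarrow> real) \<Rightarrow> bool" where
  "N_nondegenerate F \<longleftrightarrow>
     (\<forall>\<kappa>. compact_face \<kappa> (newton_poly F) \<longrightarrow>
        (\<forall>\<gamma>\<in>Gamma_face (newton_poly F) \<kappa>. \<exists>t. face_part F \<kappa> (\<gamma> t) \<noteq> 0))"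

definition N_canonical :: "C2 set \<Rightarrow> C2 \<Rightarrow> (C2 \<Rightarrow> C2) \<Rightarrow> C2 set \<Rightarrow> bool" where
  "N_canonical M p \<Phi> U \<longleftrightarrow> holo_coord p \<Phi> U \<and>
     (\<exists>\<rho>. local_defining_function (\<Phi> ` (M \<inter> U)) (0, 0) \<rho> \<and> N_nondegenerate \<rho>)"

definition complex_curve_param :: "C2 set \<Rightarrow> C2 \<Rightarrow> (complex \<Rightarrow> C2) \<Rightarrow> real \<Rightarrow> bool" where
  "complex_curve_param X p \<phi> e \<longleftrightarrow> e > 0 \<and> holo_curve e \<phi> \<and> \<phi> 0 = p \<and>
     (deriv (\<lambda>t. fst (\<phi> t)) 0, deriv (\<lambda>t. snd (\<phi> t)) 0) \<noteq> (0, 0) \<and>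
     inj_on \<phi> (ball 0 e) \<and>
     (\<exists>\<psi>. continuous_on (\<phi> ` ball 0 e) \<psi> \<and> (\<forall>t\<in>ball 0 e. \<psi> (\<phi> t) = t)) \<and>
     (\<exists>V. open V \<and> p \<in> V \<and> X \<inter> V = \<phi> ` ball 0 e)"

definition BG_type_infinite :: "C2 \<Rightarrow> (C2 \<Rightarrow> real) \<Rightarrow> bool" where
  "BG_type_infinite p r \<longleftrightarrow>
     (\<forall>m::nat. \<exists>X \<phi> e. complex_curve_param X p \<phi> e \<and> vord (r \<circ> \<phi>) \<ge> enat m)"

end

(*
In N-nondegenerate coordinates, let a curve have components with leading terms c1 t^a1 and
c2 t^a2. If l is the minimum of a1 x1 + a2 x2 on the Newton polyhedron, then the terms of the
Taylor series on the corresponding compact face dominate the defining function along the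
curve, so nondegeneracy makes its order of vanishing exactly l. If the polyhedron meets both
axes, in (A,0) and (0,B), then l <= max A B * min a1 a2, so all contact orders are bounded.
Hence (1) and (4) force the defining function in the canonical coordinates to be
nonconvenient, i.e. (5).

If the polyhedron misses an axis, say the first one, all pure z1-terms vanish. As the gradient
is nonzero, there is a linear term in z2, which gives (6), and the disc z2 = 0 is tangent to M
to infinite order, which gives (3) and (7). The remaining implications compare suprema.

Passing between defining functions in different coordinates only uses that each one is locally
bounded by a multiple of the other.
*)
theory Submission
  imports Defs "HOL-Complex_Analysis.Complex_Analysis"
begin

section \<open>Smooth functions\<close>

text \<open>An upper bound on a contact order needs only one real ray of parameters on which the
  defining function is not too small. Along a complex parameter \<open>t\<close> the monomials of
  one weight carry different powers of \<open>t\<close> and its conjugate, so no common power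
  factors out, and nondegeneracy promises a nonzero face part at a single \<open>t0\<close> only. On
  the ray \<open>s * t0\<close> with \<open>s > 0\<close> real, every monomial scales by
  \<open>s\<close> to its weight, and the face part at \<open>t0\<close> becomes the coefficient of
  the leading power. As the function is merely smooth, this rests on a Taylor expansion with
  remainder; positive exponents keep the degree at most the weight, so the expansion to degree
  \<open>l\<close> contains all terms of the face and the remainder is of higher order in
  \<open>s\<close>. A curve inside a coordinate axis has no second exponent and is reached only by
  perturbation. The Taylor coefficients are iterated Wirtinger derivatives in a fixed order; that
  they shift correctly under differentiation depends on the symmetry of mixed derivatives, which is
  why this is settled first.\<close>

lemma frechet_derivative_cong_open:
  assumes "open W" "x \<in> W" "\<And>y. y \<in> W \<Longrightarrow> f y = g y"
  shows "frechet_derivative f (at x) = frechet_derivative g (at x)"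
proof -
  have "(f has_derivative D) (at x) \<longleftrightarrow> (g has_derivative D) (at x)" for D
    using has_derivative_transform_within_open[OF _ assms(1,2)] assms(3) by metis
  then show ?thesis unfolding frechet_derivative_def by simp
qed

text \<open>Derivative formulas such as the sum rule hold only at points of \<open>W\<close>, while
  \<open>Ck_on\<close> speaks about a total function; openness lets one expression be traded for the
  other inside the inductions.\<close>

lemma Ck_on_cong:
  assumes "open W" "\<And>x. x \<in> W \<Longrightarrow> f x = g x" "Ck_on k W f"
  shows "Ck_on k W g"
  using assms(2,3)
proof (induction k arbitrary: f g)
  case 0
  then show ?case by (auto intro: continuous_on_eq)
next
  case (Suc k)
  have "f differentiable_on W" using Suc.prems by simp
  have "g differentiable_on W"
    unfolding differentiable_on_def
  proof
    fix x assume "x \<in> W"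
    with \<open>f differentiable_on W\<close> have "f differentiable (at x within W)"
      by (simp add: differentiable_on_def)
    then show "g differentiable (at x within W)"
      by (rule differentiable_transform_within[OF _ zero_less_one \<open>x \<in> W\<close>]) (rule Suc.prems(1))
  qed
  moreover have "Ck_on k W (\<lambda>x. frechet_derivative g (at x) v)" for v
  proof (rule Suc.IH)
    show "frechet_derivative f (at x) v = frechet_derivative g (at x) v" if "x \<in> W" for x
      by (rule fun_cong, rule frechet_derivative_cong_open[OF assms(1) that]) (rule Suc.prems(1))
    show "Ck_on k W (\<lambda>x. frechet_derivative f (at x) v)" using Suc.prems by simp
  qed
  ultimately show ?case by simp
qed

lemma smooth_on_frechet_derivative:
  assumes "smooth_on W f"
  shows "smooth_on W (\<lambda>x. frechet_derivative f (at x) v)"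
  using assms unfolding smooth_on_def by (metis Ck_on.simps(2))

lemma smooth_on_differentiable:
  assumes "smooth_on W f" "open W" "x \<in> W"
  shows "f differentiable (at x)"
  using assms differentiable_on_eq_differentiable_at unfolding smooth_on_def by (metis Ck_on.simps(2))

lemma smooth_on_continuous: "smooth_on W f \<Longrightarrow> continuous_on W f"
  unfolding smooth_on_def by (metis Ck_on.simps(1))

lemma Ck_on_bounded_linear:
  assumes "open W" "bounded_linear h" "Ck_on k W f"
  shows "Ck_on k W (\<lambda>x. h (f x))"
  using assms(3)
proof (induction k arbitrary: f)
  case 0
  then show ?case
    using assms(2) by (simp add: bounded_linear.continuous_on)
next
  case (Suc k)
  have d: "f differentiable (at x)" if "x \<in> W" for x
    using Suc.prems that assms(1) differentiable_on_eq_differentiable_at by auto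
  have hd: "((\<lambda>x. h (f x)) has_derivative (\<lambda>v. h (frechet_derivative f (at x) v))) (at x)"
    if "x \<in> W" for x
    using bounded_linear.has_derivative[OF assms(2)] d[OF that] frechet_derivative_works by blast
  then have "(\<lambda>x. h (f x)) differentiable_on W"
    using assms(1) differentiable_def differentiable_on_eq_differentiable_at by blast
  moreover have "Ck_on k W (\<lambda>x. frechet_derivative (\<lambda>x. h (f x)) (at x) v)" for v
  proof (rule Ck_on_cong[OF assms(1) _ Suc.IH])
    show "Ck_on k W (\<lambda>x. frechet_derivative f (at x) v)" using Suc.prems by simp
    show "h (frechet_derivative f (at x) v) = frechet_derivative (\<lambda>x. h (f x)) (at x) v"
      if "x \<in> W" for x
      using frechet_derivative_at[OF hd[OF that]] by metis
  qed
  ultimately show ?case by simp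
qed

lemma Ck_on_add:
  assumes "open W" "Ck_on k W f" "Ck_on k W g"
  shows "Ck_on k W (\<lambda>x. f x + g x)"
  using assms(2,3)
proof (induction k arbitrary: f g)
  case 0
  then show ?case by (simp add: continuous_on_add)
next
  case (Suc k)
  have d: "f differentiable (at x)" "g differentiable (at x)" if "x \<in> W" for x
    using Suc.prems that assms(1) differentiable_on_eq_differentiable_at by auto
  have hd: "((\<lambda>x. f x + g x) has_derivative
      (\<lambda>v. frechet_derivative f (at x) v + frechet_derivative g (at x) v)) (at x)"
    if "x \<in> W" for x
    using has_derivative_add d[OF that] frechet_derivative_works by blast
  then have "(\<lambda>x. f x + g x) differentiable_on W"
    using assms(1) differentiable_def differentiable_on_eq_differentiable_at by blast
  moreover have "Ck_on k W (\<lambda>x. frechet_derivative (\<lambda>x. f x + g x) (at x) v)" for v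
  proof (rule Ck_on_cong[OF assms(1) _ Suc.IH])
    show "Ck_on k W (\<lambda>x. frechet_derivative f (at x) v)" using Suc.prems by simp
    show "Ck_on k W (\<lambda>x. frechet_derivative g (at x) v)" using Suc.prems by simp
    show "frechet_derivative f (at x) v + frechet_derivative g (at x) v
        = frechet_derivative (\<lambda>x. f x + g x) (at x) v" if "x \<in> W" for x
      using frechet_derivative_at[OF hd[OF that]] by metis
  qed
  ultimately show ?case by simp
qed

lemma smooth_on_bounded_linear:
  "open W \<Longrightarrow> bounded_linear h \<Longrightarrow> smooth_on W f \<Longrightarrow> smooth_on W (\<lambda>x. h (f x))"
  unfolding smooth_on_def using Ck_on_bounded_linear by blast

lemma smooth_on_add:
  "open W \<Longrightarrow> smooth_on W f \<Longrightarrow> smooth_on W g \<Longrightarrow> smooth_on W (\<lambda>x. f x + g x)"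
  unfolding smooth_on_def using Ck_on_add by blast

section \<open>Mean value estimates and symmetry of second derivatives\<close>

lemma linear_norm_le_Basis_sum:
  fixes L :: "'a::euclidean_space \<Rightarrow> 'b::real_normed_vector"
  assumes "linear L"
  shows "norm (L v) \<le> (\<Sum>b\<in>Basis. norm (L b)) * norm v"
proof -
  have "L v = L (\<Sum>b\<in>Basis. (v \<bullet> b) *\<^sub>R b)" by (simp add: euclidean_representation)
  also have "\<dots> = (\<Sum>b\<in>Basis. (v \<bullet> b) *\<^sub>R L b)"
    using assms by (simp add: linear_sum linear_scale)
  also have "norm \<dots> \<le> (\<Sum>b\<in>Basis. norm (L b) * norm v)"
  proof (rule sum_norm_le)
    fix b :: 'a assume "b \<in> Basis"
    then have "\<bar>v \<bullet> b\<bar> * norm (L b) \<le> norm v * norm (L b)"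
      by (intro mult_right_mono Basis_le_norm) auto
    then show "norm ((v \<bullet> b) *\<^sub>R L b) \<le> norm (L b) * norm v"
      by (simp only: norm_scaleR mult.commute)
  qed
  finally show ?thesis by (simp add: sum_distrib_right)
qed

text \<open>\<open>Ck_on\<close> speaks of the continuity of each directional derivative, not of the
  derivative as an operator. The sum over the basis turns the former into a continuous bound for the
  operator norm, and the mean value inequality applies because balls are convex.\<close>

lemma smooth_on_lipschitz_near:
  fixes f :: "'a::euclidean_space \<Rightarrow> 'b::real_normed_vector"
  assumes "smooth_on W f" "open W" "q \<in> W"
  obtains d B where "d > 0" "ball q d \<subseteq> W"
    "\<And>x y. x \<in> ball q d \<Longrightarrow> y \<in> ball q d \<Longrightarrow> norm (f x - f y) \<le> B * norm (x - y)"
proof -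
  define G where "G x = (\<Sum>b\<in>Basis. norm (frechet_derivative f (at x) b))" for x
  have "continuous_on W G"
    unfolding G_def
    by (intro continuous_intros smooth_on_continuous smooth_on_frechet_derivative assms)
  then have "isCont G q" using assms continuous_on_eq_continuous_at by blast
  then have "(G \<longlongrightarrow> G q) (nhds q)"
    by (simp only: isCont_def tendsto_at_iff_tendsto_nhds)
  then have "eventually (\<lambda>x. G x < G q + 1) (nhds q)"
    by (rule order_tendstoD(2)) simp
  then obtain d1 where d1: "d1 > 0" "\<And>x. dist x q < d1 \<Longrightarrow> G x < G q + 1"
    by (auto simp: eventually_nhds_metric)
  obtain d2 where d2: "d2 > 0" "ball q d2 \<subseteq> W" using assms openE by blast
  define d where "d = min d1 d2"
  have sub: "ball q d \<subseteq> W" using d2 by (auto simp: d_def)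
  have "norm (f x - f y) \<le> (G q + 1) * norm (x - y)" if "x \<in> ball q d" "y \<in> ball q d" for x y
  proof (rule differentiable_bound[OF convex_ball _ _ that])
    fix z assume z: "z \<in> ball q d"
    show hd: "(f has_derivative frechet_derivative f (at z)) (at z within ball q d)"
      using smooth_on_differentiable[OF assms(1,2)] z sub frechet_derivative_works
        has_derivative_at_withinI by blast
    show "onorm (frechet_derivative f (at z)) \<le> G q + 1"
    proof (rule onorm_le)
      fix v
      have "norm (frechet_derivative f (at z) v) \<le> G z * norm v"
        unfolding G_def using linear_norm_le_Basis_sum has_derivative_linear hd by blast
      also have "\<dots> \<le> (G q + 1) * norm v"
        using d1(2)[of z] z by (intro mult_right_mono) (auto simp: d_def dist_commute)
      finally show "norm (frechet_derivative f (at z) v) \<le> (G q + 1) * norm v" .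
    qed
  qed
  moreover have "d > 0" using d1 d2 by (simp add: d_def)
  ultimately show ?thesis using that sub by blast
qed

text \<open>The second difference of \<open>f\<close> is symmetric in \<open>u\<close> and \<open>v\<close>; approximating it by the mixed derivative in both orders yields Schwarz's theorem below.\<close>

lemma second_difference_bound:
  fixes f :: "'a::euclidean_space \<Rightarrow> 'b::real_normed_vector" and u v :: 'a
  assumes sm: "smooth_on W f" and W: "open W" "x \<in> W" and e: "e > 0"
  defines "A \<equiv> frechet_derivative (\<lambda>y. frechet_derivative f (at y) u) (at x) v"
  shows "\<exists>d>0. \<forall>s t. 0 \<le> s \<longrightarrow> s < d \<longrightarrow> 0 \<le> t \<longrightarrow> t < d \<longrightarrow>
    norm (f (x + s *\<^sub>R u + t *\<^sub>R v) - f (x + s *\<^sub>R u) - f (x + t *\<^sub>R v) + f x - (s * t) *\<^sub>R A)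
      \<le> e * s * t"
proof -
  define Du where "Du y = frechet_derivative f (at y) u" for y
  define Duv where "Duv y = frechet_derivative Du (at y) v" for y
  have smu: "smooth_on W Du" unfolding Du_def by (rule smooth_on_frechet_derivative[OF sm])
  have "continuous_on W Duv" unfolding Duv_def
    by (intro smooth_on_continuous smooth_on_frechet_derivative smu)
  then have "isCont Duv x" using W continuous_on_eq_continuous_at by blast
  then have "eventually (\<lambda>y. dist (Duv y) (Duv x) < e) (nhds x)"
    using e unfolding isCont_def tendsto_at_iff_tendsto_nhds by (intro tendstoD)
  moreover have "eventually (\<lambda>y. y \<in> W) (nhds x)" using W by (rule eventually_nhds_in_open)
  ultimately have "eventually (\<lambda>y. dist (Duv y) (Duv x) < e \<and> y \<in> W) (nhds x)"
    by eventually_elim simp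
  then obtain d1 where d1: "d1 > 0" "\<And>y. dist y x < d1 \<Longrightarrow> dist (Duv y) (Duv x) < e \<and> y \<in> W"
    by (auto simp: eventually_nhds_metric)
  \<comment> \<open>Chosen so that \<open>x + a u + b v\<close> stays within \<open>d1\<close> of
    \<open>x\<close> for \<open>a, b < d\<close>; the summand 1 covers
    \<open>u = v = 0\<close>.\<close>
  define d where "d = d1 / (norm u + norm v + 1)"
  have nn: "norm u + norm v + 1 > 0" by (smt (verit) norm_ge_zero)
  have d: "d > 0" using d1 nn by (simp add: d_def)
  have near: "dist (x + a *\<^sub>R u + b *\<^sub>R v) x < d1" if "0 \<le> a" "a < d" "0 \<le> b" "b < d" for a b
  proof -
    have "dist (x + a *\<^sub>R u + b *\<^sub>R v) x \<le> a * norm u + b * norm v"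
      using that norm_triangle_ineq[of "a *\<^sub>R u" "b *\<^sub>R v"] by (simp add: dist_norm)
    also have "\<dots> \<le> d * norm u + d * norm v"
      using that by (intro add_mono mult_right_mono) auto
    also have "\<dots> < d * (norm u + norm v + 1)" using d by (simp add: algebra_simps)
    also have "\<dots> = d1" using nn by (simp add: d_def)
    finally show ?thesis .
  qed
  \<comment> \<open>First use of the mean value inequality, along \<open>v\<close>: the increment of
    \<open>Du\<close> is \<open>b * A\<close> up to \<open>e * b\<close>, because \<open>Duv\<close>
    stays within \<open>e\<close> of \<open>A\<close>.\<close>
  have Duv: "norm (Du (x + a *\<^sub>R u + b *\<^sub>R v) - Du (x + a *\<^sub>R u) - b *\<^sub>R A) \<le> e * b"
    if "0 \<le> a" "a < d" "0 \<le> b" "b < d" for a b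
  proof -
    define \<psi> where "\<psi> \<tau> = Du (x + a *\<^sub>R u + \<tau> *\<^sub>R v) - \<tau> *\<^sub>R A" for \<tau>
    have "norm (\<psi> b - \<psi> 0) \<le> e * norm (b - 0)"
    proof (rule differentiable_bound[where S = "{0..b}"])
      fix \<tau> assume \<tau>: "\<tau> \<in> {0..b}"
      let ?y = "x + a *\<^sub>R u + \<tau> *\<^sub>R v"
      have n: "dist ?y x < d1" using near[of a \<tau>] that \<tau> by auto
      have "(Du has_derivative frechet_derivative Du (at ?y)) (at ?y)"
        using smooth_on_differentiable[OF smu W(1)] d1(2)[OF n] frechet_derivative_works by blast
      then have "((\<lambda>\<tau>. Du (x + a *\<^sub>R u + \<tau> *\<^sub>R v)) has_derivative
          (\<lambda>h. frechet_derivative Du (at ?y) (h *\<^sub>R v))) (at \<tau> within {0..b})"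
        by (rule has_derivative_compose[rotated]) (auto intro!: derivative_eq_intros)
      moreover have "linear (frechet_derivative Du (at ?y))"
        using \<open>(Du has_derivative _) _\<close> has_derivative_linear by blast
      ultimately have hd: "((\<lambda>\<tau>. Du (x + a *\<^sub>R u + \<tau> *\<^sub>R v)) has_derivative (\<lambda>h. h *\<^sub>R Duv ?y)) (at \<tau> within {0..b})"
        by (simp add: Duv_def linear_scale)
      show "(\<psi> has_derivative (\<lambda>h. h *\<^sub>R (Duv ?y - A))) (at \<tau> within {0..b})"
        unfolding \<psi>_def by (auto intro!: derivative_eq_intros hd simp: scaleR_right_diff_distrib)
      show "onorm (\<lambda>h. h *\<^sub>R (Duv ?y - A)) \<le> e"
        using d1(2)[OF n] by (intro onorm_le)
          (auto simp: dist_norm A_def Duv_def Du_def[abs_def] mult.commute[of e] intro!: mult_left_mono)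
    qed (use that in auto)
    then show ?thesis using that by (simp add: \<psi>_def algebra_simps)
  qed
  have "norm (f (x + s *\<^sub>R u + t *\<^sub>R v) - f (x + s *\<^sub>R u) - f (x + t *\<^sub>R v) + f x - (s * t) *\<^sub>R A)
      \<le> e * s * t" if "0 \<le> s" "s < d" "0 \<le> t" "t < d" for s t
  proof -
    \<comment> \<open>Second use, along \<open>u\<close>: the derivative of this function in
      \<sigma> is the increment just estimated, so it is bounded by \<open>e * t\<close>.\<close>
    define \<phi> where "\<phi> \<sigma> = f (x + \<sigma> *\<^sub>R u + t *\<^sub>R v) - f (x + \<sigma> *\<^sub>R u) - (\<sigma> * t) *\<^sub>R A" for \<sigma>
    have "norm (\<phi> s - \<phi> 0) \<le> (e * t) * norm (s - 0)"
    proof (rule differentiable_bound[where S = "{0..s}"])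
      fix \<sigma> assume \<sigma>: "\<sigma> \<in> {0..s}"
      have hd: "((\<lambda>\<sigma>. f (x + \<sigma> *\<^sub>R u + c *\<^sub>R v)) has_derivative (\<lambda>h. h *\<^sub>R Du (x + \<sigma> *\<^sub>R u + c *\<^sub>R v)))
         (at \<sigma> within {0..s})" if "0 \<le> c" "c < d" for c
      proof -
        let ?y = "x + \<sigma> *\<^sub>R u + c *\<^sub>R v"
        have n: "dist ?y x < d1" using near[of \<sigma> c] that \<sigma> \<open>s < d\<close> by auto
        have hf: "(f has_derivative frechet_derivative f (at ?y)) (at ?y)"
          using smooth_on_differentiable[OF sm W(1)] d1(2)[OF n] frechet_derivative_works by blast
        then have "((\<lambda>\<sigma>. f (x + \<sigma> *\<^sub>R u + c *\<^sub>R v)) has_derivative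
            (\<lambda>h. frechet_derivative f (at ?y) (h *\<^sub>R u))) (at \<sigma> within {0..s})"
          by (rule has_derivative_compose[rotated]) (auto intro!: derivative_eq_intros)
        moreover have "linear (frechet_derivative f (at ?y))"
          using hf has_derivative_linear by blast
        ultimately show ?thesis by (simp add: Du_def linear_scale)
      qed
      show "(\<phi> has_derivative (\<lambda>h. h *\<^sub>R (Du (x + \<sigma> *\<^sub>R u + t *\<^sub>R v) - Du (x + \<sigma> *\<^sub>R u) - t *\<^sub>R A)))
         (at \<sigma> within {0..s})"
        unfolding \<phi>_def using hd[of t] hd[of 0] that d
        by (auto intro!: derivative_eq_intros simp: scaleR_right_diff_distrib)
      show "onorm (\<lambda>h. h *\<^sub>R (Du (x + \<sigma> *\<^sub>R u + t *\<^sub>R v) - Du (x + \<sigma> *\<^sub>R u) - t *\<^sub>R A)) \<le> e * t"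
        using Duv[of \<sigma> t] that \<sigma> by (intro onorm_le)
          (auto simp: mult.commute[of "e * t"] intro!: mult_left_mono)
    qed (use that in auto)
    then show ?thesis using that by (simp add: \<phi>_def algebra_simps)
  qed
  then show ?thesis using d by blast
qed

text \<open>With equal steps \<open>s\<close>, both mixed derivatives times \<open>s * s\<close>
  approximate the same second difference up to \<open>e * s * s\<close>, so they differ by at most
  \<open>2 * e\<close>; taking \<open>e\<close> as a quarter of their distance is
  contradictory.\<close>

lemma frechet_derivative_commute:
  fixes f :: "'a::euclidean_space \<Rightarrow> 'b::real_normed_vector"
  assumes sm: "smooth_on W f" and W: "open W" "x \<in> W"
  shows "frechet_derivative (\<lambda>y. frechet_derivative f (at y) u) (at x) v
       = frechet_derivative (\<lambda>y. frechet_derivative f (at y) v) (at x) u" (is "?A = ?B")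
proof (rule ccontr)
  assume ne: "?A \<noteq> ?B"
  define e where "e = norm (?A - ?B) / 4"
  have e: "e > 0" using ne by (simp add: e_def)
  obtain d1 where d1: "d1 > 0" "\<And>s t. 0 \<le> s \<Longrightarrow> s < d1 \<Longrightarrow> 0 \<le> t \<Longrightarrow> t < d1 \<Longrightarrow>
    norm (f (x + s *\<^sub>R u + t *\<^sub>R v) - f (x + s *\<^sub>R u) - f (x + t *\<^sub>R v) + f x - (s * t) *\<^sub>R ?A) \<le> e * s * t"
    using second_difference_bound[OF sm W e, of u v] by blast
  obtain d2 where d2: "d2 > 0" "\<And>s t. 0 \<le> s \<Longrightarrow> s < d2 \<Longrightarrow> 0 \<le> t \<Longrightarrow> t < d2 \<Longrightarrow>
    norm (f (x + s *\<^sub>R v + t *\<^sub>R u) - f (x + s *\<^sub>R v) - f (x + t *\<^sub>R u) + f x - (s * t) *\<^sub>R ?B) \<le> e * s * t"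
    using second_difference_bound[OF sm W e, of v u] by blast
  define s where "s = min d1 d2 / 2"
  have s: "s > 0" "s < d1" "s < d2" using d1 d2 by (auto simp: s_def)
  define \<Delta> where "\<Delta> = f (x + s *\<^sub>R u + s *\<^sub>R v) - f (x + s *\<^sub>R u) - f (x + s *\<^sub>R v) + f x"
  have a: "norm (\<Delta> - (s * s) *\<^sub>R ?A) \<le> e * s * s" using d1(2)[of s s] s by (simp add: \<Delta>_def)
  have "f (x + s *\<^sub>R v + s *\<^sub>R u) - f (x + s *\<^sub>R v) - f (x + s *\<^sub>R u) + f x = \<Delta>"
    by (simp add: \<Delta>_def algebra_simps)
  then have b: "norm (\<Delta> - (s * s) *\<^sub>R ?B) \<le> e * s * s" using d2(2)[of s s] s by simp
  have "(s * s) *\<^sub>R (?A - ?B) = (\<Delta> - (s * s) *\<^sub>R ?B) - (\<Delta> - (s * s) *\<^sub>R ?A)"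
    by (simp add: algebra_simps)
  then have "norm ((s * s) *\<^sub>R (?A - ?B)) \<le> e * s * s + e * s * s"
    by (simp only:) (intro order_trans[OF norm_triangle_ineq4] add_mono a b)
  then have "(s * s) * norm (?A - ?B) \<le> e * s * s + e * s * s" by (simp only: norm_scaleR) simp
  also have "\<dots> = (s * s) * (2 * e)" by simp
  finally have "(s * s) * norm (?A - ?B) \<le> (s * s) * (2 * e)" .
  then have "norm (?A - ?B) \<le> 2 * e" using s by simp
  then show False using e by (simp add: e_def)
qed

section \<open>Wirtinger derivatives and Taylor expansion\<close>

text \<open>One shape for the four operators, with \<open>k = \<i>\<close> or
  \<open>k = - \<i>\<close>, so that smoothness, locality and commutation are proved once.\<close>

definition wirt :: "((C2 \<Rightarrow> complex) \<Rightarrow> C2 \<Rightarrow> complex) \<Rightarrow> bool" where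
  "wirt A \<longleftrightarrow> (\<exists>k u v. A = (\<lambda>f x. (pd u f x + k * pd v f x) / 2))"

lemma wirt_dz:
  shows "wirt dz1" "wirt dzb1" "wirt dz2" "wirt dzb2"
proof -
  have "dz1 = (\<lambda>f x. (pd (1, 0) f x + (- \<i>) * pd (\<i>, 0) f x) / 2)"
    "dzb1 = (\<lambda>f x. (pd (1, 0) f x + \<i> * pd (\<i>, 0) f x) / 2)"
    "dz2 = (\<lambda>f x. (pd (0, 1) f x + (- \<i>) * pd (0, \<i>) f x) / 2)"
    "dzb2 = (\<lambda>f x. (pd (0, 1) f x + \<i> * pd (0, \<i>) f x) / 2)"
    by (simp_all add: fun_eq_iff dz1_def dzb1_def dz2_def dzb2_def)
  then show "wirt dz1" "wirt dzb1" "wirt dz2" "wirt dzb2"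
    unfolding wirt_def by blast+
qed

lemma wirt_cong:
  assumes "wirt A" "open W" "\<And>x. x \<in> W \<Longrightarrow> f x = g x" "x \<in> W"
  shows "A f x = A g x"
proof -
  have "frechet_derivative f (at x) = frechet_derivative g (at x)"
    by (rule frechet_derivative_cong_open[OF assms(2,4)]) (rule assms(3))
  then show ?thesis using assms(1) by (auto simp: wirt_def pd_def)
qed

lemma wirt_smooth:
  assumes "wirt A" "open W" "smooth_on W f"
  shows "smooth_on W (A f)"
proof -
  obtain k u v where A: "A = (\<lambda>f x. (pd u f x + k * pd v f x) / 2)"
    using assms(1) by (auto simp: wirt_def)
  have "smooth_on W (\<lambda>x. (1/2) * (pd u f x + k * pd v f x))"
    unfolding pd_def
    by (intro smooth_on_bounded_linear[OF assms(2) bounded_linear_mult_right] smooth_on_add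
        smooth_on_frechet_derivative assms)
  then show ?thesis by (simp add: A)
qed

lemma pd_linear_comb:
  assumes "f differentiable (at x)" "g differentiable (at x)"
  shows "pd w (\<lambda>x. (f x + k * g x) / 2) x = (pd w f x + k * pd w g x) / 2"
proof -
  have "((\<lambda>x. (f x + k * g x) / 2) has_derivative
      (\<lambda>w. (frechet_derivative f (at x) w + k * frechet_derivative g (at x) w) / 2)) (at x)"
    using assms[unfolded frechet_derivative_works] by (auto intro!: derivative_eq_intros)
  from fun_cong[OF frechet_derivative_at[OF this], of w] show ?thesis by (simp add: pd_def)
qed

text \<open>The operators are combinations of directional derivatives with constant coefficients, so
  the symmetry of second derivatives carries over bilinearly.\<close>

lemma wirt_commute:
  assumes "wirt A" "wirt B" "open W" "smooth_on W f" "x \<in> W"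
  shows "A (B f) x = B (A f) x"
proof -
  obtain k u v where A: "A = (\<lambda>f x. (pd u f x + k * pd v f x) / 2)"
    using assms(1) by (auto simp: wirt_def)
  obtain l a b where B: "B = (\<lambda>f x. (pd a f x + l * pd b f x) / 2)"
    using assms(2) by (auto simp: wirt_def)
  have d: "pd w f differentiable (at x)" for w
    unfolding pd_def
    using smooth_on_differentiable[OF smooth_on_frechet_derivative assms(3,5)] assms(4) by blast
  have c: "pd w (pd w' f) x = pd w' (pd w f) x" for w w'
    unfolding pd_def using frechet_derivative_commute[OF assms(4,3,5)] by blast
  show ?thesis
    unfolding A B pd_linear_comb[OF d d]
    by (simp add: c[of u a] c[of u b] c[of v a] c[of v b] field_simps)
qed

lemma wirt_pow_smooth:
  assumes "wirt A" "open W" "smooth_on W f"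
  shows "smooth_on W ((A ^^ n) f)"
  using assms by (induction n) (auto intro: wirt_smooth)

lemma wirt_pow_cong:
  assumes "wirt A" "open W" "\<And>x. x \<in> W \<Longrightarrow> f x = g x" "x \<in> W"
  shows "(A ^^ n) f x = (A ^^ n) g x"
  using assms(4)
proof (induction n arbitrary: x)
  case (Suc n)
  have "A ((A ^^ n) f) x = A ((A ^^ n) g) x"
    by (rule wirt_cong[OF assms(1,2) _ Suc.prems]) (rule Suc.IH)
  then show ?case by simp
qed (simp add: assms(3))

lemma wirt_pow_commute:
  assumes "wirt A" "wirt B" "open W" "smooth_on W f" "x \<in> W"
  shows "(A ^^ n) (B f) x = B ((A ^^ n) f) x"
  using assms(5)
proof (induction n arbitrary: x)
  case (Suc n)
  have "A ((A ^^ n) (B f)) x = A (B ((A ^^ n) f)) x"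
    by (rule wirt_cong[OF assms(1,3) _ Suc.prems]) (rule Suc.IH)
  then have "(A ^^ Suc n) (B f) x = A (B ((A ^^ n) f)) x" by simp
  also have "\<dots> = B ((A ^^ Suc n) f) x"
    using wirt_commute[OF assms(1,2,3) wirt_pow_smooth[OF assms(1,3,4)] Suc.prems] by simp
  finally show ?case .
qed simp

text \<open>Earlier commutations hold only pointwise on \<open>W\<close>, so the inner function
  \<open>g\<close> equals \<open>B f\<close> there and perhaps nowhere else; \<open>B\<close> is
  then moved outside the next block.\<close>

lemma wirt_pow_push:
  assumes "wirt A" "wirt B" "open W" "smooth_on W f" "\<And>y. y \<in> W \<Longrightarrow> g y = B f y" "x \<in> W"
  shows "(A ^^ n) g x = B ((A ^^ n) f) x"
proof -
  have "(A ^^ n) g x = (A ^^ n) (B f) x"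
    by (rule wirt_pow_cong[OF assms(1,3) _ assms(6)]) (rule assms(5))
  also have "\<dots> = B ((A ^^ n) f) x" by (rule wirt_pow_commute[OF assms(1-4,6)])
  finally show ?thesis .
qed

definition wirt_iter :: "nat \<Rightarrow> nat \<Rightarrow> nat \<Rightarrow> nat \<Rightarrow> (C2 \<Rightarrow> complex) \<Rightarrow> C2 \<Rightarrow> complex" where
  "wirt_iter a b c d f = (dz1 ^^ a) ((dz2 ^^ b) ((dzb1 ^^ c) ((dzb2 ^^ d) f)))"

text \<open>A derivative applied first, innermost, must travel through the blocks to its own one, by
  one commutation per block. This is what makes the Taylor coefficients of a derivative shifted
  coefficients of \<open>f\<close>.\<close>

lemma wirt_iter_Suc:
  assumes "open W" "smooth_on W f" "x \<in> W"
  shows "wirt_iter a b c d (dz1 f) x = wirt_iter (Suc a) b c d f x"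
    and "wirt_iter a b c d (dz2 f) x = wirt_iter a (Suc b) c d f x"
    and "wirt_iter a b c d (dzb1 f) x = wirt_iter a b (Suc c) d f x"
    and "wirt_iter a b c d (dzb2 f) x = wirt_iter a b c (Suc d) f x"
proof -
  let ?f3 = "(dzb2 ^^ d) f" and ?f2 = "(dzb1 ^^ c) ((dzb2 ^^ d) f)"
  let ?f1 = "(dz2 ^^ b) ((dzb1 ^^ c) ((dzb2 ^^ d) f))"
  note sm = wirt_pow_smooth[OF wirt_dz(4) assms(1,2), of d]
  note sm2 = wirt_pow_smooth[OF wirt_dz(2) assms(1) sm, of c]
  note sm1 = wirt_pow_smooth[OF wirt_dz(3) assms(1) sm2, of b]
  show "wirt_iter a b c d (dzb2 f) x = wirt_iter a b c (Suc d) f x"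
    unfolding wirt_iter_def funpow_Suc_right comp_def ..
  have c1: "(dzb2 ^^ d) (B f) y = B ?f3 y" if "wirt B" "y \<in> W" for B y
    by (rule wirt_pow_commute[OF wirt_dz(4) that(1) assms(1,2) that(2)])
  have c2: "(dzb1 ^^ c) ((dzb2 ^^ d) (B f)) y = B ?f2 y" if "wirt B" "y \<in> W" for B y
    by (rule wirt_pow_push[OF wirt_dz(2) that(1) assms(1) sm _ that(2)]) (rule c1[OF that(1)])
  have c3: "(dz2 ^^ b) ((dzb1 ^^ c) ((dzb2 ^^ d) (B f))) y = B ?f1 y" if "wirt B" "y \<in> W" for B y
    by (rule wirt_pow_push[OF wirt_dz(3) that(1) assms(1) sm2 _ that(2)]) (rule c2[OF that(1)])
  have e1: "(dzb1 ^^ c) ((dzb2 ^^ d) (dzb1 f)) y = (dzb1 ^^ Suc c) ?f3 y" if "y \<in> W" for y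
    using c2[OF wirt_dz(2) that] by simp
  have e2: "(dz2 ^^ b) ((dzb1 ^^ c) ((dzb2 ^^ d) (dz2 f))) y = (dz2 ^^ Suc b) ?f2 y" if "y \<in> W" for y
    using c3[OF wirt_dz(3) that] by simp
  have e3: "(dz2 ^^ b) ((dzb1 ^^ c) ((dzb2 ^^ d) (dzb1 f))) y = (dz2 ^^ b) ((dzb1 ^^ Suc c) ?f3) y"
    if "y \<in> W" for y
    by (rule wirt_pow_cong[OF wirt_dz(3) assms(1) _ that]) (rule e1)
  show "wirt_iter a b c d (dzb1 f) x = wirt_iter a b (Suc c) d f x"
    unfolding wirt_iter_def by (rule wirt_pow_cong[OF wirt_dz(1) assms(1) _ assms(3)]) (rule e3)
  show "wirt_iter a b c d (dz2 f) x = wirt_iter a (Suc b) c d f x"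
    unfolding wirt_iter_def by (rule wirt_pow_cong[OF wirt_dz(1) assms(1) _ assms(3)]) (rule e2)
  have "(dz1 ^^ a) ((dz2 ^^ b) ((dzb1 ^^ c) ((dzb2 ^^ d) (dz1 f)))) x = dz1 ((dz1 ^^ a) ?f1) x"
    by (rule wirt_pow_push[OF wirt_dz(1,1) assms(1) sm1 _ assms(3)]) (rule c3[OF wirt_dz(1)])
  then show "wirt_iter a b c d (dz1 f) x = wirt_iter (Suc a) b c d f x"
    by (simp add: wirt_iter_def)
qed

section \<open>Taylor polynomials in the coordinates and their conjugates\<close>

lemma has_derivative_wirtinger:
  assumes "f differentiable (at x)"
  shows "(f has_derivative (\<lambda>v. fst v * dz1 f x + cnj (fst v) * dzb1 f x
      + snd v * dz2 f x + cnj (snd v) * dzb2 f x)) (at x)"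
proof -
  define L where "L = frechet_derivative f (at x)"
  have hd: "(f has_derivative L) (at x)"
    using assms by (simp add: L_def frechet_derivative_works)
  then have lin: "linear L" by (rule has_derivative_linear)
  have "L v = fst v * dz1 f x + cnj (fst v) * dzb1 f x + snd v * dz2 f x + cnj (snd v) * dzb2 f x" for v
  proof -
    have "v = Re (fst v) *\<^sub>R (1, 0) + Im (fst v) *\<^sub>R (\<i>, 0) + Re (snd v) *\<^sub>R (0, 1) + Im (snd v) *\<^sub>R (0, \<i>)"
      by (simp add: prod_eq_iff complex_eq_iff)
    then have "L v = L (Re (fst v) *\<^sub>R (1, 0) + Im (fst v) *\<^sub>R (\<i>, 0) + Re (snd v) *\<^sub>R (0, 1) + Im (snd v) *\<^sub>R (0, \<i>))"
      by simp
    also have "\<dots> = Re (fst v) *\<^sub>R L (1, 0) + Im (fst v) *\<^sub>R L (\<i>, 0) + Re (snd v) *\<^sub>R L (0, 1) + Im (snd v) *\<^sub>R L (0, \<i>)"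
      using lin by (simp only: linear_add linear_scale)
    also have "\<dots> = fst v * dz1 f x + cnj (fst v) * dzb1 f x + snd v * dz2 f x + cnj (snd v) * dzb2 f x"
      by (simp add: dz1_def dzb1_def dz2_def dzb2_def pd_def L_def complex_eq_iff field_simps)
    finally show ?thesis .
  qed
  then have "L = (\<lambda>v. fst v * dz1 f x + cnj (fst v) * dzb1 f x + snd v * dz2 f x + cnj (snd v) * dzb2 f x)"
    by blast
  then show ?thesis using hd by simp
qed

text \<open>For complex-valued functions, since the Wirtinger derivatives of a real function are
  complex and the Taylor induction passes to them.\<close>

definition wirt_coeff :: "(C2 \<Rightarrow> complex) \<Rightarrow> (nat \<times> nat) \<times> (nat \<times> nat) \<Rightarrow> complex" where
  "wirt_coeff f x = wirt_iter (fst (fst x)) (snd (fst x)) (fst (snd x)) (snd (snd x)) f (0, 0)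
     / of_nat (fact (fst (fst x)) * fact (snd (fst x)) * fact (fst (snd x)) * fact (snd (snd x)))"

lemma taylor_coeff_eq_wirt_coeff: "taylor_coeff F \<alpha> \<beta> = wirt_coeff (\<lambda>z. complex_of_real (F z)) (\<alpha>, \<beta>)"
  by (simp add: taylor_coeff_def wirt_coeff_def wirt_iter_def)

definition taylor_index :: "nat \<Rightarrow> ((nat \<times> nat) \<times> (nat \<times> nat)) set" where
  "taylor_index m = {x. fst (fst x) + snd (fst x) + fst (snd x) + snd (snd x) \<le> m}"

lemma finite_taylor_index [simp]: "finite (taylor_index m)"
proof (rule finite_subset)
  show "taylor_index m \<subseteq> ({..m} \<times> {..m}) \<times> ({..m} \<times> {..m})" by (auto simp: taylor_index_def)
qed simp

definition taylor_poly :: "nat \<Rightarrow> (C2 \<Rightarrow> complex) \<Rightarrow> C2 \<Rightarrow> complex" where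
  "taylor_poly m f z = (\<Sum>x\<in>taylor_index m. wirt_coeff f x * mono z (fst x) (snd x))"

lemma taylor_poly_at_0: "taylor_poly m f 0 = f 0"
proof -
  have "taylor_poly m f 0 = (\<Sum>x\<in>{((0, 0), (0, 0))}. wirt_coeff f x * mono 0 (fst x) (snd x))"
    unfolding taylor_poly_def
  proof (rule sum.mono_neutral_right)
    show "{((0, 0), (0, 0))} \<subseteq> taylor_index m" by (simp add: taylor_index_def)
    show "\<forall>x\<in>taylor_index m - {((0, 0), (0, 0))}. wirt_coeff f x * mono 0 (fst x) (snd x) = 0"
      by (auto simp: mono_def power_0_left)
  qed simp
  then show ?thesis by (simp add: wirt_coeff_def wirt_iter_def mono_def zero_prod_def)
qed

text \<open>Termwise differentiation of a Taylor polynomial in one of the four variables: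
  \<open>w\<close> reads the exponent concerned, \<open>up\<close> and \<open>down\<close> raise and
  lower it. Stated abstractly so that the four cases are instances.\<close>

lemma sum_taylor_index_shift:
  fixes up down :: "(nat \<times> nat) \<times> (nat \<times> nat) \<Rightarrow> (nat \<times> nat) \<times> (nat \<times> nat)"
    and c M :: "(nat \<times> nat) \<times> (nat \<times> nat) \<Rightarrow> complex"
  assumes "\<And>x. down (up x) = x" "\<And>x. w x > 0 \<Longrightarrow> up (down x) = x" "\<And>x. w (up x) = Suc (w x)"
    and "\<And>x. up x \<in> taylor_index (Suc m) \<longleftrightarrow> x \<in> taylor_index m"
    and "\<And>x. x \<in> taylor_index m \<Longrightarrow> c' x = of_nat (Suc (w x)) * c (up x)"
  shows "(\<Sum>x\<in>taylor_index (Suc m). c x * (of_nat (w x) * M (down x))) = (\<Sum>x\<in>taylor_index m. c' x * M x)"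
proof -
  \<comment> \<open>Truncated subtraction in \<open>down\<close> does no harm: where it would
    truncate, the factor \<open>w x\<close> is zero.\<close>
  have "(\<Sum>x\<in>taylor_index (Suc m). c x * (of_nat (w x) * M (down x)))
      = (\<Sum>x\<in>{x \<in> taylor_index (Suc m). w x > 0}. c x * (of_nat (w x) * M (down x)))"
    by (rule sum.mono_neutral_right) auto
  also have "\<dots> = (\<Sum>x\<in>taylor_index m. c' x * M x)"
  proof (rule sum.reindex_bij_witness[where i = up and j = down])
    fix x assume x: "x \<in> {x \<in> taylor_index (Suc m). w x > 0}"
    then have u: "up (down x) = x" using assms(2) by blast
    show "up (down x) = x" by (rule u)
    show d: "down x \<in> taylor_index m" using assms(4)[of "down x"] u x by simp
    have "w x = Suc (w (down x))" using assms(3)[of "down x"] u by simp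
    then show "c' (down x) * M (down x) = c x * (of_nat (w x) * M (down x))"
      using assms(5)[OF d] u by simp
  qed (use assms in auto)
  finally show ?thesis .
qed

lemma has_derivative_mono:
  "((\<lambda>z. mono z \<alpha> \<beta>) has_derivative (\<lambda>v.
      fst v * (of_nat (fst \<alpha>) * mono z (fst \<alpha> - 1, snd \<alpha>) \<beta>)
    + cnj (fst v) * (of_nat (fst \<beta>) * mono z \<alpha> (fst \<beta> - 1, snd \<beta>))
    + snd v * (of_nat (snd \<alpha>) * mono z (fst \<alpha>, snd \<alpha> - 1) \<beta>)
    + cnj (snd v) * (of_nat (snd \<beta>) * mono z \<alpha> (fst \<beta>, snd \<beta> - 1)))) (at z)"
proof -
  have c1: "((\<lambda>z. cnj (fst z)) has_derivative (\<lambda>v. cnj (fst v))) (at z)"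
    by (intro bounded_linear.has_derivative[OF bounded_linear_cnj] has_derivative_fst has_derivative_ident)
  have c2: "((\<lambda>z. cnj (snd z)) has_derivative (\<lambda>v. cnj (snd v))) (at z)"
    by (intro bounded_linear.has_derivative[OF bounded_linear_cnj] has_derivative_snd has_derivative_ident)
  note e = has_derivative_mult[OF has_derivative_mult[OF has_derivative_mult[OF
      has_derivative_power[OF has_derivative_fst[OF has_derivative_ident], where n = "fst \<alpha>"]
      has_derivative_power[OF has_derivative_snd[OF has_derivative_ident], where n = "snd \<alpha>"]]
      has_derivative_power[OF c1, where n = "fst \<beta>"]] has_derivative_power[OF c2, where n = "snd \<beta>"]]
  show ?thesis
    unfolding mono_def by (rule has_derivative_eq_rhs[OF e]) (simp add: fun_eq_iff algebra_simps)
qed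

text \<open>The factor comes from the quotient of the factorials of consecutive exponents.\<close>

lemma wirt_coeff_shift:
  assumes "open W" "smooth_on W f" "0 \<in> W"
  shows "wirt_coeff (dz1 f) ((a, b), (c, d)) = of_nat (Suc a) * wirt_coeff f ((Suc a, b), (c, d))"
    and "wirt_coeff (dz2 f) ((a, b), (c, d)) = of_nat (Suc b) * wirt_coeff f ((a, Suc b), (c, d))"
    and "wirt_coeff (dzb1 f) ((a, b), (c, d)) = of_nat (Suc c) * wirt_coeff f ((a, b), (Suc c, d))"
    and "wirt_coeff (dzb2 f) ((a, b), (c, d)) = of_nat (Suc d) * wirt_coeff f ((a, b), (c, Suc d))"
proof -
  have z: "(0, 0) \<in> W" using assms(3) by (simp add: zero_prod_def)
  show "wirt_coeff (dz1 f) ((a, b), (c, d)) = of_nat (Suc a) * wirt_coeff f ((Suc a, b), (c, d))"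
    "wirt_coeff (dz2 f) ((a, b), (c, d)) = of_nat (Suc b) * wirt_coeff f ((a, Suc b), (c, d))"
    "wirt_coeff (dzb1 f) ((a, b), (c, d)) = of_nat (Suc c) * wirt_coeff f ((a, b), (Suc c, d))"
    "wirt_coeff (dzb2 f) ((a, b), (c, d)) = of_nat (Suc d) * wirt_coeff f ((a, b), (c, Suc d))"
    by (simp_all add: wirt_coeff_def wirt_iter_Suc[OF assms(1,2) z] fact_Suc[where 'a = complex]
        del: of_nat_Suc fact_Suc)
qed

text \<open>Kept in the shape of \<open>has_derivative_wirtinger\<close>, so that subtracting the
  two differentiates the Taylor remainder term by term.\<close>

lemma has_derivative_taylor_poly:
  assumes "open W" "smooth_on W f" "0 \<in> W"
  shows "((taylor_poly (Suc m) f) has_derivative (\<lambda>v. fst v * taylor_poly m (dz1 f) z + cnj (fst v) * taylor_poly m (dzb1 f) z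
      + snd v * taylor_poly m (dz2 f) z + cnj (snd v) * taylor_poly m (dzb2 f) z)) (at z)"
proof -
  note sh = wirt_coeff_shift[OF assms]
  have s1: "(\<Sum>x\<in>taylor_index (Suc m). wirt_coeff f x *
      (of_nat (fst (fst x)) * mono z (fst (fst x) - 1, snd (fst x)) (snd x))) = taylor_poly m (dz1 f) z"
    unfolding taylor_poly_def
    by (rule trans[OF _ sum_taylor_index_shift[where down = "\<lambda>x. ((fst (fst x) - 1, snd (fst x)), snd x)"
      and up = "\<lambda>x. ((Suc (fst (fst x)), snd (fst x)), snd x)" and w = "\<lambda>x. fst (fst x)"
      and c = "wirt_coeff f" and c' = "wirt_coeff (dz1 f)" and M = "\<lambda>x. mono z (fst x) (snd x)" and m = m]])
      (auto simp: taylor_index_def sh)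
  have s2: "(\<Sum>x\<in>taylor_index (Suc m). wirt_coeff f x *
      (of_nat (snd (fst x)) * mono z (fst (fst x), snd (fst x) - 1) (snd x))) = taylor_poly m (dz2 f) z"
    unfolding taylor_poly_def
    by (rule trans[OF _ sum_taylor_index_shift[where down = "\<lambda>x. ((fst (fst x), snd (fst x) - 1), snd x)"
      and up = "\<lambda>x. ((fst (fst x), Suc (snd (fst x))), snd x)" and w = "\<lambda>x. snd (fst x)"
      and c = "wirt_coeff f" and c' = "wirt_coeff (dz2 f)" and M = "\<lambda>x. mono z (fst x) (snd x)" and m = m]])
      (auto simp: taylor_index_def sh)
  have s3: "(\<Sum>x\<in>taylor_index (Suc m). wirt_coeff f x *
      (of_nat (fst (snd x)) * mono z (fst x) (fst (snd x) - 1, snd (snd x)))) = taylor_poly m (dzb1 f) z"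
    unfolding taylor_poly_def
    by (rule trans[OF _ sum_taylor_index_shift[where down = "\<lambda>x. (fst x, (fst (snd x) - 1, snd (snd x)))"
      and up = "\<lambda>x. (fst x, (Suc (fst (snd x)), snd (snd x)))" and w = "\<lambda>x. fst (snd x)"
      and c = "wirt_coeff f" and c' = "wirt_coeff (dzb1 f)" and M = "\<lambda>x. mono z (fst x) (snd x)" and m = m]])
      (auto simp: taylor_index_def sh)
  have s4: "(\<Sum>x\<in>taylor_index (Suc m). wirt_coeff f x *
      (of_nat (snd (snd x)) * mono z (fst x) (fst (snd x), snd (snd x) - 1))) = taylor_poly m (dzb2 f) z"
    unfolding taylor_poly_def
    by (rule trans[OF _ sum_taylor_index_shift[where down = "\<lambda>x. (fst x, (fst (snd x), snd (snd x) - 1))"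
      and up = "\<lambda>x. (fst x, (fst (snd x), Suc (snd (snd x))))" and w = "\<lambda>x. snd (snd x)"
      and c = "wirt_coeff f" and c' = "wirt_coeff (dzb2 f)" and M = "\<lambda>x. mono z (fst x) (snd x)" and m = m]])
      (auto simp: taylor_index_def sh)
  have "(taylor_poly (Suc m) f has_derivative (\<lambda>v. \<Sum>x\<in>taylor_index (Suc m). wirt_coeff f x * (
      fst v * (of_nat (fst (fst x)) * mono z (fst (fst x) - 1, snd (fst x)) (snd x))
    + cnj (fst v) * (of_nat (fst (snd x)) * mono z (fst x) (fst (snd x) - 1, snd (snd x)))
    + snd v * (of_nat (snd (fst x)) * mono z (fst (fst x), snd (fst x) - 1) (snd x))
    + cnj (snd v) * (of_nat (snd (snd x)) * mono z (fst x) (fst (snd x), snd (snd x) - 1))))) (at z)"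
    unfolding taylor_poly_def[abs_def] by (intro has_derivative_sum has_derivative_mult_right has_derivative_mono)
  then show ?thesis
    unfolding s1[symmetric] s2[symmetric] s3[symmetric] s4[symmetric]
    by (rule has_derivative_eq_rhs)
      (simp add: fun_eq_iff sum_distrib_left sum.distrib distrib_left mult.left_commute)
qed

text \<open>A constant in such a bound may be negative a priori; a nonnegative one is required
  before enlarging the power beside it.\<close>

lemma eventually_bound_abs:
  assumes "eventually (\<lambda>z. norm (g z) \<le> C * norm z ^ n) F"
  shows "eventually (\<lambda>z. norm (g z) \<le> \<bar>C\<bar> * norm z ^ n) F"
  using assms by eventually_elim (meson abs_ge_self mult_right_mono norm_ge_zero order_trans zero_le_power)

text \<open>By induction on the order: the Wirtinger derivatives of the remainder of \<open>f\<close> are the remainders, one order lower, of the Wirtinger derivatives of \<open>f\<close>.\<close>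

lemma taylor_expansion:
  assumes "open W" "smooth_on W f" "0 \<in> W"
  shows "\<exists>C. eventually (\<lambda>z. norm (f z - taylor_poly m f z) \<le> C * norm z ^ Suc m) (nhds 0)"
  using assms(2)
proof (induction m arbitrary: f)
  case 0
  obtain d B where B: "d > 0" "ball 0 d \<subseteq> W"
    "\<And>x y. x \<in> ball 0 d \<Longrightarrow> y \<in> ball 0 d \<Longrightarrow> norm (f x - f y) \<le> B * norm (x - y)"
    using smooth_on_lipschitz_near[OF 0 assms(1,3)] by blast
  have "taylor_index 0 = {((0, 0), (0, 0))}" by (auto simp: taylor_index_def)
  then have t0: "taylor_poly 0 f z = f 0" for z
    by (simp add: taylor_poly_def wirt_coeff_def wirt_iter_def mono_def zero_prod_def)
  have "eventually (\<lambda>z. z \<in> ball 0 d) (nhds (0::C2))"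
    using B by (intro eventually_nhds_in_open) auto
  then have "eventually (\<lambda>z. norm (f z - taylor_poly 0 f z) \<le> B * norm z ^ Suc 0) (nhds 0)"
    by eventually_elim (use B(1) B(3)[of _ 0] t0 in simp)
  then show ?case by blast
next
  case (Suc m)
  note sm = wirt_smooth[OF _ assms(1) Suc.prems]
  obtain C1 where C1: "eventually (\<lambda>z. norm (dz1 f z - taylor_poly m (dz1 f) z) \<le> C1 * norm z ^ Suc m) (nhds 0)"
    using Suc.IH[OF sm[OF wirt_dz(1)]] by blast
  obtain C2 where C2: "eventually (\<lambda>z. norm (dzb1 f z - taylor_poly m (dzb1 f) z) \<le> C2 * norm z ^ Suc m) (nhds 0)"
    using Suc.IH[OF sm[OF wirt_dz(2)]] by blast
  obtain C3 where C3: "eventually (\<lambda>z. norm (dz2 f z - taylor_poly m (dz2 f) z) \<le> C3 * norm z ^ Suc m) (nhds 0)"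
    using Suc.IH[OF sm[OF wirt_dz(3)]] by blast
  obtain C4 where C4: "eventually (\<lambda>z. norm (dzb2 f z - taylor_poly m (dzb2 f) z) \<le> C4 * norm z ^ Suc m) (nhds 0)"
    using Suc.IH[OF sm[OF wirt_dz(4)]] by blast
  define C where "C = \<bar>C1\<bar> + \<bar>C2\<bar> + \<bar>C3\<bar> + \<bar>C4\<bar>"
  have "eventually (\<lambda>z. z \<in> W) (nhds 0)" using assms by (intro eventually_nhds_in_open)
  then have "eventually (\<lambda>z. z \<in> W \<and> norm (dz1 f z - taylor_poly m (dz1 f) z) + norm (dzb1 f z - taylor_poly m (dzb1 f) z)
      + norm (dz2 f z - taylor_poly m (dz2 f) z) + norm (dzb2 f z - taylor_poly m (dzb2 f) z) \<le> C * norm z ^ Suc m) (nhds 0)"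
    using eventually_bound_abs[OF C1] eventually_bound_abs[OF C2] eventually_bound_abs[OF C3]
      eventually_bound_abs[OF C4]
    by eventually_elim (unfold C_def distrib_right, blast intro: add_mono)
  then obtain d where d: "d > 0" "\<And>z. norm z < d \<Longrightarrow> z \<in> W \<and>
      norm (dz1 f z - taylor_poly m (dz1 f) z) + norm (dzb1 f z - taylor_poly m (dzb1 f) z)
      + norm (dz2 f z - taylor_poly m (dz2 f) z) + norm (dzb2 f z - taylor_poly m (dzb2 f) z) \<le> C * norm z ^ Suc m"
    by (auto simp: eventually_nhds_metric)
  have C0: "C \<ge> 0" by (simp add: C_def)
  have "norm (f z - taylor_poly (Suc m) f z) \<le> C * norm z ^ Suc (Suc m)" if z: "norm z < d" for z
  proof -
    define h where "h y = f y - taylor_poly (Suc m) f y" for y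
    define h' where "h' y v = fst v * (dz1 f y - taylor_poly m (dz1 f) y) + cnj (fst v) * (dzb1 f y - taylor_poly m (dzb1 f) y)
      + snd v * (dz2 f y - taylor_poly m (dz2 f) y) + cnj (snd v) * (dzb2 f y - taylor_poly m (dzb2 f) y)" for y v
    \<comment> \<open>The remainder vanishes at 0, so its size at \<open>z\<close> is at most
      \<open>norm z\<close> times a bound of its derivative on the ball of radius
      \<open>norm z\<close>; this supplies the additional power.\<close>
    have "norm (h z - h 0) \<le> (C * norm z ^ Suc m) * norm (z - 0)"
    proof (rule differentiable_bound[where S = "cball 0 (norm z)" and f' = h'])
      fix y :: C2 assume "y \<in> cball 0 (norm z)"
      then have y: "norm y \<le> norm z" by simp
      then have y': "norm y < d" using z by simp
      have "(h has_derivative h' y) (at y)"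
        unfolding h_def[abs_def]
        by (rule has_derivative_eq_rhs[OF has_derivative_diff[OF has_derivative_wirtinger
              has_derivative_taylor_poly[OF assms(1) Suc.prems assms(3)]]])
          (use d(2)[OF y'] smooth_on_differentiable[OF Suc.prems assms(1)] in
            \<open>auto simp: h'_def fun_eq_iff algebra_simps\<close>)
      then show "(h has_derivative h' y) (at y within cball 0 (norm z))"
        by (rule has_derivative_at_withinI)
      show "onorm (h' y) \<le> C * norm z ^ Suc m"
      proof (rule onorm_le)
        fix v :: C2
        have a: "norm (fst v) \<le> norm v" "norm (snd v) \<le> norm v"
          by (metis norm_fst_le prod.collapse, metis norm_snd_le prod.collapse)
        have "norm (h' y v) \<le> norm (fst v) * norm (dz1 f y - taylor_poly m (dz1 f) y)
          + norm (fst v) * norm (dzb1 f y - taylor_poly m (dzb1 f) y)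
          + norm (snd v) * norm (dz2 f y - taylor_poly m (dz2 f) y)
          + norm (snd v) * norm (dzb2 f y - taylor_poly m (dzb2 f) y)"
          unfolding h'_def
          by (intro norm_triangle_le add_mono) (auto simp: norm_mult)
        also have "\<dots> \<le> norm v * norm (dz1 f y - taylor_poly m (dz1 f) y)
          + norm v * norm (dzb1 f y - taylor_poly m (dzb1 f) y)
          + norm v * norm (dz2 f y - taylor_poly m (dz2 f) y)
          + norm v * norm (dzb2 f y - taylor_poly m (dzb2 f) y)"
          by (intro add_mono mult_right_mono a norm_ge_zero)
        also have "\<dots> = norm v * (norm (dz1 f y - taylor_poly m (dz1 f) y)
          + norm (dzb1 f y - taylor_poly m (dzb1 f) y) + norm (dz2 f y - taylor_poly m (dz2 f) y)
          + norm (dzb2 f y - taylor_poly m (dzb2 f) y))" by (simp only: distrib_left)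
        also have "\<dots> \<le> norm v * (C * norm y ^ Suc m)"
          using d(2)[OF y'] by (intro mult_left_mono) auto
        also have "\<dots> \<le> norm v * (C * norm z ^ Suc m)"
          by (intro mult_left_mono power_mono y C0 norm_ge_zero)
        finally show "norm (h' y v) \<le> C * norm z ^ Suc m * norm v" by (simp only: mult.commute)
      qed
    qed (auto)
    moreover have "h 0 = 0" by (simp add: h_def taylor_poly_at_0)
    ultimately show ?thesis by (simp add: h_def mult_ac)
  qed
  then show ?case using d(1) by (auto simp: eventually_nhds_metric)
qed

section \<open>Comparison of defining functions and holomorphic maps\<close>

lemma isCont_tendsto_nhds: "isCont f q \<Longrightarrow> (f \<longlongrightarrow> f q) (nhds q)"
  by (simp only: isCont_def tendsto_at_iff_tendsto_nhds)

text \<open>Moving from \<open>x\<close> in the direction \<open>v\<close>, one meets a zero of \<open>r\<close> within distance \<open>\<bar>r x\<bar> * norm v / c\<close>, and \<open>g\<close> vanishes there.\<close>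

lemma bound_by_transversal:
  fixes r :: "'a::real_normed_vector \<Rightarrow> real" and g :: "'a \<Rightarrow> 'b::real_normed_vector"
  assumes c: "c > 0" and d: "d > 0"
    and der: "\<And>x. x \<in> ball q d \<Longrightarrow> (r has_derivative r' x) (at x)" "\<And>x. x \<in> ball q d \<Longrightarrow> r' x v \<ge> c"
    and lip: "B \<ge> 0" "\<And>x y. x \<in> ball q d \<Longrightarrow> y \<in> ball q d \<Longrightarrow> norm (g x - g y) \<le> B * norm (x - y)"
    and zero: "\<And>x. x \<in> ball q d \<Longrightarrow> r x = 0 \<Longrightarrow> g x = 0"
    and x: "norm (x - q) < d / 2" "r x \<le> 0" "\<bar>r x\<bar> * norm v < c * d / 2"
  shows "norm (g x) \<le> B * norm v / c * \<bar>r x\<bar>"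
proof -
  \<comment> \<open>Time after which \<open>r\<close>, rising at rate at least \<open>c\<close>
    along \<open>v\<close>, has climbed from \<open>r x \<le> 0\<close> to a nonnegative
    value.\<close>
  define s where "s = \<bar>r x\<bar> / c"
  have s: "s \<ge> 0" using c by (simp add: s_def)
  have sv: "s * norm v < d / 2" using x(3) c by (simp add: s_def field_simps)
  \<comment> \<open>Half of \<open>d\<close> is spent on the distance of \<open>x\<close> from
    \<open>q\<close>, the other half on the path starting at \<open>x\<close>.\<close>
  have inb: "x + \<sigma> *\<^sub>R v \<in> ball q d" if "0 \<le> \<sigma>" "\<sigma> \<le> s" for \<sigma>
  proof -
    have "norm (x + \<sigma> *\<^sub>R v - q) \<le> norm (x - q) + norm (\<sigma> *\<^sub>R v)"
      by (metis add.commute add_diff_eq diff_add_eq norm_triangle_ineq)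
    also have "norm (\<sigma> *\<^sub>R v) \<le> s * norm v" using that by (simp add: mult_right_mono)
    finally show ?thesis using x(1) sv by (simp add: dist_norm norm_minus_commute)
  qed
  define \<phi> where "\<phi> \<sigma> = r (x + \<sigma> *\<^sub>R v)" for \<sigma>
  have hd: "(\<phi> has_real_derivative r' (x + \<sigma> *\<^sub>R v) v) (at \<sigma>)" if "0 \<le> \<sigma>" "\<sigma> \<le> s" for \<sigma>
  proof -
    have "(\<phi> has_derivative (\<lambda>h. r' (x + \<sigma> *\<^sub>R v) (h *\<^sub>R v))) (at \<sigma>)"
      unfolding \<phi>_def
      by (rule has_derivative_compose[where g = r and f = "\<lambda>\<sigma>. x + \<sigma> *\<^sub>R v", OF _ der(1)[OF inb[OF that]]])
        (auto intro!: derivative_eq_intros)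
    moreover have "linear (r' (x + \<sigma> *\<^sub>R v))" using der(1)[OF inb[OF that]] has_derivative_linear by blast
    ultimately show ?thesis by (simp add: has_field_derivative_def linear_scale mult_commute_abs)
  qed
  have "\<phi> 0 + c * s \<le> \<phi> s"
  proof -
    have "(\<lambda>\<sigma>. \<phi> \<sigma> - c * \<sigma>) 0 \<le> (\<lambda>\<sigma>. \<phi> \<sigma> - c * \<sigma>) s"
    proof (rule DERIV_nonneg_imp_nondecreasing[OF s])
      fix \<sigma> assume \<sigma>: "0 \<le> \<sigma>" "\<sigma> \<le> s"
      have "((\<lambda>\<sigma>. \<phi> \<sigma> - c * \<sigma>) has_real_derivative r' (x + \<sigma> *\<^sub>R v) v - c) (at \<sigma>)"
        by (auto intro!: derivative_eq_intros hd \<sigma>)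
      then show "\<exists>y. ((\<lambda>\<sigma>. \<phi> \<sigma> - c * \<sigma>) has_real_derivative y) (at \<sigma>) \<and> 0 \<le> y"
        using der(2)[OF inb[OF \<sigma>]] by (intro exI conjI) auto
    qed
    then show ?thesis by simp
  qed
  then have end_ge: "0 \<le> \<phi> s" using x(2) c by (simp add: s_def \<phi>_def)
  have cont: "\<forall>\<sigma>. 0 \<le> \<sigma> \<and> \<sigma> \<le> s \<longrightarrow> isCont \<phi> \<sigma>" using hd DERIV_isCont by blast
  obtain \<sigma> where \<sigma>: "0 \<le> \<sigma>" "\<sigma> \<le> s" "\<phi> \<sigma> = 0"
    using IVT[of \<phi> 0 0 s, OF _ end_ge s cont] x(2) by (auto simp: \<phi>_def)
  have "g (x + \<sigma> *\<^sub>R v) = 0" using zero[OF inb[OF \<sigma>(1,2)]] \<sigma>(3) by (simp add: \<phi>_def)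
  then have "norm (g x) = norm (g x - g (x + \<sigma> *\<^sub>R v))" by simp
  also have "\<dots> \<le> B * norm (x - (x + \<sigma> *\<^sub>R v))"
    using inb[of 0] s by (intro lip(2) inb \<sigma>(1,2)) simp
  also have "\<dots> \<le> B * (s * norm v)" using \<sigma> lip(1) by (intro mult_left_mono) (simp_all add: mult_right_mono)
  finally show ?thesis by (simp add: s_def mult_ac)
qed

text \<open>This replaces the divisibility \<open>g = u * r\<close> with \<open>u\<close> smooth: for orders of vanishing the estimate suffices.\<close>

lemma local_defining_function_bounds:
  fixes g :: "C2 \<Rightarrow> 'b::real_normed_vector"
  assumes ldf: "local_defining_function S q r" and q: "q \<in> S"
    and d0: "d0 > 0" and lip: "\<And>x y. x \<in> ball q d0 \<Longrightarrow> y \<in> ball q d0 \<Longrightarrow> norm (g x - g y) \<le> B * norm (x - y)"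
    and zero: "\<And>x. x \<in> ball q d0 \<Longrightarrow> x \<in> S \<Longrightarrow> g x = 0"
  shows "\<exists>C. eventually (\<lambda>x. norm (g x) \<le> C * \<bar>r x\<bar>) (nhds q)"
proof -
  obtain W where W: "open W" "q \<in> W" "smooth_on W r" "S \<inter> W = {x \<in> W. r x = 0}"
    and nz: "\<And>x. x \<in> S \<inter> W \<Longrightarrow> frechet_derivative r (at x) \<noteq> (\<lambda>_. 0)"
    using ldf unfolding local_defining_function_def by blast
  define D where "D x = frechet_derivative r (at x)" for x
  have hd: "(r has_derivative D x) (at x)" if "x \<in> W" for x
    using smooth_on_differentiable[OF W(3,1) that] by (simp add: D_def frechet_derivative_works)
  have rq: "r q = 0" using W q by blast
  obtain v0 where v0: "D q v0 \<noteq> 0" using nz[of q] q W by (auto simp: D_def fun_eq_iff)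
  \<comment> \<open>The sign is chosen so that \<open>r\<close> increases along
    \<open>v\<close>.\<close>
  define v where "v = (if D q v0 > 0 then v0 else - v0)"
  have "linear (D q)" using hd[OF W(2)] has_derivative_linear by blast
  then have v: "D q v > 0" using v0 by (auto simp: v_def linear_neg)
  define c where "c = D q v / 2"
  have c: "c > 0" using v by (simp add: c_def)
  have "continuous_on W (\<lambda>x. D x v)"
    unfolding D_def by (intro smooth_on_continuous smooth_on_frechet_derivative W)
  then have "isCont (\<lambda>x. D x v) q" using W continuous_on_eq_continuous_at by blast
  from isCont_tendsto_nhds[OF this] have "eventually (\<lambda>x. D x v > c) (nhds q)"
    by (rule order_tendstoD(1)) (use v in \<open>simp add: c_def\<close>)
  moreover have "eventually (\<lambda>x. x \<in> W) (nhds q)" using W by (intro eventually_nhds_in_open)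
  ultimately have "eventually (\<lambda>x. x \<in> W \<and> D x v \<ge> c) (nhds q)" by eventually_elim simp
  then obtain d1 where d1: "d1 > 0" "\<And>x. dist x q < d1 \<Longrightarrow> x \<in> W \<and> D x v \<ge> c"
    by (auto simp: eventually_nhds_metric)
  define d where "d = min d0 d1"
  have d: "d > 0" using d0 d1 by (simp add: d_def)
  have dW: "x \<in> W" "D x v \<ge> c" "x \<in> ball q d0" if "x \<in> ball q d" for x
    using d1(2)[of x] that by (auto simp: d_def dist_commute)
  have lip': "norm (g x - g y) \<le> \<bar>B\<bar> * norm (x - y)" if "x \<in> ball q d" "y \<in> ball q d" for x y
    using lip[OF dW(3)[OF that(1)] dW(3)[OF that(2)]] mult_right_mono[OF abs_ge_self[of B] norm_ge_zero[of "x - y"]]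
    by linarith
  have zero': "g x = 0" if "x \<in> ball q d" "r x = 0" for x
    using zero[OF dW(3)[OF that(1)]] W(4) dW(1)[OF that(1)] that(2) by blast
  have "isCont r q" using hd[OF W(2)] has_derivative_continuous by blast
  then have "((\<lambda>x. \<bar>r x\<bar> * norm v) \<longlongrightarrow> \<bar>r q\<bar> * norm v) (nhds q)"
    by (intro tendsto_intros isCont_tendsto_nhds)
  then have "eventually (\<lambda>x. \<bar>r x\<bar> * norm v < c * d / 2) (nhds q)"
    by (rule order_tendstoD(2)) (use rq c d in simp)
  moreover have "eventually (\<lambda>x. x \<in> ball q (d / 2)) (nhds q)"
    using d by (intro eventually_nhds_in_open) auto
  ultimately have "eventually (\<lambda>x. norm (g x) \<le> (\<bar>B\<bar> * norm v / c) * \<bar>r x\<bar>) (nhds q)"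
  proof eventually_elim
    case (elim x)
    then have xd: "norm (x - q) < d / 2" by (simp add: dist_norm norm_minus_commute)
    show ?case
    proof (cases "r x \<le> 0")
      case True
      show ?thesis
        by (rule bound_by_transversal[where r' = D, OF c d]) (use hd dW lip' zero' xd True elim in auto)
    next
      case False
      \<comment> \<open>On the positive side the same argument runs for \<open>- r\<close> in the
        direction \<open>- v\<close>, whose rate of change is again \<open>D y v\<close>.\<close>
      have "norm (g x) \<le> \<bar>B\<bar> * norm (- v) / c * \<bar>- r x\<bar>"
      proof (rule bound_by_transversal[where r = "\<lambda>x. - r x" and r' = "\<lambda>x w. - D x w", OF c d])
        fix y assume y: "y \<in> ball q d"
        show "((\<lambda>x. - r x) has_derivative (\<lambda>w. - D y w)) (at y)"
          using hd[OF dW(1)[OF y]] by (rule has_derivative_minus)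
        show "c \<le> - D y (- v)"
          using dW(2)[OF y] has_derivative_linear[OF hd[OF dW(1)[OF y]]] by (simp add: linear_neg)
      qed (use lip' zero' xd False elim in auto)
      then show ?thesis by simp
    qed
  qed
  then show ?thesis by blast
qed

section \<open>Holomorphic maps along curves\<close>

lemma holo2_comp_curve_deriv:
  assumes L: "(\<Phi> has_derivative L) (at (\<gamma> t))" "\<And>c v. L (c * fst v, c * snd v) = (c * fst (L v), c * snd (L v))"
    and g: "((\<lambda>t. fst (\<gamma> t)) has_field_derivative a) (at t)" "((\<lambda>t. snd (\<gamma> t)) has_field_derivative b) (at t)"
  shows "((\<lambda>t. fst (\<Phi> (\<gamma> t))) has_field_derivative fst (L (a, b))) (at t)"
    "((\<lambda>t. snd (\<Phi> (\<gamma> t))) has_field_derivative snd (L (a, b))) (at t)"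
proof -
  have "((\<lambda>t. (fst (\<gamma> t), snd (\<gamma> t))) has_derivative (\<lambda>h. (a * h, b * h))) (at t)"
    using g unfolding has_field_derivative_def by (intro has_derivative_Pair)
  then have "(\<gamma> has_derivative (\<lambda>h. (a * h, b * h))) (at t)" by simp
  from has_derivative_compose[OF this L(1)]
  have h: "((\<lambda>t. \<Phi> (\<gamma> t)) has_derivative (\<lambda>h. L (a * h, b * h))) (at t)" .
  \<comment> \<open>Complex homogeneity of \<open>L\<close> turns the real chain rule into a complex
    derivative.\<close>
  have "L (a * h, b * h) = (fst (L (a, b)) * h, snd (L (a, b)) * h)" for h
    using L(2)[of h "(a, b)"] by (simp add: mult.commute)
  then have h': "((\<lambda>t. \<Phi> (\<gamma> t)) has_derivative (\<lambda>h. (fst (L (a, b)) * h, snd (L (a, b)) * h))) (at t)"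
    using h by simp
  show "((\<lambda>t. fst (\<Phi> (\<gamma> t))) has_field_derivative fst (L (a, b))) (at t)"
    "((\<lambda>t. snd (\<Phi> (\<gamma> t))) has_field_derivative snd (L (a, b))) (at t)"
    unfolding has_field_derivative_def using has_derivative_fst[OF h'] has_derivative_snd[OF h'] by simp_all
qed

lemma holo_curve_comp:
  assumes "holo2_on \<Phi> U" "holo_curve e \<gamma>" "\<gamma> ` ball 0 e \<subseteq> U"
  shows "holo_curve e (\<lambda>t. \<Phi> (\<gamma> t))"
proof -
  have "(\<lambda>t. fst (\<Phi> (\<gamma> t))) field_differentiable (at t) \<and> (\<lambda>t. snd (\<Phi> (\<gamma> t))) field_differentiable (at t)"
    if t: "t \<in> ball 0 e" for t
  proof -
    obtain L where L: "(\<Phi> has_derivative L) (at (\<gamma> t))"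
      "\<And>c v. L (c * fst v, c * snd v) = (c * fst (L v), c * snd (L v))"
      using assms t unfolding holo2_on_def by blast
    obtain a b where "((\<lambda>t. fst (\<gamma> t)) has_field_derivative a) (at t)"
      "((\<lambda>t. snd (\<gamma> t)) has_field_derivative b) (at t)"
      using assms(2) t unfolding holo_curve_def
      by (meson field_differentiable_def holomorphic_on_imp_differentiable_at open_ball)
    from holo2_comp_curve_deriv[OF L this] show ?thesis unfolding field_differentiable_def by blast
  qed
  then show ?thesis unfolding holo_curve_def holomorphic_on_def
    using field_differentiable_at_within by blast
qed

lemma holo2_on_isCont: "holo2_on \<Phi> U \<Longrightarrow> x \<in> U \<Longrightarrow> isCont \<Phi> x"
  unfolding holo2_on_def using has_derivative_continuous by blast

text \<open>Cauchy's inequality is used on radius \<open>e / 2\<close>, where the closed disc lies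
  in the domain; hence the factor 2.\<close>

lemma cauchy_bound_deriv:
  assumes "f holomorphic_on ball 0 e" "e > 0" "\<And>t. t \<in> ball 0 e \<Longrightarrow> norm (f t) \<le> K"
    "(f has_field_derivative a) (at 0)"
  shows "norm a \<le> 2 * K / e"
proof -
  have "norm ((deriv ^^ 1) f 0) \<le> fact 1 * K / (e / 2) ^ 1"
  proof (rule Cauchy_inequality)
    show "f holomorphic_on ball 0 (e / 2)"
      using assms by (intro holomorphic_on_subset[OF assms(1)]) auto
    show "continuous_on (cball 0 (e / 2)) f"
      using assms by (intro continuous_on_subset[OF holomorphic_on_imp_continuous_on[OF assms(1)]]) auto
  qed (use assms in auto)
  then show ?thesis using DERIV_imp_deriv[OF assms(4)] by (simp add: mult.commute)
qed

text \<open>Since \<^term>\<open>holo2_on\<close> does not require continuity of the derivative, its local boundedness has to come from Cauchy's estimate on complex lines.\<close>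

lemma holo2_on_lipschitz_near:
  assumes h: "holo2_on \<Phi> U" and U: "open U" "p \<in> U"
  obtains d B where "d > 0" "ball p d \<subseteq> U"
    "\<And>x y. x \<in> ball p d \<Longrightarrow> y \<in> ball p d \<Longrightarrow> norm (\<Phi> x - \<Phi> y) \<le> B * norm (x - y)"
proof -
  define K where "K = norm (\<Phi> p) + 1"
  have "isCont (\<lambda>x. norm (\<Phi> x)) p" by (intro isCont_norm holo2_on_isCont[OF h U(2)])
  from isCont_tendsto_nhds[OF this] have "eventually (\<lambda>x. norm (\<Phi> x) < K) (nhds p)"
    by (rule order_tendstoD(2)) (simp add: K_def)
  moreover have "eventually (\<lambda>x. x \<in> U) (nhds p)" using U by (intro eventually_nhds_in_open)
  ultimately have "eventually (\<lambda>x. x \<in> U \<and> norm (\<Phi> x) < K) (nhds p)" by eventually_elim simp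
  then obtain d1 where d1: "d1 > 0" "\<And>x. dist x p < d1 \<Longrightarrow> x \<in> U \<and> norm (\<Phi> x) < K"
    by (auto simp: eventually_nhds_metric)
  \<comment> \<open>Half the radius, so that discs of radius \<open>d\<close> about points of
    \<open>ball p d\<close> still lie in the region where \<open>\<Phi>\<close> is bounded by
    \<open>K\<close>.\<close>
  define d where "d = d1 / 2"
  have d: "d > 0" using d1 by (simp add: d_def)
  have "\<exists>L. (\<Phi> has_derivative L) (at x) \<and> onorm L \<le> 4 * K / d" if x: "x \<in> ball p d" for x
  proof -
    have xU: "x \<in> U" using d1(2)[of x] x d1(1) by (simp add: d_def dist_commute)
    obtain L where L: "(\<Phi> has_derivative L) (at x)"
      "\<And>c v. L (c * fst v, c * snd v) = (c * fst (L v), c * snd (L v))"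
      using h xU unfolding holo2_on_def by blast
    have "norm (L v) \<le> 4 * K / d * norm v" for v
    proof (cases "v = 0")
      case True
      then show ?thesis using has_derivative_linear[OF L(1)] by (simp add: linear_0)
    next
      case False
      \<comment> \<open>The line \<open>\<gamma>\<close> moves by \<open>norm t * norm v\<close>, so
        this parameter radius keeps it within \<open>d\<close> of \<open>x\<close>. Cauchy's bound
        \<open>2 * K / e\<close> for each component then adds up to
        \<open>4 * K / d * norm v\<close>.\<close>
      define e where "e = d / norm v"
      have e: "e > 0" using False d by (simp add: e_def)
      define \<gamma> where "\<gamma> t = (fst x + t * fst v, snd x + t * snd v)" for t :: complex
      have near: "dist (\<gamma> t) p < d1" if "t \<in> ball 0 e" for t
      proof -
        have "norm (t * fst v, t * snd v) = norm t * norm v"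
          by (simp add: norm_prod_def norm_mult power_mult_distrib distrib_left[symmetric] real_sqrt_mult)
        also have "\<dots> < d" using that False by (simp add: e_def field_simps)
        finally have "dist (\<gamma> t) x < d" by (simp add: \<gamma>_def dist_norm prod_eq_iff minus_prod_def)
        moreover have "dist x p < d" using x by (simp add: dist_commute)
        moreover have "dist (\<gamma> t) p \<le> dist (\<gamma> t) x + dist x p" by (rule dist_triangle)
        ultimately show ?thesis by (simp add: d_def)
      qed
      have hc: "holo_curve e (\<lambda>t. \<Phi> (\<gamma> t))"
      proof (rule holo_curve_comp[OF h])
        show "holo_curve e \<gamma>" unfolding holo_curve_def \<gamma>_def by (auto intro!: holomorphic_intros)
        show "\<gamma> ` ball 0 e \<subseteq> U" using near d1(2) by blast
      qed
      have \<gamma>0: "\<gamma> 0 = x" by (simp add: \<gamma>_def)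
      have g: "((\<lambda>t. fst (\<gamma> t)) has_field_derivative fst v) (at 0)"
        "((\<lambda>t. snd (\<gamma> t)) has_field_derivative snd v) (at 0)"
        unfolding \<gamma>_def by (auto intro!: derivative_eq_intros)
      note dd = holo2_comp_curve_deriv[of \<Phi> L \<gamma> 0, unfolded \<gamma>0, OF L g]
      have bnd: "norm (fst (\<Phi> (\<gamma> t))) \<le> K" "norm (snd (\<Phi> (\<gamma> t))) \<le> K" if "t \<in> ball 0 e" for t
        using d1(2)[OF near[OF that]] norm_fst_le[of "fst (\<Phi> (\<gamma> t))" "snd (\<Phi> (\<gamma> t))"]
          norm_snd_le[of "snd (\<Phi> (\<gamma> t))" "fst (\<Phi> (\<gamma> t))"] by auto
      have "norm (fst (L v)) \<le> 2 * K / e" "norm (snd (L v)) \<le> 2 * K / e"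
        using cauchy_bound_deriv[OF _ e bnd(1) dd(1)] cauchy_bound_deriv[OF _ e bnd(2) dd(2)] hc
        by (simp_all add: holo_curve_def)
      then have "norm (L v) \<le> 2 * K / e + 2 * K / e"
        using norm_Pair_le[of "fst (L v)" "snd (L v)"] by simp
      also have "\<dots> = 4 * K / d * norm v" using False d by (simp add: e_def)
      finally show ?thesis .
    qed
    then show ?thesis using L(1) onorm_le by blast
  qed
  then obtain L where L: "\<And>x. x \<in> ball p d \<Longrightarrow> (\<Phi> has_derivative L x) (at x) \<and> onorm (L x) \<le> 4 * K / d"
    by metis
  have "norm (\<Phi> x - \<Phi> y) \<le> 4 * K / d * norm (x - y)" if "x \<in> ball p d" "y \<in> ball p d" for x y
    using that L by (intro differentiable_bound[OF convex_ball, where f' = L]) (auto intro: has_derivative_at_withinI)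
  moreover have "ball p d \<subseteq> U" using d1 by (auto simp: d_def dist_commute)
  ultimately show ?thesis using that d by blast
qed

section \<open>Newton polyhedra and orders of vanishing along curves\<close>

text \<open>The condition under the supremum in \<open>vord\<close>. Orders are compared one
  \<open>N\<close> at a time, infinite order being the case of all \<open>N\<close>. Since
  \<open>nhds 0\<close> takes in 0 itself, a positive \<open>N\<close> forces
  \<open>h 0 = 0\<close>.\<close>

definition vanishes_to :: "(complex \<Rightarrow> 'a::real_normed_vector) \<Rightarrow> nat \<Rightarrow> bool" where
  "vanishes_to h N \<longleftrightarrow> (\<exists>C. eventually (\<lambda>t. norm (h t) \<le> C * norm t ^ N) (nhds 0))"

text \<open>Reduces a face cut out by a supporting hyperplane to the generators on it; for the
  Newton polyhedron and positive weights these are finitely many, which yields compactness of the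
  face.\<close>

lemma convex_hull_Int_supporting_hyperplane:
  fixes S :: "'a::euclidean_space set"
  assumes ge: "\<And>x. x \<in> S \<Longrightarrow> l \<le> a \<bullet> x"
  shows "convex hull S \<inter> {x. a \<bullet> x = l} = convex hull (S \<inter> {x. a \<bullet> x = l})"
proof
  let ?T = "convex hull (S \<inter> {x. a \<bullet> x = l})"
  have T: "?T \<subseteq> {x. a \<bullet> x = l}"
    by (rule hull_minimal) (auto simp: convex_hyperplane)
  show "?T \<subseteq> convex hull S \<inter> {x. a \<bullet> x = l}"
    using T hull_mono[of "S \<inter> {x. a \<bullet> x = l}" S convex] by blast
  let ?Q = "{x. a \<bullet> x > l} \<union> ?T"
  \<comment> \<open>No closedness of the hull is needed: \<open>?Q\<close> is a convex superset of \<open>S\<close> which meets the hyperplane in \<open>?T\<close> only.\<close>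
  have "convex ?Q"
  proof (rule convexI)
    fix x y u v assume x: "x \<in> ?Q" and y: "y \<in> ?Q" and uv: "0 \<le> u" "0 \<le> v" "u + v = (1::real)"
    have xy: "a \<bullet> x - l \<ge> 0" "a \<bullet> y - l \<ge> 0" using x y T by auto
    show "u *\<^sub>R x + v *\<^sub>R y \<in> ?Q"
    proof (cases "u * (a \<bullet> x - l) + v * (a \<bullet> y - l) > 0")
      case True
      moreover have "a \<bullet> (u *\<^sub>R x + v *\<^sub>R y) - (u + v) * l = u * (a \<bullet> x - l) + v * (a \<bullet> y - l)"
        by (simp add: inner_add_right algebra_simps)
      ultimately show ?thesis using uv(3) by simp
    next
      case False
      then have "u * (a \<bullet> x - l) = 0" "v * (a \<bullet> y - l) = 0"
        using mult_nonneg_nonneg[OF uv(1) xy(1)] mult_nonneg_nonneg[OF uv(2) xy(2)] by linarith+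
      then consider "u = 0" | "v = 0" | "x \<in> ?T" "y \<in> ?T" using x y by auto
      then show ?thesis
      proof cases
        case 1
        then show ?thesis using uv y by simp
      next
        case 2
        then show ?thesis using uv x by simp
      next
        case 3
        then have "u *\<^sub>R x + v *\<^sub>R y \<in> ?T" by (rule convexD[OF convex_convex_hull]) (use uv in auto)
        then show ?thesis by blast
      qed
    qed
  qed
  moreover have "S \<subseteq> ?Q"
    using ge hull_subset[of "S \<inter> {x. a \<bullet> x = l}" convex] by force
  ultimately have "convex hull S \<subseteq> ?Q" by (intro hull_minimal)
  then show "convex hull S \<inter> {x. a \<bullet> x = l} \<subseteq> ?T" by auto
qed

definition newton_gens :: "(C2 \<Rightarrow> real) \<Rightarrow> (real \<times> real) set" where
  "newton_gens F = \<Union>{ {(fst (exps \<alpha> \<beta>) + x, snd (exps \<alpha> \<beta>) + y) | x y. x \<ge> 0 \<and> y \<ge> 0}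
         | \<alpha> \<beta>. taylor_coeff F \<alpha> \<beta> \<noteq> 0}"

lemma newton_poly_eq: "newton_poly F = convex hull (newton_gens F)"
  by (simp add: newton_poly_def newton_gens_def)

lemma mem_newton_gens:
  "\<xi> \<in> newton_gens F \<longleftrightarrow> (\<exists>\<alpha> \<beta>. taylor_coeff F \<alpha> \<beta> \<noteq> 0 \<and> fst (exps \<alpha> \<beta>) \<le> fst \<xi> \<and> snd (exps \<alpha> \<beta>) \<le> snd \<xi>)"
proof
  assume "\<exists>\<alpha> \<beta>. taylor_coeff F \<alpha> \<beta> \<noteq> 0 \<and> fst (exps \<alpha> \<beta>) \<le> fst \<xi> \<and> snd (exps \<alpha> \<beta>) \<le> snd \<xi>"
  then obtain \<alpha> \<beta> where h: "taylor_coeff F \<alpha> \<beta> \<noteq> 0" "fst (exps \<alpha> \<beta>) \<le> fst \<xi>" "snd (exps \<alpha> \<beta>) \<le> snd \<xi>"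
    by blast
  then have "\<xi> = (fst (exps \<alpha> \<beta>) + (fst \<xi> - fst (exps \<alpha> \<beta>)), snd (exps \<alpha> \<beta>) + (snd \<xi> - snd (exps \<alpha> \<beta>)))"
    by simp
  moreover have "fst \<xi> - fst (exps \<alpha> \<beta>) \<ge> 0" "snd \<xi> - snd (exps \<alpha> \<beta>) \<ge> 0" using h by auto
  ultimately have "\<xi> \<in> {(fst (exps \<alpha> \<beta>) + x, snd (exps \<alpha> \<beta>) + y) | x y. x \<ge> 0 \<and> y \<ge> 0}" by blast
  then show "\<xi> \<in> newton_gens F" using h(1) unfolding newton_gens_def by blast
next
  assume "\<xi> \<in> newton_gens F"
  then obtain \<alpha> \<beta> x y where h: "taylor_coeff F \<alpha> \<beta> \<noteq> 0" "x \<ge> 0" "y \<ge> 0"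
    "\<xi> = (fst (exps \<alpha> \<beta>) + x, snd (exps \<alpha> \<beta>) + y)"
    unfolding newton_gens_def by blast
  then have "taylor_coeff F \<alpha> \<beta> \<noteq> 0 \<and> fst (exps \<alpha> \<beta>) \<le> fst \<xi> \<and> snd (exps \<alpha> \<beta>) \<le> snd \<xi>" by simp
  then show "\<exists>\<alpha> \<beta>. taylor_coeff F \<alpha> \<beta> \<noteq> 0 \<and> fst (exps \<alpha> \<beta>) \<le> fst \<xi> \<and> snd (exps \<alpha> \<beta>) \<le> snd \<xi>" by blast
qed

lemma exps_mem_newton_poly: "taylor_coeff F \<alpha> \<beta> \<noteq> 0 \<Longrightarrow> exps \<alpha> \<beta> \<in> newton_poly F"
  unfolding newton_poly_eq by (rule hull_inc) (use mem_newton_gens in blast)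

text \<open>A nonnegative weight can only grow on the quadrant attached to an exponent, so the
  exponents decide.\<close>

lemma newton_gens_ge:
  assumes "a1 \<ge> 0" "a2 \<ge> 0" "\<And>\<alpha> \<beta>. taylor_coeff F \<alpha> \<beta> \<noteq> 0 \<Longrightarrow> l \<le> (a1, a2) \<bullet> exps \<alpha> \<beta>"
    and "\<xi> \<in> newton_gens F"
  shows "l \<le> (a1, a2) \<bullet> \<xi>"
proof -
  obtain \<alpha> \<beta> where h: "taylor_coeff F \<alpha> \<beta> \<noteq> 0" "fst (exps \<alpha> \<beta>) \<le> fst \<xi>" "snd (exps \<alpha> \<beta>) \<le> snd \<xi>"
    using assms(4) mem_newton_gens by blast
  have "l \<le> (a1, a2) \<bullet> exps \<alpha> \<beta>" using assms(3) h(1) by blast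
  also have "\<dots> = a1 * fst (exps \<alpha> \<beta>) + a2 * snd (exps \<alpha> \<beta>)" by (simp add: inner_prod_def)
  also have "\<dots> \<le> a1 * fst \<xi> + a2 * snd \<xi>" using h assms(1,2) by (intro add_mono mult_left_mono)
  finally show ?thesis by (simp add: inner_prod_def)
qed

lemma newton_poly_ge:
  assumes "a1 \<ge> 0" "a2 \<ge> 0" "\<And>\<alpha> \<beta>. taylor_coeff F \<alpha> \<beta> \<noteq> 0 \<Longrightarrow> l \<le> (a1, a2) \<bullet> exps \<alpha> \<beta>"
    and "\<xi> \<in> newton_poly F"
  shows "l \<le> (a1, a2) \<bullet> \<xi>"
proof -
  have "newton_poly F \<subseteq> {\<xi>. l \<le> (a1, a2) \<bullet> \<xi>}"
    unfolding newton_poly_eq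
    by (rule hull_minimal) (use newton_gens_ge[OF assms(1-3)] in \<open>auto simp: convex_halfspace_ge\<close>)
  then show ?thesis using assms(4) by blast
qed

text \<open>The power of a real parameter \<open>s\<close> that the monomial with exponents
  \<open>x\<close> acquires along a curve with exponents \<open>a1\<close> and
  \<open>a2\<close>.\<close>

definition weight :: "nat \<Rightarrow> nat \<Rightarrow> (nat \<times> nat) \<times> (nat \<times> nat) \<Rightarrow> nat" where
  "weight a1 a2 x = a1 * (fst (fst x) + fst (snd x)) + a2 * (snd (fst x) + snd (snd x))"

lemma inner_exps: "(real a1, real a2) \<bullet> exps \<alpha> \<beta> = real (weight a1 a2 (\<alpha>, \<beta>))"
  by (simp add: inner_prod_def exps_def weight_def algebra_simps)

text \<open>With both weights positive, moving from an exponent on the hyperplane into its quadrant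
  leaves the hyperplane at once. So the generators on it are exponents, integral points in a box of
  side \<open>l\<close>, and the face is the hull of finitely many points.\<close>

lemma compact_face_weight:
  fixes a1 a2 l :: nat
  assumes a: "a1 > 0" "a2 > 0"
    and ge: "\<And>\<alpha> \<beta>. taylor_coeff F \<alpha> \<beta> \<noteq> 0 \<Longrightarrow> l \<le> weight a1 a2 (\<alpha>, \<beta>)"
    and eq: "taylor_coeff F \<alpha>' \<beta>' \<noteq> 0" "weight a1 a2 (\<alpha>', \<beta>') = l"
  shows "compact_face {\<xi> \<in> newton_poly F. real a1 * fst \<xi> + real a2 * snd \<xi> = real l} (newton_poly F)"
proof -
  let ?a = "(real a1, real a2)"
  have ge': "taylor_coeff F \<alpha> \<beta> \<noteq> 0 \<Longrightarrow> real l \<le> ?a \<bullet> exps \<alpha> \<beta>" for \<alpha> \<beta>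
    using ge inner_exps by simp
  have eqset: "{\<xi> \<in> newton_poly F. real a1 * fst \<xi> + real a2 * snd \<xi> = real l}
      = newton_poly F \<inter> {\<xi>. ?a \<bullet> \<xi> = real l}"
    by (auto simp: inner_prod_def)
  have "newton_poly F \<inter> {\<xi>. ?a \<bullet> \<xi> = real l} = convex hull (newton_gens F \<inter> {\<xi>. ?a \<bullet> \<xi> = real l})"
    unfolding newton_poly_eq
    by (rule convex_hull_Int_supporting_hyperplane) (rule newton_gens_ge, use ge' in auto)
  moreover have "finite (newton_gens F \<inter> {\<xi>. ?a \<bullet> \<xi> = real l})"
  proof (rule finite_subset)
    show "newton_gens F \<inter> {\<xi>. ?a \<bullet> \<xi> = real l} \<subseteq> (\<lambda>(m, n). (real m, real n)) ` ({..l} \<times> {..l})"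
    proof
      fix \<xi> assume \<xi>: "\<xi> \<in> newton_gens F \<inter> {\<xi>. ?a \<bullet> \<xi> = real l}"
      then obtain \<alpha> \<beta> where h: "taylor_coeff F \<alpha> \<beta> \<noteq> 0" "fst (exps \<alpha> \<beta>) \<le> fst \<xi>" "snd (exps \<alpha> \<beta>) \<le> snd \<xi>"
        using mem_newton_gens by blast
      have "real l \<le> real a1 * fst (exps \<alpha> \<beta>) + real a2 * snd (exps \<alpha> \<beta>)"
        using ge'[OF h(1)] by (simp add: inner_prod_def)
      moreover have "real a1 * fst (exps \<alpha> \<beta>) \<le> real a1 * fst \<xi>" "real a2 * snd (exps \<alpha> \<beta>) \<le> real a2 * snd \<xi>"
        using h by (auto intro: mult_left_mono)
      moreover have l: "real a1 * fst \<xi> + real a2 * snd \<xi> = real l" using \<xi> by (simp add: inner_prod_def)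
      \<comment> \<open>Two inequalities whose sum is an equality are equalities; cancelling the
        positive weights puts \<xi> at an exponent.\<close>
      ultimately have "real a1 * fst (exps \<alpha> \<beta>) = real a1 * fst \<xi>" "real a2 * snd (exps \<alpha> \<beta>) = real a2 * snd \<xi>"
        by linarith+
      then have \<xi>e: "\<xi> = exps \<alpha> \<beta>" using a by (simp add: prod_eq_iff)
      then have "real (weight a1 a2 (\<alpha>, \<beta>)) = real l" using \<xi> inner_exps by auto
      then have w: "weight a1 a2 (\<alpha>, \<beta>) = l" by simp
      have "fst \<alpha> + fst \<beta> \<le> a1 * (fst \<alpha> + fst \<beta>)" "snd \<alpha> + snd \<beta> \<le> a2 * (snd \<alpha> + snd \<beta>)" using a by auto
      then have "fst \<alpha> + fst \<beta> \<le> l" "snd \<alpha> + snd \<beta> \<le> l"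
        using w[unfolded weight_def fst_conv snd_conv] by linarith+
      then show "\<xi> \<in> (\<lambda>(m, n). (real m, real n)) ` ({..l} \<times> {..l})"
        unfolding \<xi>e exps_def by (intro image_eqI[where x = "(fst \<alpha> + fst \<beta>, snd \<alpha> + snd \<beta>)"]) auto
    qed
  qed simp
  ultimately have "compact (newton_poly F \<inter> {\<xi>. ?a \<bullet> \<xi> = real l})"
    by (simp add: finite_imp_compact_convex_hull)
  moreover have "(newton_poly F \<inter> {\<xi>. ?a \<bullet> \<xi> = real l}) face_of newton_poly F"
  proof (rule face_of_Int_supporting_hyperplane_ge)
    show "convex (newton_poly F)" by (simp add: newton_poly_eq)
    show "real l \<le> ?a \<bullet> \<xi>" if "\<xi> \<in> newton_poly F" for \<xi>
      using newton_poly_ge[OF _ _ ge' that] by simp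
  qed
  moreover have "exps \<alpha>' \<beta>' \<in> newton_poly F \<inter> {\<xi>. ?a \<bullet> \<xi> = real l}"
    using exps_mem_newton_poly[OF eq(1)] eq(2) inner_exps by simp
  ultimately show ?thesis unfolding compact_face_def eqset by blast
qed

text \<open>The factor \<open>s\<close> is real, so conjugation leaves it alone, and holomorphic and
  antiholomorphic exponents contribute alike.\<close>

lemma mono_scale:
  "mono (of_real s ^ a1 * u, of_real s ^ a2 * v) \<alpha> \<beta> = of_real s ^ weight a1 a2 (\<alpha>, \<beta>) * mono (u, v) \<alpha> \<beta>"
  by (simp add: mono_def weight_def power_mult_distrib power_add power_mult algebra_simps)

lemma tendsto_mono:
  assumes "(u \<longlongrightarrow> u0) G" "(v \<longlongrightarrow> v0) G"
  shows "((\<lambda>s. mono (u s, v s) \<alpha> \<beta>) \<longlongrightarrow> mono (u0, v0) \<alpha> \<beta>) G"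
  unfolding mono_def fst_conv snd_conv
  by (intro tendsto_intros assms)

text \<open>The minimum of the weight \<open>(a1, a2)\<close> on the polyhedron is attained on a compact face \<open>\<kappa>\<close>. By nondegeneracy the face part is nonzero at some point of the monomial curve with the leading coefficients of \<open>h1\<close> and \<open>h2\<close>; along the real ray of parameters through that point it is the leading term of \<open>F\<close>.\<close>

lemma order_le_weight:
  fixes F :: "C2 \<Rightarrow> real" and a1 a2 N :: nat
  assumes W: "open W" "0 \<in> W" and sm: "smooth_on W F" and nd: "N_nondegenerate F"
    and a: "a1 > 0" "a2 > 0"
    and h: "isCont h1 0" "isCont h2 0" "h1 0 \<noteq> 0" "h2 0 \<noteq> 0"
    and van: "vanishes_to (\<lambda>t. F (t ^ a1 * h1 t, t ^ a2 * h2 t)) N"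
    and \<xi>: "\<xi> \<in> newton_poly F"
  shows "real N \<le> real a1 * fst \<xi> + real a2 * snd \<xi>"
proof -
  define f where "f z = complex_of_real (F z)" for z
  have smf: "smooth_on W f"
    unfolding f_def by (rule smooth_on_bounded_linear[OF W(1) bounded_linear_of_real sm])
  have tc: "taylor_coeff F (fst x) (snd x) = wirt_coeff f x" for x
    by (simp add: taylor_coeff_eq_wirt_coeff f_def[abs_def])
  define w where "w = weight a1 a2"
  have "newton_gens F \<noteq> {}" using \<xi> unfolding newton_poly_eq by auto
  then have ex: "\<exists>n x. wirt_coeff f x \<noteq> 0 \<and> w x = n" by (metis equals0I mem_newton_gens tc prod.sel)
  define l where "l = (LEAST n. \<exists>x. wirt_coeff f x \<noteq> 0 \<and> w x = n)"
  obtain x0 where x0: "wirt_coeff f x0 \<noteq> 0" "w x0 = l" using LeastI_ex[OF ex] unfolding l_def by blast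
  have lmin: "l \<le> w x" if "wirt_coeff f x \<noteq> 0" for x
    unfolding l_def by (rule Least_le) (use that in blast)
  have lmin': "l \<le> weight a1 a2 (\<alpha>, \<beta>)" if "taylor_coeff F \<alpha> \<beta> \<noteq> 0" for \<alpha> \<beta>
    using lmin[of "(\<alpha>, \<beta>)"] tc[of "(\<alpha>, \<beta>)"] that by (simp add: w_def)
  define \<kappa> where "\<kappa> = {\<xi> \<in> newton_poly F. real a1 * fst \<xi> + real a2 * snd \<xi> = real l}"
  have face: "compact_face \<kappa> (newton_poly F)"
    unfolding \<kappa>_def
    by (rule compact_face_weight[OF a lmin', where \<alpha>' = "fst x0" and \<beta>' = "snd x0"]) (use x0 tc in \<open>auto simp: w_def\<close>)
  define \<gamma>0 where "\<gamma>0 t = (h1 0 * t ^ a1, h2 0 * t ^ a2)" for t :: complex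
  have "\<gamma>0 \<in> Gamma_face (newton_poly F) \<kappa>"
    unfolding Gamma_face_def \<kappa>_def \<gamma>0_def[abs_def] using h by blast
  then obtain t0 where t0: "face_part F \<kappa> (\<gamma>0 t0) \<noteq> 0"
    using nd face unfolding N_nondegenerate_def by blast
  \<comment> \<open>Exponents of weight \<open>l\<close> have total degree at most \<open>l\<close>,
    because \<open>a1\<close> and \<open>a2\<close> are at least 1; hence the face part is a finite
    sum inside the Taylor polynomial of degree \<open>l\<close>.\<close>
  define J where "J = {x \<in> taylor_index l. w x = l \<and> wirt_coeff f x \<noteq> 0}"
  have le_weight: "fst (fst x) + snd (fst x) + fst (snd x) + snd (snd x) \<le> w x" for x
  proof -
    have "fst (fst x) + fst (snd x) \<le> a1 * (fst (fst x) + fst (snd x))"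
      "snd (fst x) + snd (snd x) \<le> a2 * (snd (fst x) + snd (snd x))" using a by auto
    then show ?thesis unfolding w_def weight_def by linarith
  qed
  have face_weight: "w (\<alpha>, \<beta>) = l" if "exps \<alpha> \<beta> \<in> \<kappa>" for \<alpha> \<beta>
  proof -
    have "real (w (\<alpha>, \<beta>)) = real l"
      using that unfolding \<kappa>_def w_def inner_exps[symmetric] by (simp add: inner_prod_def)
    then show ?thesis by simp
  qed
  have fp: "face_part F \<kappa> z = (\<Sum>x\<in>J. wirt_coeff f x * mono z (fst x) (snd x))" for z
  proof -
    let ?K = "{(\<alpha>, \<beta>). exps \<alpha> \<beta> \<in> \<kappa>}"
    have "face_part F \<kappa> z = (\<Sum>x\<in>?K. wirt_coeff f x * mono z (fst x) (snd x))"
      unfolding face_part_def by (rule sum.cong[OF refl]) (auto simp: tc[symmetric])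
    also have "\<dots> = (\<Sum>x\<in>J. wirt_coeff f x * mono z (fst x) (snd x))"
    proof (rule sum.mono_neutral_right)
      have "?K \<subseteq> taylor_index l" using face_weight le_weight by (fastforce simp: taylor_index_def)
      then show "finite ?K" by (rule finite_subset) simp
      show "\<forall>x\<in>?K - J. wirt_coeff f x * mono z (fst x) (snd x) = 0"
        using face_weight \<open>?K \<subseteq> taylor_index l\<close> by (auto simp: J_def)
      show "J \<subseteq> ?K"
      proof
        fix x assume x: "x \<in> J"
        then have "exps (fst x) (snd x) \<in> newton_poly F" using exps_mem_newton_poly tc by (simp add: J_def)
        moreover have "(real a1, real a2) \<bullet> exps (fst x) (snd x) = real l"
          using x by (simp add: inner_exps J_def w_def)
        ultimately show "x \<in> ?K" by (simp add: \<kappa>_def inner_prod_def case_prod_beta)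
      qed
    qed
    finally show ?thesis .
  qed
  let ?G = "at_right (0::real)"
  define T where "T s = of_real s * t0" for s
  have Tlim: "(T \<longlongrightarrow> 0) ?G"
    unfolding T_def[abs_def] by (rule tendsto_eq_rhs[OF tendsto_mult_right[OF tendsto_of_real[OF tendsto_ident_at]]]) simp
  define \<gamma> where "\<gamma> t = (t ^ a1 * h1 t, t ^ a2 * h2 t)" for t
  have h1T: "((\<lambda>s. h1 (T s)) \<longlongrightarrow> h1 0) ?G" and h2T: "((\<lambda>s. h2 (T s)) \<longlongrightarrow> h2 0) ?G"
    using isCont_tendsto_compose[OF h(1) Tlim] isCont_tendsto_compose[OF h(2) Tlim] by auto
  have \<gamma>T: "\<gamma> (T s) = (of_real s ^ a1 * (t0 ^ a1 * h1 (T s)), of_real s ^ a2 * (t0 ^ a2 * h2 (T s)))" for s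
    by (simp add: \<gamma>_def T_def power_mult_distrib)
  \<comment> \<open>What remains of a monomial along the ray once its power of \<open>s\<close> is
    split off; it tends to the monomial at \<open>\<gamma>0 t0\<close>.\<close>
  define m where "m x s = mono (t0 ^ a1 * h1 (T s), t0 ^ a2 * h2 (T s)) (fst x) (snd x)" for x s
  have mlim: "(m x \<longlongrightarrow> mono (\<gamma>0 t0) (fst x) (snd x)) ?G" for x
    unfolding m_def[abs_def] \<gamma>0_def
    by (rule tendsto_mono) (rule tendsto_eq_rhs[OF tendsto_mult_left[OF h1T]], simp,
        rule tendsto_eq_rhs[OF tendsto_mult_left[OF h2T]], simp)
  have pos: "eventually (\<lambda>s. s > 0 \<and> s \<le> 1) ?G"
    by (auto simp: eventually_at_right_field intro: exI[of _ 1])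
  \<comment> \<open>A term of weight above \<open>l\<close> keeps a positive power of
    \<open>s\<close> and dies in the limit; no nonzero coefficient has smaller weight, so exactly
    the face survives.\<close>
  have term_lim: "((\<lambda>s. wirt_coeff f x * mono (\<gamma> (T s)) (fst x) (snd x) / of_real s ^ l) \<longlongrightarrow>
      (if x \<in> J then wirt_coeff f x * mono (\<gamma>0 t0) (fst x) (snd x) else 0)) ?G" if xi: "x \<in> taylor_index l" for x
  proof (cases "wirt_coeff f x = 0")
    case True
    then show ?thesis by (simp add: J_def)
  next
    case False
    then have wl: "l \<le> w x" by (rule lmin)
    have eq: "wirt_coeff f x * of_real s ^ (w x - l) * m x s = wirt_coeff f x * mono (\<gamma> (T s)) (fst x) (snd x) / of_real s ^ l"
      if "s > 0 \<and> s \<le> 1" for s :: real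
    proof -
      have "mono (\<gamma> (T s)) (fst x) (snd x) = of_real s ^ w x * m x s"
        unfolding \<gamma>T mono_scale m_def by (simp add: w_def)
      also have "of_real s ^ w x = (of_real s ^ (w x - l) * of_real s ^ l :: complex)"
        using wl by (simp flip: power_add)
      finally show ?thesis using that by simp
    qed
    have "((\<lambda>s. wirt_coeff f x * of_real s ^ (w x - l) * m x s) \<longlongrightarrow>
        wirt_coeff f x * of_real 0 ^ (w x - l) * mono (\<gamma>0 t0) (fst x) (snd x)) ?G"
      by (intro tendsto_intros mlim)
    then have "((\<lambda>s. wirt_coeff f x * mono (\<gamma> (T s)) (fst x) (snd x) / of_real s ^ l) \<longlongrightarrow>
        wirt_coeff f x * of_real 0 ^ (w x - l) * mono (\<gamma>0 t0) (fst x) (snd x)) ?G"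
      by (rule Lim_transform_eventually) (use pos in \<open>eventually_elim; use eq in blast\<close>)
    then show ?thesis
      by (rule tendsto_eq_rhs) (use wl False xi in \<open>auto simp: J_def power_0_left\<close>)
  qed
  have sumlim: "((\<lambda>s. taylor_poly l f (\<gamma> (T s)) / of_real s ^ l) \<longlongrightarrow> face_part F \<kappa> (\<gamma>0 t0)) ?G"
  proof -
    have "((\<lambda>s. \<Sum>x\<in>taylor_index l. wirt_coeff f x * mono (\<gamma> (T s)) (fst x) (snd x) / of_real s ^ l) \<longlongrightarrow>
      (\<Sum>x\<in>taylor_index l. if x \<in> J then wirt_coeff f x * mono (\<gamma>0 t0) (fst x) (snd x) else 0)) ?G"
      by (intro tendsto_sum term_lim)
    moreover have "(\<Sum>x\<in>taylor_index l. if x \<in> J then wirt_coeff f x * mono (\<gamma>0 t0) (fst x) (snd x) else 0)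
      = face_part F \<kappa> (\<gamma>0 t0)"
      unfolding fp by (subst sum.inter_restrict[symmetric]) (auto simp: J_def intro!: sum.cong)
    ultimately show ?thesis by (simp add: taylor_poly_def sum_divide_distrib)
  qed
  have \<gamma>lim: "((\<lambda>s. \<gamma> (T s)) \<longlongrightarrow> 0) ?G"
  proof -
    have "((\<lambda>s. (T s ^ a1 * h1 (T s), T s ^ a2 * h2 (T s))) \<longlongrightarrow> (0 ^ a1 * h1 0, 0 ^ a2 * h2 0)) ?G"
      by (intro tendsto_intros Tlim h1T h2T)
    then show ?thesis using a by (simp add: \<gamma>_def zero_prod_def power_0_left)
  qed
  have remlim: "((\<lambda>s. (f (\<gamma> (T s)) - taylor_poly l f (\<gamma> (T s))) / of_real s ^ l) \<longlongrightarrow> 0) ?G"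
  proof -
    obtain C where C: "eventually (\<lambda>z. norm (f z - taylor_poly l f z) \<le> C * norm z ^ Suc l) (nhds 0)"
      using taylor_expansion[OF W(1) smf W(2)] by blast
    have ev: "eventually (\<lambda>s. norm (f (\<gamma> (T s)) - taylor_poly l f (\<gamma> (T s))) \<le> \<bar>C\<bar> * norm (\<gamma> (T s)) ^ Suc l) ?G"
      using eventually_bound_abs[OF C] \<gamma>lim by (rule eventually_compose_filterlim)
    \<comment> \<open>Since \<open>a1\<close> and \<open>a2\<close> are at least 1 and
      \<open>s \<le> 1\<close>, the curve is bounded by \<open>K s * s\<close>; a remainder of order
      \<open>Suc l\<close> therefore leaves one factor \<open>s\<close> after division by
      \<open>s ^ l\<close>.\<close>
    define K where "K s = norm (t0 ^ a1 * h1 (T s)) + norm (t0 ^ a2 * h2 (T s))" for s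
    have "((\<lambda>s. \<bar>C\<bar> * K s ^ Suc l * s) \<longlongrightarrow> \<bar>C\<bar> * (norm (t0 ^ a1 * h1 0) + norm (t0 ^ a2 * h2 0)) ^ Suc l * 0) ?G"
      unfolding K_def by (intro tendsto_intros h1T h2T)
    then have "((\<lambda>s. \<bar>C\<bar> * K s ^ Suc l * s) \<longlongrightarrow> 0) ?G" by simp
    moreover have "eventually (\<lambda>s. norm ((f (\<gamma> (T s)) - taylor_poly l f (\<gamma> (T s))) / of_real s ^ l)
        \<le> \<bar>C\<bar> * K s ^ Suc l * s) ?G"
      using ev pos
    proof eventually_elim
      case (elim s)
      then have s: "s > 0" "s \<le> 1" by auto
      have sa: "s ^ k \<le> s" if "k > 0" for k :: nat
        using power_decreasing[of 1 k s] that s by simp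
      have "norm (\<gamma> (T s)) \<le> norm (of_real s ^ a1 * (t0 ^ a1 * h1 (T s))) + norm (of_real s ^ a2 * (t0 ^ a2 * h2 (T s)))"
        unfolding \<gamma>T by (rule norm_Pair_le)
      also have "\<dots> = s ^ a1 * norm (t0 ^ a1 * h1 (T s)) + s ^ a2 * norm (t0 ^ a2 * h2 (T s))"
        using s by (simp add: norm_mult norm_power)
      also have "\<dots> \<le> s * norm (t0 ^ a1 * h1 (T s)) + s * norm (t0 ^ a2 * h2 (T s))"
        by (intro add_mono mult_right_mono sa a norm_ge_zero)
      also have "\<dots> = K s * s" by (simp add: K_def algebra_simps)
      finally have n: "norm (\<gamma> (T s)) \<le> K s * s" .
      have "norm (f (\<gamma> (T s)) - taylor_poly l f (\<gamma> (T s))) \<le> \<bar>C\<bar> * norm (\<gamma> (T s)) ^ Suc l" using elim by blast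
      also have "\<dots> \<le> \<bar>C\<bar> * (K s * s) ^ Suc l" by (intro mult_left_mono power_mono n) auto
      also have "\<dots> = \<bar>C\<bar> * K s ^ Suc l * s * s ^ l" by (simp add: power_mult_distrib)
      finally show ?case using s by (simp add: norm_divide norm_power divide_le_eq)
    qed
    ultimately show ?thesis by (rule Lim_null_comparison[rotated])
  qed
  have flim: "((\<lambda>s. f (\<gamma> (T s)) / of_real s ^ l) \<longlongrightarrow> face_part F \<kappa> (\<gamma>0 t0)) ?G"
    using tendsto_add[OF remlim sumlim] by (simp add: diff_divide_distrib)
  \<comment> \<open>Vanishing to an order above \<open>l\<close> would make the quotient by
    \<open>s ^ l\<close> tend to 0, although its limit is the nonzero face part.\<close>
  have "N \<le> l"
  proof (rule ccontr)
    assume "\<not> N \<le> l"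
    then have Nl: "l < N" by simp
    obtain C where C: "eventually (\<lambda>t. norm (F (\<gamma> t)) \<le> C * norm t ^ N) (nhds 0)"
      using van unfolding vanishes_to_def \<gamma>_def by blast
    have ev: "eventually (\<lambda>s. norm (F (\<gamma> (T s))) \<le> C * norm (T s) ^ N) ?G"
      using C Tlim by (rule eventually_compose_filterlim)
    have "((\<lambda>s. C * norm t0 ^ N * s ^ (N - l)) \<longlongrightarrow> C * norm t0 ^ N * 0 ^ (N - l)) ?G"
      by (intro tendsto_intros)
    then have "((\<lambda>s. C * norm t0 ^ N * s ^ (N - l)) \<longlongrightarrow> 0) ?G" using Nl by (simp add: power_0_left)
    moreover have "eventually (\<lambda>s. norm (f (\<gamma> (T s)) / of_real s ^ l) \<le> C * norm t0 ^ N * s ^ (N - l)) ?G"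
      using ev pos
    proof eventually_elim
      case (elim s)
      have "norm (f (\<gamma> (T s))) \<le> C * norm (T s) ^ N" using elim by (simp add: f_def)
      also have "\<dots> = C * norm t0 ^ N * (s ^ (N - l) * s ^ l)"
        using elim Nl by (simp add: T_def norm_mult power_mult_distrib flip: power_add)
      finally show ?case using elim by (simp add: norm_divide norm_power divide_le_eq)
    qed
    ultimately have "((\<lambda>s. f (\<gamma> (T s)) / of_real s ^ l) \<longlongrightarrow> 0) ?G"
      by (rule Lim_null_comparison[rotated])
    then have "face_part F \<kappa> (\<gamma>0 t0) = 0"
      using tendsto_unique[OF _ flim] by (simp add: trivial_limit_at_right_real)
    then show False using t0 by simp
  qed
  moreover have "real l \<le> (real a1, real a2) \<bullet> \<xi>"
    by (rule newton_poly_ge[OF _ _ _ \<xi>]) (use lmin' inner_exps in auto)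
  ultimately show ?thesis by (simp add: inner_prod_def)
qed

section \<open>Calculus of orders of vanishing, and contact orders of curves\<close>

lemma vanishes_to_mono:
  assumes "vanishes_to h N" "M \<le> N"
  shows "vanishes_to h M"
proof -
  obtain C where C: "eventually (\<lambda>t. norm (h t) \<le> C * norm t ^ N) (nhds 0)"
    using assms(1) unfolding vanishes_to_def by blast
  have "eventually (\<lambda>t::complex. t \<in> ball 0 1) (nhds 0)" by (intro eventually_nhds_in_open) auto
  with eventually_bound_abs[OF C] have "eventually (\<lambda>t. norm (h t) \<le> \<bar>C\<bar> * norm t ^ M) (nhds 0)"
  proof eventually_elim
    case (elim t)
    have "\<bar>C\<bar> * norm t ^ N \<le> \<bar>C\<bar> * norm t ^ M"
      using elim(2) assms(2) by (intro mult_left_mono power_decreasing) auto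
    then show ?case using elim(1) by linarith
  qed
  then show ?thesis unfolding vanishes_to_def by blast
qed

lemma vanishes_to_dominated:
  assumes "vanishes_to h N" "eventually (\<lambda>t. norm (g t) \<le> B * norm (h t)) (nhds 0)"
  shows "vanishes_to g N"
proof -
  obtain C where "eventually (\<lambda>t. norm (h t) \<le> C * norm t ^ N) (nhds 0)"
    using assms(1) unfolding vanishes_to_def by blast
  with assms(2) have "eventually (\<lambda>t. norm (g t) \<le> (\<bar>B\<bar> * C) * norm t ^ N) (nhds 0)"
  proof eventually_elim
    case (elim t)
    have "B * norm (h t) \<le> \<bar>B\<bar> * norm (h t)" by (intro mult_right_mono) auto
    also have "\<dots> \<le> \<bar>B\<bar> * (C * norm t ^ N)" using elim by (intro mult_left_mono) auto
    finally show ?case using elim by (simp add: mult.assoc)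
  qed
  then show ?thesis unfolding vanishes_to_def by blast
qed

lemma vanishes_to_cong:
  assumes "vanishes_to h N" "eventually (\<lambda>t. g t = h t) (nhds 0)"
  shows "vanishes_to g N"
  using assms(1) by (rule vanishes_to_dominated[where B = 1]) (use assms(2) in \<open>eventually_elim; simp\<close>)

lemma vanishes_to_add:
  assumes "vanishes_to g N" "vanishes_to h N"
  shows "vanishes_to (\<lambda>t. g t + h t) N"
proof -
  obtain C D where "eventually (\<lambda>t. norm (g t) \<le> C * norm t ^ N) (nhds 0)"
    "eventually (\<lambda>t. norm (h t) \<le> D * norm t ^ N) (nhds 0)"
    using assms unfolding vanishes_to_def by blast
  then have "eventually (\<lambda>t. norm (g t + h t) \<le> (C + D) * norm t ^ N) (nhds 0)"
    unfolding distrib_right by eventually_elim (rule norm_triangle_le, rule add_mono)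
  then show ?thesis unfolding vanishes_to_def by blast
qed

lemma vanishes_to_power_mult:
  fixes h :: "complex \<Rightarrow> complex"
  assumes "isCont h 0"
  shows "vanishes_to (\<lambda>t. t ^ n * h t) n"
proof -
  from isCont_tendsto_nhds[OF isCont_norm[OF assms]]
  have "eventually (\<lambda>t. norm (h t) < norm (h 0) + 1) (nhds 0)" by (rule order_tendstoD(2)) simp
  then have "eventually (\<lambda>t. norm (t ^ n * h t) \<le> (norm (h 0) + 1) * norm t ^ n) (nhds 0)"
    by eventually_elim (simp add: norm_mult norm_power mult.commute[of "_ + 1"] mult_left_mono)
  then show ?thesis unfolding vanishes_to_def by blast
qed

lemma vanishes_to_Pair:
  assumes "vanishes_to g N" "vanishes_to h N"
  shows "vanishes_to (\<lambda>t. (g t, h t)) N"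
proof -
  obtain C D where "eventually (\<lambda>t. norm (g t) \<le> C * norm t ^ N) (nhds 0)"
    "eventually (\<lambda>t. norm (h t) \<le> D * norm t ^ N) (nhds 0)"
    using assms unfolding vanishes_to_def by blast
  then have "eventually (\<lambda>t. norm (g t, h t) \<le> (C + D) * norm t ^ N) (nhds 0)"
    unfolding distrib_right by eventually_elim (rule order_trans[OF norm_Pair_le], rule add_mono)
  then show ?thesis unfolding vanishes_to_def by blast
qed

lemma vord_eq: "vord h = Sup {enat N | N. vanishes_to h N}"
  by (simp add: vord_def vanishes_to_def)

lemma vanishes_to_imp_le_vord: "vanishes_to h N \<Longrightarrow> enat N \<le> vord h"
  unfolding vord_eq by (rule Sup_upper) blast

lemma vord_leI: "(\<And>N. vanishes_to h N \<Longrightarrow> N \<le> K) \<Longrightarrow> vord h \<le> enat K"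
  unfolding vord_eq by (rule Sup_least) auto

lemma vord_eq_infinity: "(\<And>N. vanishes_to h N) \<Longrightarrow> vord h = \<infinity>"
proof (rule ccontr)
  assume van: "\<And>N. vanishes_to h N" and "vord h \<noteq> \<infinity>"
  then obtain k where "vord h = enat k" by (cases "vord h") auto
  then show False using vanishes_to_imp_le_vord[OF van, of "Suc k"] by simp
qed

text \<open>Extracts the leading exponent \<open>n\<close> and the leading coefficient
  \<open>h 0\<close> of a component; the value at \<open>t1\<close> excludes the zero
  function.\<close>

lemma holomorphic_factor_at_0:
  assumes "g holomorphic_on ball 0 e" "e > 0" "g 0 = 0" "t1 \<in> ball 0 e" "g t1 \<noteq> 0"
  obtains n h where "n > 0" "isCont h 0" "h 0 \<noteq> 0" "eventually (\<lambda>t. g t = t ^ n * h t) (nhds 0)"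
proof -
  have "\<not> g constant_on ball 0 e"
    using assms unfolding constant_on_def by (metis centre_in_ball)
  then obtain h s n where h: "0 < n" "0 < s" "h holomorphic_on ball 0 s"
    "\<And>w. w \<in> ball 0 s \<Longrightarrow> g w = (w - 0) ^ n * h w" "\<And>w. w \<in> ball 0 s \<Longrightarrow> h w \<noteq> 0"
    using holomorphic_factor_zero_nonconstant[OF assms(1) open_ball connected_ball _ assms(3)]
      assms(2) by (metis centre_in_ball)
  have "continuous_on (ball 0 s) h" using h(3) by (rule holomorphic_on_imp_continuous_on)
  then have "isCont h 0" using h(2) continuous_on_eq_continuous_at[OF open_ball] by (metis centre_in_ball)
  moreover have "eventually (\<lambda>t. t \<in> ball 0 s) (nhds (0::complex))"
    using h(2) by (intro eventually_nhds_in_open) auto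
  then have "eventually (\<lambda>t. g t = t ^ n * h t) (nhds 0)"
    by eventually_elim (use h(4) in simp)
  ultimately show ?thesis using that h(1,2,5) by (metis centre_in_ball)
qed

text \<open>If one component of the curve vanishes identically, replace it by \<open>t ^ a\<close> for large \<open>a\<close>: as \<open>F\<close> is Lipschitz, this does not affect the low orders. The map \<open>T\<close> chooses the slot of the component \<open>g\<close>.\<close>

lemma order_le_weight_degenerate:
  fixes F :: "C2 \<Rightarrow> real" and T :: "complex \<Rightarrow> complex \<Rightarrow> C2"
  assumes W: "open W" "0 \<in> W" and sm: "smooth_on W F"
    and T0: "T = Pair \<or> T = (\<lambda>u v. (v, u))"
    and g: "(g \<longlongrightarrow> 0) (nhds 0)"
    and key: "\<And>a M. a > 0 \<Longrightarrow> vanishes_to (\<lambda>t. F (T (g t) (t ^ a))) M \<Longrightarrow> real M \<le> K"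
    and van: "vanishes_to (\<lambda>t. F (T (g t) 0)) N"
  shows "real N \<le> K"
proof -
  obtain b :: nat where "real b > K" using reals_Archimedean2 by blast
  \<comment> \<open>With \<open>a\<close> above \<open>K\<close>, the inequality
    \<open>min N a \<le> K\<close> obtained at the end can only come from \<open>N \<le> K\<close>;
    \<open>Suc\<close> makes \<open>a\<close> positive.\<close>
  then obtain a :: nat where a: "real a > K" "a > 0" using that[of "Suc b"] by simp
  obtain d B where d: "d > 0" "ball 0 d \<subseteq> W"
    "\<And>x y. x \<in> ball 0 d \<Longrightarrow> y \<in> ball 0 d \<Longrightarrow> norm (F x - F y) \<le> B * norm (x - y)"
    using smooth_on_lipschitz_near[OF sm W] by blast
  have dT: "T (g t) s - T (g t) 0 = T 0 s" "norm (T 0 s) = norm s" for t s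
    using T0 by auto
  have Tl: "((\<lambda>t. T (g t) (s t)) \<longlongrightarrow> 0) (nhds 0)" if "(s \<longlongrightarrow> 0) (nhds 0)" for s
    using T0 tendsto_Pair[OF g that] tendsto_Pair[OF that g] by (auto simp: zero_prod_def)
  have "((\<lambda>t::complex. t ^ a) \<longlongrightarrow> 0 ^ a) (nhds 0)" by (intro tendsto_intros filterlim_ident)
  then have "((\<lambda>t::complex. t ^ a) \<longlongrightarrow> 0) (nhds 0)" using a by (simp add: power_0_left)
  from Tl[OF this] have e1: "eventually (\<lambda>t. T (g t) (t ^ a) \<in> ball 0 d) (nhds 0)"
    by (rule topological_tendstoD) (use d in auto)
  have e2: "eventually (\<lambda>t. T (g t) 0 \<in> ball 0 d) (nhds 0)"
    using Tl[OF tendsto_const] by (rule topological_tendstoD) (use d in auto)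
  have "eventually (\<lambda>t. norm (F (T (g t) (t ^ a)) - F (T (g t) 0)) \<le> B * norm t ^ a) (nhds 0)"
    using e1 e2
  proof eventually_elim
    case (elim t)
    show ?case using d(3)[OF elim] unfolding dT by (simp add: norm_power)
  qed
  then have va: "vanishes_to (\<lambda>t. F (T (g t) (t ^ a)) - F (T (g t) 0)) a"
    unfolding vanishes_to_def by blast
  then have "vanishes_to (\<lambda>t. (F (T (g t) (t ^ a)) - F (T (g t) 0)) + F (T (g t) 0)) (min N a)"
    by (intro vanishes_to_add vanishes_to_mono[OF van] vanishes_to_mono[OF va]) auto
  then have "real (min N a) \<le> K" using key[OF a(2)] by simp
  then show ?thesis using a(1) by (simp add: min_def split: if_splits)
qed

text \<open>The two axis points have weights \<open>a1 * A\<close> and \<open>a2 * B\<close>, so the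
  smaller exponent times \<open>max A B\<close> bounds every order. Of \<open>n\<close> only
  \<open>vanishes_to \<gamma> n\<close> is claimed, a lower bound for the order of the curve: this
  is the direction in which the quotient in \<open>Delta1\<close> is bounded.\<close>

lemma curve_order_bound:
  fixes F :: "C2 \<Rightarrow> real"
  assumes W: "open W" "0 \<in> W" and sm: "smooth_on W F" and nd: "N_nondegenerate F"
    and A: "(A, 0) \<in> newton_poly F" and B: "(0, B) \<in> newton_poly F"
    and \<gamma>: "holo_curve e \<gamma>" "e > 0" "\<gamma> 0 = 0" "t1 \<in> ball 0 e" "\<gamma> t1 \<noteq> 0"
  shows "\<exists>n>0. vanishes_to \<gamma> n \<and> (\<forall>N. vanishes_to (\<lambda>t. F (\<gamma> t)) N \<longrightarrow> real N \<le> max A B * real n)"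
proof -
  define g1 g2 where "g1 t = fst (\<gamma> t)" and "g2 t = snd (\<gamma> t)" for t
  have \<gamma>g: "\<gamma> t = (g1 t, g2 t)" for t by (simp add: g1_def g2_def)
  have hol: "g1 holomorphic_on ball 0 e" "g2 holomorphic_on ball 0 e"
    using \<gamma>(1) by (simp_all add: holo_curve_def g1_def[abs_def] g2_def[abs_def])
  have g0: "g1 0 = 0" "g2 0 = 0" using \<gamma>(3) by (simp_all add: g1_def g2_def)
  have ball: "eventually (\<lambda>t. t \<in> ball 0 e) (nhds (0::complex))"
    using \<gamma>(2) by (intro eventually_nhds_in_open) auto
  note fac1 = holomorphic_factor_at_0[OF hol(1) \<gamma>(2) g0(1)]
  note fac2 = holomorphic_factor_at_0[OF hol(2) \<gamma>(2) g0(2)]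
  note key = order_le_weight[OF W sm nd]
  have cont: "(g1 \<longlongrightarrow> 0) (nhds 0)" "(g2 \<longlongrightarrow> 0) (nhds 0)"
    using hol[THEN holomorphic_on_imp_continuous_on] \<gamma>(2) g0 isCont_tendsto_nhds
    by (metis centre_in_ball continuous_on_eq_continuous_at open_ball)+
  have le_max: "real m * A \<le> max A B * real m" "real m * B \<le> max A B * real m" for m
    by (simp_all add: mult.commute[of _ "real m"] mult_left_mono)
  \<comment> \<open>The cofactor of a substitute component, in the shape \<open>t ^ a * 1\<close>
    that \<open>order_le_weight\<close> expects.\<close>
  have isC1: "isCont (\<lambda>_. 1 :: complex) 0" by simp
  consider (both) s1 s2 where "s1 \<in> ball 0 e" "g1 s1 \<noteq> 0" "s2 \<in> ball 0 e" "g2 s2 \<noteq> 0"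
    | (one) s1 where "s1 \<in> ball 0 e" "g1 s1 \<noteq> 0" "\<And>t. t \<in> ball 0 e \<Longrightarrow> g2 t = 0"
    | (two) s2 where "s2 \<in> ball 0 e" "g2 s2 \<noteq> 0" "\<And>t. t \<in> ball 0 e \<Longrightarrow> g1 t = 0"
  proof -
    have "g1 t1 \<noteq> 0 \<or> g2 t1 \<noteq> 0" using \<gamma>(5) \<gamma>g[of t1] by (auto simp: zero_prod_def)
    then show thesis using both one two \<gamma>(4) by blast
  qed
  then show ?thesis
  proof cases
    case both
    obtain a1 h1 where h1: "a1 > 0" "isCont h1 0" "h1 0 \<noteq> 0" "eventually (\<lambda>t. g1 t = t ^ a1 * h1 t) (nhds 0)"
      using fac1[OF both(1,2)] by blast
    obtain a2 h2 where h2: "a2 > 0" "isCont h2 0" "h2 0 \<noteq> 0" "eventually (\<lambda>t. g2 t = t ^ a2 * h2 t) (nhds 0)"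
      using fac2[OF both(3,4)] by blast
    have "vanishes_to g1 (min a1 a2)" "vanishes_to g2 (min a1 a2)"
      using vanishes_to_mono[OF vanishes_to_cong[OF vanishes_to_power_mult[OF h1(2)] h1(4)], of "min a1 a2"]
        vanishes_to_mono[OF vanishes_to_cong[OF vanishes_to_power_mult[OF h2(2)] h2(4)], of "min a1 a2"]
      by simp_all
    then have "vanishes_to \<gamma> (min a1 a2)"
      using vanishes_to_Pair by (simp add: \<gamma>g[abs_def])
    moreover have "real N \<le> max A B * real (min a1 a2)" if N: "vanishes_to (\<lambda>t. F (\<gamma> t)) N" for N
    proof -
      have "vanishes_to (\<lambda>t. F (t ^ a1 * h1 t, t ^ a2 * h2 t)) N"
        using N by (rule vanishes_to_cong) (use h1(4) h2(4) in \<open>eventually_elim; simp add: \<gamma>g\<close>)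
      from key[OF h1(1) h2(1) h1(2) h2(2) h1(3) h2(3) this]
      have "real N \<le> real a1 * A" "real N \<le> real a2 * B" using A B by fastforce+
      then show ?thesis using le_max[of "min a1 a2"] le_max[of a1] le_max[of a2]
        by (simp add: min_def split: if_splits)
    qed
    ultimately show ?thesis using h1(1) h2(1) by (metis min_less_iff_conj)
  next
    case one
    obtain a1 h1 where h1: "a1 > 0" "isCont h1 0" "h1 0 \<noteq> 0" "eventually (\<lambda>t. g1 t = t ^ a1 * h1 t) (nhds 0)"
      using fac1[OF one(1,2)] by blast
    have \<gamma>1: "eventually (\<lambda>t. \<gamma> t = (g1 t, 0)) (nhds 0)"
      using ball by eventually_elim (simp add: \<gamma>g one(3))
    have "vanishes_to g1 a1" using vanishes_to_cong[OF vanishes_to_power_mult[OF h1(2)] h1(4)] .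
    then have "vanishes_to \<gamma> a1"
      by (rule vanishes_to_dominated[where B = 1]) (use \<gamma>1 in \<open>eventually_elim; simp\<close>)
    moreover have "real N \<le> max A B * real a1" if N: "vanishes_to (\<lambda>t. F (\<gamma> t)) N" for N
    proof -
      have "vanishes_to (\<lambda>t. F (g1 t, 0)) N"
        using N by (rule vanishes_to_cong) (use \<gamma>1 in \<open>eventually_elim; simp\<close>)
      \<comment> \<open>The point \<open>(A, 0)\<close> has weight \<open>a1 * A\<close> whatever
        exponent \<open>a\<close> the substitute component receives, so one bound serves all
        \<open>a\<close>.\<close>
      then have "real N \<le> real a1 * A"
      proof (rule order_le_weight_degenerate[where T = Pair, OF W sm _ cont(1), rotated 2])
        fix a M assume a: "(a::nat) > 0" and M: "vanishes_to (\<lambda>t. F (g1 t, t ^ a)) M"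
        have "vanishes_to (\<lambda>t. F (t ^ a1 * h1 t, t ^ a * 1)) M"
          using M by (rule vanishes_to_cong) (use h1(4) in \<open>eventually_elim; simp\<close>)
        from key[OF h1(1) a h1(2) isC1 h1(3) _ this A] show "real M \<le> real a1 * A" by simp
      qed simp
      then show ?thesis using le_max[of a1] by simp
    qed
    ultimately show ?thesis using h1(1) by blast
  next
    case two
    obtain a2 h2 where h2: "a2 > 0" "isCont h2 0" "h2 0 \<noteq> 0" "eventually (\<lambda>t. g2 t = t ^ a2 * h2 t) (nhds 0)"
      using fac2[OF two(1,2)] by blast
    have \<gamma>2: "eventually (\<lambda>t. \<gamma> t = (0, g2 t)) (nhds 0)"
      using ball by eventually_elim (simp add: \<gamma>g two(3))
    have "vanishes_to g2 a2" using vanishes_to_cong[OF vanishes_to_power_mult[OF h2(2)] h2(4)] .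
    then have "vanishes_to \<gamma> a2"
      by (rule vanishes_to_dominated[where B = 1]) (use \<gamma>2 in \<open>eventually_elim; simp\<close>)
    moreover have "real N \<le> max A B * real a2" if N: "vanishes_to (\<lambda>t. F (\<gamma> t)) N" for N
    proof -
      have "vanishes_to (\<lambda>t. F (0, g2 t)) N"
        using N by (rule vanishes_to_cong) (use \<gamma>2 in \<open>eventually_elim; simp\<close>)
      then have "real N \<le> real a2 * B"
      proof (rule order_le_weight_degenerate[where T = "\<lambda>u v. (v, u)", OF W sm _ cont(2), rotated 2])
        fix a M assume a: "(a::nat) > 0" and M: "vanishes_to (\<lambda>t. F (t ^ a, g2 t)) M"
        have "vanishes_to (\<lambda>t. F (t ^ a * 1, t ^ a2 * h2 t)) M"
          using M by (rule vanishes_to_cong) (use h2(4) in \<open>eventually_elim; simp\<close>)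
        from key[OF a h2(1) isC1 h2(2) _ h2(3) this B] show "real M \<le> real a2 * B" by simp
      qed simp
      then show ?thesis using le_max[of a2] by simp
    qed
    ultimately show ?thesis using h2(1) by blast
  qed
qed

text \<open>A nonzero derivative gives \<open>\<phi> t - p = (t * u t, t * v t)\<close> with
  \<open>u 0\<close> and \<open>v 0\<close> not both zero, hence order exactly 1; injectivity makes
  the germ nonconstant.\<close>

lemma complex_curve_param_imp_Gamma_reg:
  assumes "complex_curve_param X p \<phi> e"
  shows "\<phi> \<in> Gamma_reg p"
proof -
  have e: "e > 0" "holo_curve e \<phi>" "\<phi> 0 = p"
    and nz: "(deriv (\<lambda>t. fst (\<phi> t)) 0, deriv (\<lambda>t. snd (\<phi> t)) 0) \<noteq> (0, 0)"
    and inj: "inj_on \<phi> (ball 0 e)"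
    using assms unfolding complex_curve_param_def by blast+
  have "((\<lambda>t. fst (\<phi> t)) has_field_derivative deriv (\<lambda>t. fst (\<phi> t)) 0) (at 0)"
    "((\<lambda>t. snd (\<phi> t)) has_field_derivative deriv (\<lambda>t. snd (\<phi> t)) 0) (at 0)"
    using e unfolding holo_curve_def by (auto intro: holomorphic_derivI)
  then obtain u v where u: "\<And>t. fst (\<phi> t) - fst (\<phi> 0) = u t * (t - 0)" "isCont u 0"
      "u 0 = deriv (\<lambda>t. fst (\<phi> t)) 0"
    and v: "\<And>t. snd (\<phi> t) - snd (\<phi> 0) = v t * (t - 0)" "isCont v 0"
      "v 0 = deriv (\<lambda>t. snd (\<phi> t)) 0"
    unfolding CARAT_DERIV by blast
  have diff: "\<phi> t - p = (t ^ 1 * u t, t ^ 1 * v t)" for t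
    using u(1)[of t] v(1)[of t] e(3) by (simp add: prod_eq_iff mult.commute)
  have van1: "vanishes_to (\<lambda>t. \<phi> t - p) 1"
    unfolding diff by (intro vanishes_to_Pair vanishes_to_power_mult u v)
  \<comment> \<open>Dividing a bound of order two by \<open>t\<close> off the origin makes each
    cofactor tend to 0, and continuity gives its value at 0.\<close>
  have zero: "w 0 = 0" if w: "isCont w 0" "\<And>t. norm (t * w t) \<le> norm (\<phi> t - p)"
    and van: "vanishes_to (\<lambda>t. \<phi> t - p) 2" for w :: "complex \<Rightarrow> complex"
  proof -
    obtain C where C: "eventually (\<lambda>t. norm (\<phi> t - p) \<le> C * norm t ^ 2) (nhds 0)"
      using van unfolding vanishes_to_def by blast
    have "eventually (\<lambda>t. norm (\<phi> t - p) \<le> C * norm t ^ 2) (at 0)"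
      using C by (simp add: eventually_at_filter eventually_mono)
    moreover have "eventually (\<lambda>t. t \<noteq> (0::complex)) (at 0)" by (simp add: eventually_at_filter)
    ultimately have "eventually (\<lambda>t. norm (w t) \<le> C * norm t) (at 0)"
    proof eventually_elim
      case (elim t)
      have "norm t * norm (w t) \<le> norm t * (C * norm t)"
        using w(2)[of t] elim(1) by (simp add: norm_mult power2_eq_square mult_ac)
      then show ?case using elim(2) by simp
    qed
    moreover have "isCont (\<lambda>t::complex. C * norm t) 0" by (intro continuous_intros)
    then have "((\<lambda>t::complex. C * norm t) \<longlongrightarrow> 0) (at 0)" by (simp add: isCont_def)
    ultimately have "(w \<longlongrightarrow> 0) (at 0)" by (rule Lim_null_comparison)
    then show "w 0 = 0" using w(1) LIM_unique unfolding isCont_def by blast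
  qed
  have le1: "N \<le> 1" if "vanishes_to (\<lambda>t. \<phi> t - p) N" for N
  proof (rule ccontr)
    assume "\<not> N \<le> 1"
    then have van2: "vanishes_to (\<lambda>t. \<phi> t - p) 2" using vanishes_to_mono[OF that] by simp
    have "norm (t * u t) \<le> norm (\<phi> t - p)" "norm (t * v t) \<le> norm (\<phi> t - p)" for t
      unfolding diff using norm_fst_le[of "t ^ 1 * u t" "t ^ 1 * v t"] norm_snd_le[of "t ^ 1 * v t" "t ^ 1 * u t"]
      by auto
    then have "u 0 = 0" "v 0 = 0" using zero[OF u(2) _ van2] zero[OF v(2) _ van2] by auto
    then show False using nz u(3) v(3) by simp
  qed
  have "vord (\<lambda>t. \<phi> t - p) = 1"
    using vanishes_to_imp_le_vord[OF van1] vord_leI[of "\<lambda>t. \<phi> t - p", OF le1] by (simp add: one_enat_def order_antisym)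
  moreover have "\<exists>t\<in>ball 0 e. \<phi> t \<noteq> p"
  proof -
    have m: "of_real (e / 2) \<in> ball (0::complex) e" "(0::complex) \<in> ball 0 e" using e(1) by auto
    then have "\<phi> (of_real (e / 2)) \<noteq> \<phi> 0" using inj_onD[OF inj _ m] e(1) by auto
    then show ?thesis using m(1) e(3) by blast
  qed
  ultimately show ?thesis unfolding Gamma_reg_def Gamma_def using e by blast
qed

text \<open>The composite of \<open>r2\<close> with \<open>\<Phi>\<close> is Lipschitz near
  \<open>q1\<close> and vanishes on \<open>S1\<close> there, so the transversal estimate applies. In
  this form the lemma serves both a coordinate and its inverse.\<close>

lemma local_defining_function_comp_bound:
  assumes l1: "local_defining_function S1 q1 r1" "q1 \<in> S1" and l2: "local_defining_function S2 q2 r2"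
    and \<Phi>: "holo2_on \<Phi> U" "open U" "q1 \<in> U" "\<Phi> q1 = q2" "\<And>x. x \<in> S1 \<Longrightarrow> x \<in> U \<Longrightarrow> \<Phi> x \<in> S2"
  shows "\<exists>C. eventually (\<lambda>x. norm (r2 (\<Phi> x)) \<le> C * \<bar>r1 x\<bar>) (nhds q1)"
proof -
  obtain W where W: "open W" "q2 \<in> W" "smooth_on W r2" "S2 \<inter> W = {x \<in> W. r2 x = 0}"
    using l2 unfolding local_defining_function_def by blast
  obtain d2 B2 where d2: "d2 > 0" "ball q2 d2 \<subseteq> W"
    "\<And>x y. x \<in> ball q2 d2 \<Longrightarrow> y \<in> ball q2 d2 \<Longrightarrow> norm (r2 x - r2 y) \<le> B2 * norm (x - y)"
    using smooth_on_lipschitz_near[OF W(3,1,2)] by blast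
  obtain d1 B1 where d1: "d1 > 0" "ball q1 d1 \<subseteq> U"
    "\<And>x y. x \<in> ball q1 d1 \<Longrightarrow> y \<in> ball q1 d1 \<Longrightarrow> norm (\<Phi> x - \<Phi> y) \<le> B1 * norm (x - y)"
    using holo2_on_lipschitz_near[OF \<Phi>(1-3)] by blast
  from isCont_tendsto_nhds[OF holo2_on_isCont[OF \<Phi>(1,3)]] have "eventually (\<lambda>x. \<Phi> x \<in> ball q2 d2) (nhds q1)"
    by (rule topological_tendstoD) (use d2 \<Phi>(4) in auto)
  then obtain d3 where d3: "d3 > 0" "\<And>x. dist x q1 < d3 \<Longrightarrow> \<Phi> x \<in> ball q2 d2"
    by (auto simp: eventually_nhds_metric)
  define d where "d = min d1 d3"
  have d: "d > 0" using d1 d3 by (simp add: d_def)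
  have sub: "x \<in> ball q1 d1" "\<Phi> x \<in> ball q2 d2" if "x \<in> ball q1 d" for x
    using that d3(2)[of x] by (auto simp: d_def dist_commute)
  show ?thesis
  proof (rule local_defining_function_bounds[OF l1 d])
    fix x y assume xy: "x \<in> ball q1 d" "y \<in> ball q1 d"
    have "norm (r2 (\<Phi> x) - r2 (\<Phi> y)) \<le> B2 * norm (\<Phi> x - \<Phi> y)"
      by (intro d2(3) sub xy)
    also have "\<dots> \<le> \<bar>B2\<bar> * norm (\<Phi> x - \<Phi> y)" by (intro mult_right_mono) auto
    also have "\<dots> \<le> \<bar>B2\<bar> * (B1 * norm (x - y))" by (intro mult_left_mono d1(3) sub xy) auto
    finally show "norm (r2 (\<Phi> x) - r2 (\<Phi> y)) \<le> (\<bar>B2\<bar> * B1) * norm (x - y)" by (simp add: mult.assoc)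
  next
    fix x assume x: "x \<in> ball q1 d" "x \<in> S1"
    then have "\<Phi> x \<in> S2 \<inter> W" using \<Phi>(5) sub[OF x(1)] d1(2) d2(2) by blast
    then show "r2 (\<Phi> x) = 0" using W(4) by blast
  qed
qed

text \<open>On the line every monomial containing the second variable is zero and the pure ones are
  absent, so only the Taylor remainder is left.\<close>

lemma smooth_flat_on_line:
  fixes F :: "C2 \<Rightarrow> real"
  assumes W: "open W" "0 \<in> W" and sm: "smooth_on W F"
    and pure: "\<And>\<alpha> \<beta>. snd \<alpha> = 0 \<Longrightarrow> snd \<beta> = 0 \<Longrightarrow> taylor_coeff F \<alpha> \<beta> = 0"
  shows "vanishes_to (\<lambda>t. F (t, 0)) N"
proof -
  define f where "f z = complex_of_real (F z)" for z
  have smf: "smooth_on W f"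
    unfolding f_def by (rule smooth_on_bounded_linear[OF W(1) bounded_linear_of_real sm])
  have tc: "taylor_coeff F (fst x) (snd x) = wirt_coeff f x" for x
    by (simp add: taylor_coeff_eq_wirt_coeff f_def[abs_def])
  obtain C where C: "eventually (\<lambda>z. norm (f z - taylor_poly N f z) \<le> C * norm z ^ Suc N) (nhds 0)"
    using taylor_expansion[OF W(1) smf W(2)] by blast
  have "((\<lambda>t::complex. (t, 0::complex)) \<longlongrightarrow> (0, 0)) (nhds 0)" by (intro tendsto_intros filterlim_ident)
  then have lim: "((\<lambda>t::complex. (t, 0::complex)) \<longlongrightarrow> 0) (nhds 0)" by (simp add: zero_prod_def)
  have ev: "eventually (\<lambda>t. norm (f (t, 0) - taylor_poly N f (t, 0)) \<le> C * norm (t, 0::complex) ^ Suc N) (nhds 0)"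
    using C lim by (rule eventually_compose_filterlim)
  have t0: "taylor_poly N f (t, 0) = 0" for t
    unfolding taylor_poly_def
  proof (intro sum.neutral ballI)
    fix x assume "x \<in> taylor_index N"
    show "wirt_coeff f x * mono (t, 0) (fst x) (snd x) = 0"
      using pure[of "fst x" "snd x"] tc[of x]
      by (cases "snd (fst x) = 0 \<and> snd (snd x) = 0") (auto simp: mono_def power_0_left)
  qed
  have "eventually (\<lambda>t. norm (F (t, 0)) \<le> C * norm t ^ Suc N) (nhds 0)"
    using ev by eventually_elim (simp add: t0 f_def)
  then have "vanishes_to (\<lambda>t. F (t, 0)) (Suc N)" unfolding vanishes_to_def by blast
  then show ?thesis by (rule vanishes_to_mono) simp
qed

text \<open>The quadrant at the exponent \<open>(0, 1)\<close> of the linear term is already the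
  whole set; conversely every monomial present contains the second variable or its conjugate, so
  none lies below height 1.\<close>

lemma newton_poly_half_plane:
  fixes F :: "C2 \<Rightarrow> real"
  assumes W: "open W" "0 \<in> W" and sm: "smooth_on W F" and nz: "frechet_derivative F (at 0) \<noteq> (\<lambda>_. 0)"
    and pure: "\<And>\<alpha> \<beta>. snd \<alpha> = 0 \<Longrightarrow> snd \<beta> = 0 \<Longrightarrow> taylor_coeff F \<alpha> \<beta> = 0"
  shows "newton_poly F = {\<xi>. fst \<xi> \<ge> 0 \<and> snd \<xi> \<ge> 1}"
proof -
  define f where "f z = complex_of_real (F z)" for z
  have tc: "taylor_coeff F \<alpha> \<beta> = wirt_coeff f (\<alpha>, \<beta>)" for \<alpha> \<beta>
    by (simp add: taylor_coeff_eq_wirt_coeff f_def[abs_def])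
  have "(F has_derivative frechet_derivative F (at 0)) (at 0)"
    using smooth_on_differentiable[OF sm W] by (simp add: frechet_derivative_works)
  then have df: "(f has_derivative (\<lambda>v. of_real (frechet_derivative F (at 0) v))) (at 0)"
    unfolding f_def by (rule has_derivative_of_real)
  then have fd: "f differentiable (at 0)" using differentiable_def by blast
  have L: "of_real (frechet_derivative F (at 0) v) = fst v * dz1 f 0 + cnj (fst v) * dzb1 f 0
      + snd v * dz2 f 0 + cnj (snd v) * dzb2 f 0" for v
    using fun_cong[OF has_derivative_unique[OF df has_derivative_wirtinger[OF fd]], of v] by simp
  have "dz1 f 0 = 0" "dzb1 f 0 = 0"
    using pure[of "(1, 0)" "(0, 0)"] pure[of "(0, 0)" "(1, 0)"]
    by (simp_all add: tc wirt_coeff_def wirt_iter_def zero_prod_def)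
  then have nn: "\<not> (dz2 f 0 = 0 \<and> dzb2 f 0 = 0)" using L nz by (auto simp: fun_eq_iff)
  have lin: "\<exists>\<alpha> \<beta>. taylor_coeff F \<alpha> \<beta> \<noteq> 0 \<and> exps \<alpha> \<beta> = (0, 1)"
  proof (cases "dz2 f 0 = 0")
    case True
    then show ?thesis using nn
      by (intro exI[of _ "(0, 0)"] exI[of _ "(0, 1)"])
        (simp add: tc wirt_coeff_def wirt_iter_def zero_prod_def exps_def)
  next
    case False
    then show ?thesis
      by (intro exI[of _ "(0, 1)"] exI[of _ "(0, 0)"])
        (simp add: tc wirt_coeff_def wirt_iter_def zero_prod_def exps_def)
  qed
  show ?thesis
  proof
    have "fst \<xi> \<ge> 0" if "\<xi> \<in> newton_poly F" for \<xi>
      using newton_poly_ge[of 1 0 F 0 \<xi>, OF _ _ _ that] by (simp add: exps_def inner_prod_def)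
    moreover have "snd \<xi> \<ge> 1" if "\<xi> \<in> newton_poly F" for \<xi>
    proof -
      have "1 \<le> ((0::real), 1) \<bullet> exps \<alpha> \<beta>" if "taylor_coeff F \<alpha> \<beta> \<noteq> 0" for \<alpha> \<beta>
      proof -
        have "snd \<alpha> + snd \<beta> \<noteq> 0" using pure[of \<alpha> \<beta>] that by auto
        then have "1 \<le> real (snd \<alpha> + snd \<beta>)" by linarith
        then show ?thesis by (simp add: exps_def inner_prod_def)
      qed
      from newton_poly_ge[of 0 1 F 1 \<xi>, OF _ _ this that] show ?thesis by (simp add: inner_prod_def)
    qed
    ultimately show "newton_poly F \<subseteq> {\<xi>. fst \<xi> \<ge> 0 \<and> snd \<xi> \<ge> 1}" by blast
    show "{\<xi>. fst \<xi> \<ge> 0 \<and> snd \<xi> \<ge> 1} \<subseteq> newton_poly F"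
    proof
      fix \<xi> :: "real \<times> real" assume "\<xi> \<in> {\<xi>. fst \<xi> \<ge> 0 \<and> snd \<xi> \<ge> 1}"
      then have "\<xi> \<in> newton_gens F" using lin unfolding mem_newton_gens by force
      then show "\<xi> \<in> newton_poly F" unfolding newton_poly_eq by (rule hull_inc)
    qed
  qed
qed

section \<open>Exchanging the two coordinates\<close>

text \<open>Condition (6) prefers the first axis, while a nonconvenient polyhedron may miss the
  second one; exchanging the coordinates reduces that case to the other.\<close>

definition cswap :: "C2 \<Rightarrow> C2" where "cswap z = (snd z, fst z)"

lemma cswap_simps [simp]: "cswap (cswap z) = z" "cswap (a, b) = (b, a)" "cswap 0 = 0"
  "fst (cswap z) = snd z" "snd (cswap z) = fst z"
  by (simp_all add: cswap_def zero_prod_def)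

lemma has_derivative_cswap: "(cswap has_derivative cswap) F"
proof -
  have "bounded_linear cswap"
    unfolding cswap_def[abs_def] by (intro bounded_linear_Pair bounded_linear_fst bounded_linear_snd)
  then show ?thesis by (rule bounded_linear_imp_has_derivative)
qed

lemma cswap_image: "cswap ` X = cswap -` X"
  by (rule set_eqI) (metis cswap_simps(1) image_iff vimage_eq)

lemma open_cswap_vimage: "open W \<Longrightarrow> open (cswap -` W)"
proof (rule continuous_open_vimage)
  show "isCont cswap x" for x using has_derivative_cswap has_derivative_continuous by blast
qed

lemma frechet_derivative_cswap:
  assumes "f differentiable (at (cswap x))"
  shows "frechet_derivative (\<lambda>x. f (cswap x)) (at x) v = frechet_derivative f (at (cswap x)) (cswap v)"
proof -
  have "((\<lambda>x. f (cswap x)) has_derivative (\<lambda>v. frechet_derivative f (at (cswap x)) (cswap v))) (at x)"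
    using has_derivative_compose[OF has_derivative_cswap assms[unfolded frechet_derivative_works]] .
  from fun_cong[OF frechet_derivative_at[OF this], of v] show ?thesis by simp
qed

text \<open>The derivative of the composite in direction \<open>v\<close> is that of
  \<open>f\<close> in direction \<open>cswap v\<close>, again composed with \<open>cswap\<close>, so
  the induction closes.\<close>

lemma Ck_on_cswap:
  assumes "open W" "Ck_on k W f"
  shows "Ck_on k (cswap -` W) (\<lambda>x. f (cswap x))"
  using assms(2)
proof (induction k arbitrary: f)
  case 0
  have "continuous_on (cswap -` W) cswap"
    by (rule has_derivative_continuous_on) (rule has_derivative_cswap)
  moreover have "continuous_on W f" using 0 by simp
  ultimately have "continuous_on (cswap -` W) (\<lambda>x. f (cswap x))"
    by (intro continuous_on_compose2[where g = f and f = cswap and t = W]) auto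
  then show ?case by simp
next
  case (Suc k)
  have d: "f differentiable (at x)" if "x \<in> W" for x
    using Suc.prems that assms(1) differentiable_on_eq_differentiable_at by auto
  have o: "open (cswap -` W)" by (rule open_cswap_vimage[OF assms(1)])
  have "(\<lambda>x. f (cswap x)) differentiable (at x)" if x: "x \<in> cswap -` W" for x
  proof -
    have "(f has_derivative frechet_derivative f (at (cswap x))) (at (cswap x))"
      using d[of "cswap x"] x by (simp add: frechet_derivative_works)
    from has_derivative_compose[OF has_derivative_cswap this] show ?thesis
      by (rule differentiableI)
  qed
  then have "(\<lambda>x. f (cswap x)) differentiable_on (cswap -` W)"
    using differentiable_on_eq_differentiable_at[OF o] by blast
  moreover have "Ck_on k (cswap -` W) (\<lambda>x. frechet_derivative (\<lambda>x. f (cswap x)) (at x) v)" for v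
  proof (rule Ck_on_cong[OF o])
    show "Ck_on k (cswap -` W) (\<lambda>x. frechet_derivative f (at (cswap x)) (cswap v))"
      by (rule Suc.IH) (use Suc.prems in \<open>simp only: Ck_on.simps\<close>)
    show "frechet_derivative f (at (cswap x)) (cswap v) = frechet_derivative (\<lambda>x. f (cswap x)) (at x) v"
      if "x \<in> cswap -` W" for x
      by (rule frechet_derivative_cswap[OF d, symmetric]) (use that in simp)
  qed
  ultimately show ?case by simp
qed

lemma local_defining_function_cswap:
  assumes "local_defining_function S q \<rho>"
  shows "local_defining_function (cswap ` S) (cswap q) (\<lambda>x. \<rho> (cswap x))"
proof -
  obtain W where W: "open W" "q \<in> W" "smooth_on W \<rho>" "S \<inter> W = {x \<in> W. \<rho> x = 0}"
    and nz: "\<And>x. x \<in> S \<inter> W \<Longrightarrow> frechet_derivative \<rho> (at x) \<noteq> (\<lambda>_. 0)"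
    using assms unfolding local_defining_function_def by blast
  have "smooth_on (cswap -` W) (\<lambda>x. \<rho> (cswap x))"
    using W(1,3) Ck_on_cswap unfolding smooth_on_def by blast
  moreover have "cswap ` S \<inter> cswap -` W = {x \<in> cswap -` W. \<rho> (cswap x) = 0}"
    unfolding cswap_image using W(4) by blast
  moreover have "frechet_derivative (\<lambda>x. \<rho> (cswap x)) (at x) \<noteq> (\<lambda>_. 0)"
    if "x \<in> cswap ` S \<inter> cswap -` W" for x
  proof
    assume z: "frechet_derivative (\<lambda>x. \<rho> (cswap x)) (at x) = (\<lambda>_. 0)"
    have x: "cswap x \<in> S \<inter> W" using that unfolding cswap_image by blast
    have "frechet_derivative \<rho> (at (cswap x)) v = 0" for v
      using frechet_derivative_cswap[OF smooth_on_differentiable[OF W(3,1)], of x "cswap v"] x z by simp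
    then show False using nz[OF x] by blast
  qed
  ultimately show ?thesis
    unfolding local_defining_function_def using open_cswap_vimage[OF W(1)] W(2)
    by (intro exI[of _ "cswap -` W"]) simp
qed

lemma holo2_on_cswap_comp:
  assumes "holo2_on \<Phi> U"
  shows "holo2_on (\<lambda>x. cswap (\<Phi> x)) U"
  unfolding holo2_on_def
proof
  fix x assume "x \<in> U"
  then obtain L where L: "(\<Phi> has_derivative L) (at x)"
    "\<And>c v. L (c * fst v, c * snd v) = (c * fst (L v), c * snd (L v))"
    using assms unfolding holo2_on_def by blast
  have "((\<lambda>x. cswap (\<Phi> x)) has_derivative (\<lambda>v. cswap (L v))) (at x)"
    using has_derivative_compose[OF L(1) has_derivative_cswap] .
  then show "\<exists>L. ((\<lambda>x. cswap (\<Phi> x)) has_derivative L) (at x) \<and>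
      (\<forall>c v. L (c * fst v, c * snd v) = (c * fst (L v), c * snd (L v)))"
    using L(2) by (intro exI[of _ "\<lambda>v. cswap (L v)"]) simp
qed

lemma holo2_on_comp_cswap:
  assumes "holo2_on \<Psi> V"
  shows "holo2_on (\<lambda>x. \<Psi> (cswap x)) (cswap ` V)"
  unfolding holo2_on_def
proof
  fix x assume "x \<in> cswap ` V"
  then have "cswap x \<in> V" by auto
  then obtain L where L: "(\<Psi> has_derivative L) (at (cswap x))"
    "\<And>c v. L (c * fst v, c * snd v) = (c * fst (L v), c * snd (L v))"
    using assms unfolding holo2_on_def by blast
  have "((\<lambda>x. \<Psi> (cswap x)) has_derivative (\<lambda>v. L (cswap v))) (at x)"
    using has_derivative_compose[OF has_derivative_cswap L(1)] .
  moreover have "L (cswap (c * fst v, c * snd v)) = (c * fst (L (cswap v)), c * snd (L (cswap v)))" for c v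
    using L(2)[of c "cswap v"] by simp
  ultimately show "\<exists>L. ((\<lambda>x. \<Psi> (cswap x)) has_derivative L) (at x) \<and>
      (\<forall>c v. L (c * fst v, c * snd v) = (c * fst (L v), c * snd (L v)))"
    by (intro exI[of _ "\<lambda>v. L (cswap v)"]) simp
qed

lemma holo_coord_cswap:
  assumes "holo_coord p \<Phi> U"
  shows "holo_coord p (\<lambda>x. cswap (\<Phi> x)) U"
proof -
  obtain \<Psi> where h: "open U" "p \<in> U" "holo2_on \<Phi> U" "inj_on \<Phi> U" "open (\<Phi> ` U)"
    "holo2_on \<Psi> (\<Phi> ` U)" "\<And>x. x \<in> U \<Longrightarrow> \<Psi> (\<Phi> x) = x" "\<Phi> p = (0, 0)"
    using assms unfolding holo_coord_def by blast
  have im: "(\<lambda>x. cswap (\<Phi> x)) ` U = cswap ` \<Phi> ` U" by (simp add: image_image)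
  have "inj_on (\<lambda>x. cswap (\<Phi> x)) U"
    using h(4) unfolding inj_on_def by (metis cswap_simps(1))
  moreover have "open (cswap ` \<Phi> ` U)" unfolding cswap_image by (rule open_cswap_vimage[OF h(5)])
  moreover have "\<exists>\<Psi>. holo2_on \<Psi> (cswap ` \<Phi> ` U) \<and> (\<forall>x\<in>U. \<Psi> (cswap (\<Phi> x)) = x)"
    using holo2_on_comp_cswap[OF h(6)] h(7) by (intro exI[of _ "\<lambda>x. \<Psi> (cswap x)"]) simp
  ultimately show ?thesis
    unfolding holo_coord_def im using h holo2_on_cswap_comp by simp
qed

lemma wirt_cswap:
  assumes "open W" "smooth_on W f" "x \<in> cswap -` W"
  shows "dz1 (\<lambda>x. f (cswap x)) x = dz2 f (cswap x)" "dzb1 (\<lambda>x. f (cswap x)) x = dzb2 f (cswap x)"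
  using frechet_derivative_cswap[OF smooth_on_differentiable[OF assms(2,1)], of x] assms(3)
  by (simp_all add: dz1_def dz2_def dzb1_def dzb2_def pd_def)

lemma wirt_pow_cswap:
  assumes W: "open W" "smooth_on W f" and AB: "wirt A" "wirt B"
    and swap: "\<And>g x. smooth_on W g \<Longrightarrow> x \<in> cswap -` W \<Longrightarrow> A (\<lambda>x. g (cswap x)) x = B g (cswap x)"
    and x: "x \<in> cswap -` W"
  shows "(A ^^ n) (\<lambda>x. f (cswap x)) x = (B ^^ n) f (cswap x)"
  using x
proof (induction n arbitrary: x)
  case (Suc n)
  have "A ((A ^^ n) (\<lambda>x. f (cswap x))) x = A (\<lambda>x. (B ^^ n) f (cswap x)) x"
    by (rule wirt_cong[OF AB(1) open_cswap_vimage[OF W(1)] _ Suc.prems]) (rule Suc.IH)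
  also have "\<dots> = B ((B ^^ n) f) (cswap x)"
    by (rule swap[OF wirt_pow_smooth[OF AB(2) W] Suc.prems])
  finally show ?case by simp
next
  case 0
  show ?case by simp
qed

text \<open>Pure coefficients involve only a \<open>dz1\<close> and a \<open>dzb1\<close> block,
  which become a \<open>dz2\<close> and a \<open>dzb2\<close> block in the same order; so the
  exchange goes through block by block.\<close>

lemma taylor_coeff_cswap_pure:
  assumes W: "open W" "0 \<in> W" and sm: "smooth_on W F"
  shows "taylor_coeff (\<lambda>x. F (cswap x)) (a, 0) (c, 0) = taylor_coeff F (0, a) (0, c)"
proof -
  define f where "f z = complex_of_real (F z)" for z
  have smf: "smooth_on W f"
    unfolding f_def by (rule smooth_on_bounded_linear[OF W(1) bounded_linear_of_real sm])
  have x0: "0 \<in> cswap -` W" using W(2) by simp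
  have "(dz1 ^^ a) ((dzb1 ^^ c) (\<lambda>x. f (cswap x))) 0 = (dz1 ^^ a) (\<lambda>x. (dzb2 ^^ c) f (cswap x)) 0"
    by (rule wirt_pow_cong[OF wirt_dz(1) open_cswap_vimage[OF W(1)] _ x0],
        rule wirt_pow_cswap[OF W(1) smf wirt_dz(2,4) wirt_cswap(2)[OF W(1)]])
  also have "\<dots> = (dz2 ^^ a) ((dzb2 ^^ c) f) 0"
    using wirt_pow_cswap[OF W(1) wirt_pow_smooth[OF wirt_dz(4) W(1) smf] wirt_dz(1,3) wirt_cswap(1)[OF W(1)] x0]
    by simp
  finally show ?thesis by (simp add: taylor_coeff_def f_def[abs_def] zero_prod_def)
qed

section \<open>The equivalences\<close>

lemma pure_coeff_of_axis_disjoint: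
  assumes "\<not> (\<exists>x. (x, 0) \<in> newton_poly F)" "snd \<alpha> = 0" "snd \<beta> = 0"
  shows "taylor_coeff F \<alpha> \<beta> = 0"
proof (rule ccontr)
  assume "taylor_coeff F \<alpha> \<beta> \<noteq> 0"
  then have "exps \<alpha> \<beta> \<in> newton_poly F" by (rule exps_mem_newton_poly)
  then show False using assms by (simp add: exps_def)
qed

lemma half_plane_of_axis_disjoint:
  assumes ldf: "local_defining_function S (0, 0) \<rho>" "(0, 0) \<in> S"
    and pure: "\<And>\<alpha> \<beta>. snd \<alpha> = 0 \<Longrightarrow> snd \<beta> = 0 \<Longrightarrow> taylor_coeff \<rho> \<alpha> \<beta> = 0"
  shows "newton_poly \<rho> = {\<xi>. fst \<xi> \<ge> 0 \<and> snd \<xi> \<ge> 1}"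
proof -
  obtain W where W: "open W" "(0, 0) \<in> W" "smooth_on W \<rho>"
    and nz: "\<And>x. x \<in> S \<inter> W \<Longrightarrow> frechet_derivative \<rho> (at x) \<noteq> (\<lambda>_. 0)"
    using ldf(1) unfolding local_defining_function_def by blast
  show ?thesis
    by (rule newton_poly_half_plane[OF W(1) _ W(3) _ pure]) (use W(2) nz ldf(2) in \<open>auto simp: zero_prod_def\<close>)
qed

lemma nonconvenient_imp_half_plane:
  assumes hc: "holo_coord p \<Phi> U" and pM: "p \<in> M"
    and ldf: "local_defining_function (\<Phi> ` (M \<inter> U)) (0, 0) \<rho>" and nc: "\<not> convenient \<rho>"
  shows "\<exists>\<Phi> U \<rho>. holo_coord p \<Phi> U \<and> local_defining_function (\<Phi> ` (M \<inter> U)) (0, 0) \<rho>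
    \<and> newton_poly \<rho> = {\<xi>. fst \<xi> \<ge> 0 \<and> snd \<xi> \<ge> 1}"
proof -
  have p0: "(0, 0) \<in> \<Phi> ` (M \<inter> U)" using hc pM unfolding holo_coord_def by (metis IntI image_eqI)
  consider "\<not> (\<exists>x. (x, 0) \<in> newton_poly \<rho>)" | "\<not> (\<exists>y. (0, y) \<in> newton_poly \<rho>)"
    using nc unfolding convenient_def by blast
  then show ?thesis
  proof cases
    case 1
    then show ?thesis
      using half_plane_of_axis_disjoint[OF ldf p0] pure_coeff_of_axis_disjoint[OF 1] hc ldf by blast
  next
    case 2
    let ?\<Phi> = "\<lambda>x. cswap (\<Phi> x)" and ?\<rho> = "\<lambda>x. \<rho> (cswap x)"
    have im: "?\<Phi> ` (M \<inter> U) = cswap ` \<Phi> ` (M \<inter> U)" by (simp add: image_image)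
    have l: "local_defining_function (?\<Phi> ` (M \<inter> U)) (0, 0) ?\<rho>"
      unfolding im using local_defining_function_cswap[OF ldf] by simp
    have p0': "(0, 0) \<in> ?\<Phi> ` (M \<inter> U)" unfolding im by (rule image_eqI[OF _ p0]) simp
    obtain W where W: "open W" "0 \<in> W" "smooth_on W \<rho>"
      using ldf unfolding local_defining_function_def zero_prod_def by blast
    have "taylor_coeff ?\<rho> \<alpha> \<beta> = 0" if z: "snd \<alpha> = 0" "snd \<beta> = 0" for \<alpha> \<beta>
    proof -
      have "taylor_coeff ?\<rho> \<alpha> \<beta> = taylor_coeff \<rho> (0, fst \<alpha>) (0, fst \<beta>)"
        using taylor_coeff_cswap_pure[OF W, of "fst \<alpha>" "fst \<beta>"] z by (metis prod.collapse)
      also have "\<dots> = 0"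
      proof (rule ccontr)
        assume "taylor_coeff \<rho> (0, fst \<alpha>) (0, fst \<beta>) \<noteq> 0"
        then have "exps (0, fst \<alpha>) (0, fst \<beta>) \<in> newton_poly \<rho>" by (rule exps_mem_newton_poly)
        then show False using 2 by (simp add: exps_def)
      qed
      finally show ?thesis .
    qed
    from half_plane_of_axis_disjoint[OF l p0' this] show ?thesis
      using holo_coord_cswap[OF hc] l by blast
  qed
qed

text \<open>One disc, the preimage of the axis under the coordinate, serves both (3) and (7), so it
  is produced with the full data of a parametrized submanifold rather than as a member of
  \<open>Gamma_reg\<close>.\<close>

lemma half_plane_imp_flat_curve:
  assumes hc: "holo_coord p \<Phi> U" and pM: "p \<in> M" and r: "local_defining_function M p r"
    and ldf: "local_defining_function (\<Phi> ` (M \<inter> U)) (0, 0) \<rho>"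
    and np: "newton_poly \<rho> = {\<xi>. fst \<xi> \<ge> 0 \<and> snd \<xi> \<ge> 1}"
  shows "\<exists>X \<phi> e. complex_curve_param X p \<phi> e \<and> tangent_inf_order r \<phi>"
proof -
  obtain \<Psi> where h: "open U" "p \<in> U" "holo2_on \<Phi> U" "open (\<Phi> ` U)"
    "holo2_on \<Psi> (\<Phi> ` U)" "\<And>x. x \<in> U \<Longrightarrow> \<Psi> (\<Phi> x) = x" "\<Phi> p = (0, 0)"
    using hc unfolding holo_coord_def by blast
  have p0: "(0, 0) \<in> \<Phi> ` (M \<inter> U)" "(0, 0) \<in> \<Phi> ` U"
    using image_eqI[of "(0, 0)" \<Phi> p] h(2,7) pM by auto
  obtain W where W: "open W" "0 \<in> W" "smooth_on W \<rho>"
    using ldf unfolding local_defining_function_def zero_prod_def by blast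
  have "\<not> (\<exists>x. (x, 0) \<in> newton_poly \<rho>)" by (simp add: np)
  note pure = pure_coeff_of_axis_disjoint[OF this]
  have flat: "vanishes_to (\<lambda>t. \<rho> (t, 0)) N" for N
    by (rule smooth_flat_on_line[OF W]) (rule pure)
  have \<Psi>0: "\<Psi> (0, 0) = p" using h(2,6,7) by metis
  have \<Psi>M: "\<Psi> y \<in> M" if y: "y \<in> \<Phi> ` (M \<inter> U)" "y \<in> \<Phi> ` U" for y
  proof -
    obtain x where "x \<in> M" "x \<in> U" "y = \<Phi> x" using y by blast
    then show ?thesis using h(6) by simp
  qed
  \<comment> \<open>The two defining functions live in different coordinates; this bound carries
    flatness of \<open>\<rho>\<close> on the axis to flatness of \<open>r\<close> on its image under
    \<open>\<Psi>\<close>.\<close>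
  obtain C where C: "eventually (\<lambda>y. norm (r (\<Psi> y)) \<le> C * \<bar>\<rho> y\<bar>) (nhds (0, 0))"
    using local_defining_function_comp_bound[OF ldf p0(1) r h(5,4) p0(2) \<Psi>0 \<Psi>M] by blast
  have lim: "((\<lambda>t::complex. (t, 0::complex)) \<longlongrightarrow> (0, 0)) (nhds 0)"
    by (intro tendsto_intros filterlim_ident)
  have bd: "eventually (\<lambda>t. norm (r (\<Psi> (t, 0))) \<le> C * norm (\<rho> (t, 0))) (nhds 0)"
    using eventually_compose_filterlim[OF C lim] by simp
  define \<phi> where "\<phi> t = \<Psi> (t, 0)" for t :: complex
  have "vanishes_to (\<lambda>t. r (\<phi> t)) N" for N
    unfolding \<phi>_def by (rule vanishes_to_dominated[OF flat bd])
  then have tan: "tangent_inf_order r \<phi>" unfolding tangent_inf_order_def vanishes_to_def by simp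
  have "eventually (\<lambda>t::complex. (t, 0::complex) \<in> \<Phi> ` U) (nhds 0)"
    using lim by (rule topological_tendstoD) (use h(4) p0 in auto)
  then obtain e where e: "e > 0" "\<And>t::complex. dist t 0 < e \<Longrightarrow> (t, 0) \<in> \<Phi> ` U"
    by (auto simp: eventually_nhds_metric)
  have sub: "(\<lambda>t::complex. (t, 0::complex)) ` ball 0 e \<subseteq> \<Phi> ` U" using e(2) by (auto simp: dist_commute)
  have hol: "holo_curve e \<phi>"
    unfolding \<phi>_def by (rule holo_curve_comp[OF h(5) _ sub]) (simp add: holo_curve_def holomorphic_on_const holomorphic_on_ident)
  have inv: "\<Phi> (\<phi> t) = (t, 0)" "\<phi> t \<in> U" if t: "t \<in> ball 0 e" for t
  proof -
    have "(t, 0) \<in> \<Phi> ` U" using sub t by blast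
    then obtain x where "x \<in> U" "(t, 0) = \<Phi> x" by blast
    then show "\<Phi> (\<phi> t) = (t, 0)" "\<phi> t \<in> U" using h(6) by (simp_all add: \<phi>_def)
  qed
  have \<phi>0: "\<phi> 0 = p" by (simp add: \<phi>_def \<Psi>0)
  \<comment> \<open>If the velocity of \<open>\<phi>\<close> vanished, so would that of its image
    under \<open>\<Phi>\<close>, yet the first component of this image is \<open>t\<close>.\<close>
  have nz: "(deriv (\<lambda>t. fst (\<phi> t)) 0, deriv (\<lambda>t. snd (\<phi> t)) 0) \<noteq> (0, 0)"
  proof
    assume z: "(deriv (\<lambda>t. fst (\<phi> t)) 0, deriv (\<lambda>t. snd (\<phi> t)) 0) = (0, 0)"
    have "((\<lambda>t. fst (\<phi> t)) has_field_derivative deriv (\<lambda>t. fst (\<phi> t)) 0) (at 0)"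
      "((\<lambda>t. snd (\<phi> t)) has_field_derivative deriv (\<lambda>t. snd (\<phi> t)) 0) (at 0)"
      using e(1) hol unfolding holo_curve_def by (auto intro: holomorphic_derivI)
    then have g: "((\<lambda>t. fst (\<phi> t)) has_field_derivative 0) (at 0)"
      "((\<lambda>t. snd (\<phi> t)) has_field_derivative 0) (at 0)" using z by auto
    obtain L where L: "(\<Phi> has_derivative L) (at (\<phi> 0))"
      "\<And>c v. L (c * fst v, c * snd v) = (c * fst (L v), c * snd (L v))"
      using h(2,3) \<phi>0 unfolding holo2_on_def by blast
    have "((\<lambda>t. fst (\<Phi> (\<phi> t))) has_field_derivative fst (L (0, 0))) (at 0)"
      by (rule holo2_comp_curve_deriv(1)[OF L g])
    moreover have "L (0, 0) = 0"
      using linear_0[OF has_derivative_linear[OF L(1)]] by (simp add: zero_prod_def)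
    ultimately have d0: "((\<lambda>t. fst (\<Phi> (\<phi> t))) has_field_derivative 0) (at 0)" by simp
    have d1: "((\<lambda>t. fst (\<Phi> (\<phi> t))) has_field_derivative 1) (at 0)"
      by (rule has_field_derivative_transform_within_open[OF DERIV_ident open_ball[of 0 e]])
        (use e(1) inv in auto)
    show False using DERIV_unique[OF d0 d1] by simp
  qed
  have inj: "inj_on \<phi> (ball 0 e)"
    by (rule inj_on_inverseI[where g = "\<lambda>x. fst (\<Phi> x)"]) (simp add: inv)
  have "continuous_on U \<Phi>"
    using holo2_on_isCont[OF h(3)] continuous_at_imp_continuous_on by blast
  then have "continuous_on (\<phi> ` ball 0 e) (\<lambda>x. fst (\<Phi> x))"
    by (intro continuous_on_fst) (rule continuous_on_subset, use inv in auto)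
  \<comment> \<open>Taking \<open>X\<close> to be the image of the disc itself allows the
    neighbourhood \<open>V\<close> to be the whole space.\<close>
  then have "complex_curve_param (\<phi> ` ball 0 e) p \<phi> e"
    unfolding complex_curve_param_def using e(1) hol \<phi>0 nz inj
    by (intro conjI exI[of _ "\<lambda>x. fst (\<Phi> x)"] exI[of _ UNIV] ballI) (simp_all add: inv(1))
  then show ?thesis using tan by blast
qed

text \<open>Curves are moved into the canonical coordinate. Bounding \<open>\<rho>\<close> there by
  \<open>r\<close> carries contact orders over, and the Lipschitz estimate for the inverse brings
  the order \<open>n\<close> of the curve back. One \<open>K\<close> for all curves bounds the
  supremum in (1); on a single curve it excludes (4).\<close>

lemma convenient_order_bound:
  assumes pM: "p \<in> M" and r: "local_defining_function M p r"
    and hc: "holo_coord p \<Phi> U" and ldf: "local_defining_function (\<Phi> ` (M \<inter> U)) (0, 0) \<rho>"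
    and nd: "N_nondegenerate \<rho>" and conv: "convenient \<rho>"
  shows "\<exists>K::nat. \<forall>\<gamma>\<in>Gamma p. \<exists>n>0. vanishes_to (\<lambda>t. \<gamma> t - p) n \<and>
    (\<forall>N. vanishes_to (r \<circ> \<gamma>) N \<longrightarrow> N \<le> K * n)"
proof -
  obtain A B where AB: "(A, 0) \<in> newton_poly \<rho>" "(0, B) \<in> newton_poly \<rho>"
    using conv unfolding convenient_def by blast
  \<comment> \<open>\<open>max A B\<close> is real while orders are natural numbers; rounding up
    keeps the bound.\<close>
  define K where "K = nat \<lceil>max A B\<rceil>"
  have K: "max A B \<le> real K" unfolding K_def by linarith
  obtain \<Psi> where h: "open U" "p \<in> U" "holo2_on \<Phi> U" "open (\<Phi> ` U)"
    "holo2_on \<Psi> (\<Phi> ` U)" "\<And>x. x \<in> U \<Longrightarrow> \<Psi> (\<Phi> x) = x" "\<Phi> p = (0, 0)"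
    using hc unfolding holo_coord_def by blast
  have p0: "(0, 0) \<in> \<Phi> ` (M \<inter> U)" "(0, 0) \<in> \<Phi> ` U"
    using image_eqI[of "(0, 0)" \<Phi> p] h(2,7) pM by auto
  obtain W where W: "open W" "0 \<in> W" "smooth_on W \<rho>"
    using ldf unfolding local_defining_function_def zero_prod_def by blast
  obtain C where C: "eventually (\<lambda>x. norm (\<rho> (\<Phi> x)) \<le> C * \<bar>r x\<bar>) (nhds p)"
    using local_defining_function_comp_bound[OF r pM ldf h(3,1,2,7)] by blast
  obtain d B' where d: "d > 0" "ball (0, 0) d \<subseteq> \<Phi> ` U"
    "\<And>x y. x \<in> ball (0, 0) d \<Longrightarrow> y \<in> ball (0, 0) d \<Longrightarrow> norm (\<Psi> x - \<Psi> y) \<le> B' * norm (x - y)"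
    using holo2_on_lipschitz_near[OF h(5,4) p0(2)] by blast
  have \<Psi>0: "\<Psi> (0, 0) = p" using h(2,6,7) by metis
  have "\<exists>n>0. vanishes_to (\<lambda>t. \<gamma> t - p) n \<and> (\<forall>N. vanishes_to (r \<circ> \<gamma>) N \<longrightarrow> N \<le> K * n)"
    if \<gamma>: "\<gamma> \<in> Gamma p" for \<gamma>
  proof -
    obtain e t1 where e: "\<gamma> 0 = p" "e > 0" "holo_curve e \<gamma>" "t1 \<in> ball 0 e" "\<gamma> t1 \<noteq> p"
      using \<gamma> unfolding Gamma_def by blast
    have hol: "(\<lambda>t. fst (\<gamma> t)) holomorphic_on ball 0 e" "(\<lambda>t. snd (\<gamma> t)) holomorphic_on ball 0 e"
      using e(3) by (simp_all add: holo_curve_def)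
    have "continuous_on (ball 0 e) (\<lambda>t. (fst (\<gamma> t), snd (\<gamma> t)))"
      by (intro continuous_on_Pair holomorphic_on_imp_continuous_on hol)
    then have "\<forall>t\<in>ball 0 e. isCont \<gamma> t" by (simp add: continuous_on_eq_continuous_at)
    then have "isCont \<gamma> 0" using e(2) by simp
    then have \<gamma>lim: "(\<gamma> \<longlongrightarrow> p) (nhds 0)" using isCont_tendsto_nhds e(1) by metis
    then have "eventually (\<lambda>t. \<gamma> t \<in> U) (nhds 0)" by (rule topological_tendstoD) (use h in auto)
    then obtain e1 where e1: "e1 > 0" "\<And>t. dist t 0 < e1 \<Longrightarrow> \<gamma> t \<in> U"
      by (auto simp: eventually_nhds_metric)
    define e2 where "e2 = min e e1"
    have e2: "e2 > 0" using e(2) e1(1) by (simp add: e2_def)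
    have inU: "\<gamma> ` ball 0 e2 \<subseteq> U" using e1(2) by (auto simp: e2_def dist_commute)
    have sub: "ball 0 e2 \<subseteq> ball (0::complex) e" by (auto simp: e2_def)
    define \<delta> where "\<delta> t = \<Phi> (\<gamma> t)" for t
    have "holo_curve e2 \<gamma>"
      using hol sub unfolding holo_curve_def by (blast intro: holomorphic_on_subset)
    then have hol\<delta>: "holo_curve e2 \<delta>"
      unfolding \<delta>_def using inU by (rule holo_curve_comp[OF h(3)])
    have \<delta>0: "\<delta> 0 = 0" by (simp add: \<delta>_def e(1) h(7) zero_prod_def)
    \<comment> \<open>The curve was restricted to a smaller disc to stay in \<open>U\<close>; by the
      identity theorem, a restriction constantly equal to \<open>p\<close> would force
      \<open>\<gamma> t1 = p\<close>.\<close>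
    have "\<exists>t2\<in>ball 0 e2. \<gamma> t2 \<noteq> p"
    proof (rule ccontr)
      assume "\<not> (\<exists>t2\<in>ball 0 e2. \<gamma> t2 \<noteq> p)"
      then have const: "\<gamma> t = p" if "t \<in> ball 0 e2" for t using that by blast
      have lim: "0 islimpt ball (0::complex) e2" using e2 by (intro interior_limit_point) simp
      have e0: "0 \<in> ball (0::complex) e" using e(2) by simp
      have "fst (\<gamma> t1) - fst p = 0"
        by (rule analytic_continuation[OF holomorphic_on_diff[OF hol(1) holomorphic_on_const]
              open_ball connected_ball sub e0 lim _ e(4)]) (simp add: const)
      moreover have "snd (\<gamma> t1) - snd p = 0"
        by (rule analytic_continuation[OF holomorphic_on_diff[OF hol(2) holomorphic_on_const]
              open_ball connected_ball sub e0 lim _ e(4)]) (simp add: const)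
      ultimately show False using e(5) by (simp add: prod_eq_iff)
    qed
    then obtain t2 where t2: "t2 \<in> ball 0 e2" "\<gamma> t2 \<noteq> p" by blast
    have "\<delta> t2 \<noteq> 0"
    proof
      assume "\<delta> t2 = 0"
      then have "\<Psi> (\<delta> t2) = p" using \<Psi>0 by (simp add: zero_prod_def)
      then show False using t2 inU h(6) unfolding \<delta>_def by (metis image_subset_iff)
    qed
    from curve_order_bound[OF W nd AB hol\<delta> e2 \<delta>0 t2(1) this]
    obtain n where n: "n > 0" "vanishes_to \<delta> n"
      "\<And>N. vanishes_to (\<lambda>t. \<rho> (\<delta> t)) N \<Longrightarrow> real N \<le> max A B * real n" by blast
    have \<delta>lim: "(\<delta> \<longlongrightarrow> (0, 0)) (nhds 0)"
    proof -
      have "(\<Phi> \<longlongrightarrow> (0, 0)) (nhds p)" using isCont_tendsto_nhds[OF holo2_on_isCont[OF h(3,2)]] h(7) by simp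
      then show ?thesis unfolding \<delta>_def using \<gamma>lim by (rule filterlim_compose)
    qed
    then have "eventually (\<lambda>t. \<delta> t \<in> ball (0, 0) d) (nhds 0)"
      by (rule topological_tendstoD) (use d in auto)
    moreover have "eventually (\<lambda>t. t \<in> ball 0 e2) (nhds (0::complex))"
      using e2 by (intro eventually_nhds_in_open) auto
    ultimately have "eventually (\<lambda>t. norm (\<gamma> t - p) \<le> B' * norm (\<delta> t)) (nhds 0)"
    proof eventually_elim
      case (elim t)
      have "\<gamma> t = \<Psi> (\<delta> t)" using inU elim(2) h(6) by (simp add: \<delta>_def image_subset_iff)
      then show ?case using d(3)[OF elim(1), of "(0, 0)"] d(1) \<Psi>0 by (simp add: zero_prod_def[symmetric])
    qed
    then have v: "vanishes_to (\<lambda>t. \<gamma> t - p) n" by (rule vanishes_to_dominated[OF n(2)])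
    have "N \<le> K * n" if N: "vanishes_to (r \<circ> \<gamma>) N" for N
    proof -
      have "eventually (\<lambda>t. norm (\<rho> (\<delta> t)) \<le> C * norm ((r \<circ> \<gamma>) t)) (nhds 0)"
        using eventually_compose_filterlim[OF C \<gamma>lim] by (simp add: \<delta>_def)
      then have "vanishes_to (\<lambda>t. \<rho> (\<delta> t)) N" by (rule vanishes_to_dominated[OF N])
      then have "real N \<le> max A B * real n" by (rule n(3))
      also have "\<dots> \<le> real K * real n" by (intro mult_right_mono K) simp
      finally show ?thesis by (simp flip: of_nat_mult)
    qed
    then show ?thesis using n(1) v by blast
  qed
  then show ?thesis by blast
qed

lemma Delta1_finite:
  assumes "\<And>\<gamma>. \<gamma> \<in> Gamma p \<Longrightarrow> \<exists>n>0. vanishes_to (\<lambda>t. \<gamma> t - p) n \<and>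
    (\<forall>N. vanishes_to (r \<circ> \<gamma>) N \<longrightarrow> N \<le> K * n)"
  shows "Delta1 p r \<noteq> \<infinity>"
proof -
  have "ereal_of_enat (vord (r \<circ> \<gamma>)) / ereal_of_enat (vord (\<lambda>t. \<gamma> t - p)) \<le> ereal (real K)"
    if \<gamma>: "\<gamma> \<in> Gamma p" for \<gamma>
  proof -
    obtain n where n: "n > 0" "vanishes_to (\<lambda>t. \<gamma> t - p) n"
      "\<And>N. vanishes_to (r \<circ> \<gamma>) N \<Longrightarrow> N \<le> K * n" using assms[OF \<gamma>] by blast
    have "vord (r \<circ> \<gamma>) \<le> enat (K * n)" by (rule vord_leI) (rule n(3))
    then obtain a where a: "vord (r \<circ> \<gamma>) = enat a" "a \<le> K * n" by (cases "vord (r \<circ> \<gamma>)") auto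
    have b: "enat n \<le> vord (\<lambda>t. \<gamma> t - p)" by (rule vanishes_to_imp_le_vord[OF n(2)])
    show ?thesis
    proof (cases "vord (\<lambda>t. \<gamma> t - p)")
      case (enat b')
      then have b': "n \<le> b'" "b' > 0" using b n(1) by auto
      have "real a \<le> real (K * b')" using a(2) b' by (metis le_trans mult_le_mono2 of_nat_mono)
      then have "real a / real b' \<le> real K" using b' by (simp add: divide_le_eq)
      then show ?thesis using a enat b' by simp
    next
      \<comment> \<open>Division by \<infinity> gives 0 in \<open>ereal\<close>, and the numerator
        is finite.\<close>
      case infinity
      then show ?thesis using a by simp
    qed
  qed
  then have "Delta1 p r \<le> ereal (real K)" unfolding Delta1_def by (rule SUP_least)
  then show ?thesis by auto
qed

text \<open>On regular curves the denominator is 1. An infinite supremum need not be attained, so a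
  curve exceeding each real bound \<open>B\<close> is taken in turn.\<close>

lemma Delta1_reg_imp_Delta1:
  assumes "Delta1_reg p r = \<infinity>"
  shows "Delta1 p r = \<infinity>"
proof (rule ereal_top)
  fix B
  obtain k :: nat where k: "B \<le> real k" using real_arch_simple by blast
  have "enat k < Delta1_reg p r" using assms by simp
  then obtain \<gamma> where \<gamma>: "\<gamma> \<in> Gamma_reg p" "enat k < vord (r \<circ> \<gamma>)"
    unfolding Delta1_reg_def less_SUP_iff by blast
  then have v: "vord (\<lambda>t. \<gamma> t - p) = 1" "\<gamma> \<in> Gamma p" by (simp_all add: Gamma_reg_def)
  have "ereal B \<le> ereal_of_enat (enat k)" using k by simp
  also have "\<dots> \<le> ereal_of_enat (vord (r \<circ> \<gamma>))" using \<gamma>(2) by (simp only: ereal_of_enat_le_iff less_imp_le)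
  also have "\<dots> = ereal_of_enat (vord (r \<circ> \<gamma>)) / ereal_of_enat (vord (\<lambda>t. \<gamma> t - p))"
    by (simp add: v(1) one_enat_def flip: one_ereal_def)
  also have "\<dots> \<le> Delta1 p r" unfolding Delta1_def by (rule SUP_upper[OF v(2)])
  finally show "ereal B \<le> Delta1 p r" .
qed

theorem theorem5p3:
  fixes M :: "C2 set" and p :: C2 and r :: "C2 \<Rightarrow> real"
  assumes hyp: "real_hypersurface M"
    and pM: "p \<in> M"
    and r: "local_defining_function M p r"
    and canon: "\<exists>\<Phi> U. N_canonical M p \<Phi> U"
  shows "(Delta1 p r = \<infinity> \<longleftrightarrow> Delta1_reg p r = \<infinity>)
    \<and> (Delta1_reg p r = \<infinity> \<longleftrightarrow> (\<exists>\<gamma>\<in>Gamma_reg p. tangent_inf_order r \<gamma>))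
    \<and> ((\<exists>\<gamma>\<in>Gamma_reg p. tangent_inf_order r \<gamma>) \<longleftrightarrow> (\<exists>\<gamma>\<in>Gamma p. tangent_inf_order r \<gamma>))
    \<and> ((\<exists>\<gamma>\<in>Gamma p. tangent_inf_order r \<gamma>) \<longleftrightarrow>
         (\<exists>\<Phi> U \<rho>. holo_coord p \<Phi> U \<and> local_defining_function (\<Phi> ` (M \<inter> U)) (0, 0) \<rho>
                   \<and> \<not> convenient \<rho>))
    \<and> ((\<exists>\<Phi> U \<rho>. holo_coord p \<Phi> U \<and> local_defining_function (\<Phi> ` (M \<inter> U)) (0, 0) \<rho>
                   \<and> \<not> convenient \<rho>) \<longleftrightarrow>
       (\<exists>\<Phi> U \<rho>. holo_coord p \<Phi> U \<and> local_defining_function (\<Phi> ` (M \<inter> U)) (0, 0) \<rho>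
                   \<and> newton_poly \<rho> = {\<xi>. fst \<xi> \<ge> 0 \<and> snd \<xi> \<ge> 1}))
    \<and> ((\<exists>\<Phi> U \<rho>. holo_coord p \<Phi> U \<and> local_defining_function (\<Phi> ` (M \<inter> U)) (0, 0) \<rho>
                   \<and> newton_poly \<rho> = {\<xi>. fst \<xi> \<ge> 0 \<and> snd \<xi> \<ge> 1}) \<longleftrightarrow>
       BG_type_infinite p r)"
proof -
  let ?C1 = "Delta1 p r = \<infinity>" and ?C2 = "Delta1_reg p r = \<infinity>"
  let ?C3 = "\<exists>\<gamma>\<in>Gamma_reg p. tangent_inf_order r \<gamma>" and ?C4 = "\<exists>\<gamma>\<in>Gamma p. tangent_inf_order r \<gamma>"
  let ?C5 = "\<exists>\<Phi> U \<rho>. holo_coord p \<Phi> U \<and> local_defining_function (\<Phi> ` (M \<inter> U)) (0, 0) \<rho> \<and> \<not> convenient \<rho>"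
  let ?C6 = "\<exists>\<Phi> U \<rho>. holo_coord p \<Phi> U \<and> local_defining_function (\<Phi> ` (M \<inter> U)) (0, 0) \<rho>
    \<and> newton_poly \<rho> = {\<xi>. fst \<xi> \<ge> 0 \<and> snd \<xi> \<ge> 1}"
  let ?C7 = "BG_type_infinite p r"
  have tan: "vanishes_to (r \<circ> \<gamma>) N" if "tangent_inf_order r \<gamma>" for \<gamma> N
    using that unfolding tangent_inf_order_def vanishes_to_def by simp
  obtain \<Phi> U \<rho> where c: "holo_coord p \<Phi> U" "local_defining_function (\<Phi> ` (M \<inter> U)) (0, 0) \<rho>"
    "N_nondegenerate \<rho>"
    using canon unfolding N_canonical_def by blast
  \<comment> \<open>If no coordinate is as in (5), then in particular the canonical one has a
    convenient defining function.\<close>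
  have bound: "\<exists>K::nat. \<forall>\<gamma>\<in>Gamma p. \<exists>n>0. vanishes_to (\<lambda>t. \<gamma> t - p) n \<and>
    (\<forall>N. vanishes_to (r \<circ> \<gamma>) N \<longrightarrow> N \<le> K * n)" if "\<not> ?C5"
    by (rule convenient_order_bound[OF pM r c]) (use that c in blast)
  have i15: "?C5" if "?C1"
    using bound Delta1_finite that by blast
  have i45: "?C5" if C4: "?C4"
  proof (rule ccontr)
    assume "\<not> ?C5"
    then obtain K :: nat where K: "\<And>\<gamma>. \<gamma> \<in> Gamma p \<Longrightarrow> \<exists>n>0. vanishes_to (\<lambda>t. \<gamma> t - p) n \<and>
      (\<forall>N. vanishes_to (r \<circ> \<gamma>) N \<longrightarrow> N \<le> K * n)" using bound by blast
    obtain \<gamma> where \<gamma>: "\<gamma> \<in> Gamma p" "tangent_inf_order r \<gamma>" using C4 by blast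
    obtain n where "\<And>N. vanishes_to (r \<circ> \<gamma>) N \<Longrightarrow> N \<le> K * n" using K[OF \<gamma>(1)] by blast
    from this[OF tan[OF \<gamma>(2)], of "Suc (K * n)"] show False by simp
  qed
  have i56: "?C6" if "?C5" using nonconvenient_imp_half_plane[OF _ pM] that by blast
  have i65: "?C5" if C6: "?C6"
  proof -
    obtain \<Phi> U \<rho> where "holo_coord p \<Phi> U" "local_defining_function (\<Phi> ` (M \<inter> U)) (0, 0) \<rho>"
      and np: "newton_poly \<rho> = {\<xi>. fst \<xi> \<ge> 0 \<and> snd \<xi> \<ge> 1}" using C6 by blast
    moreover have "\<not> convenient \<rho>" unfolding convenient_def np by simp
    ultimately show ?thesis by blast
  qed
  have i6: "\<exists>X \<phi> e. complex_curve_param X p \<phi> e \<and> tangent_inf_order r \<phi>" if "?C6"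
    using half_plane_imp_flat_curve[OF _ pM r] that by blast
  have i63: "?C3" if "?C6" using i6[OF that] complex_curve_param_imp_Gamma_reg by blast
  have flat: "vord (r \<circ> \<gamma>) = \<infinity>" if "tangent_inf_order r \<gamma>" for \<gamma>
    by (rule vord_eq_infinity) (rule tan[OF that])
  have i67: "?C7" if C6: "?C6"
  proof -
    obtain X \<phi> e where "complex_curve_param X p \<phi> e" "tangent_inf_order r \<phi>" using i6[OF C6] by blast
    moreover have "vord (r \<circ> \<phi>) \<ge> enat m" for m using flat[OF \<open>tangent_inf_order r \<phi>\<close>] by simp
    ultimately show ?thesis unfolding BG_type_infinite_def by blast
  qed
  have reg: "vord (r \<circ> \<gamma>) \<le> Delta1_reg p r" if "\<gamma> \<in> Gamma_reg p" for \<gamma>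
    unfolding Delta1_reg_def by (rule SUP_upper[OF that])
  \<comment> \<open>The disc in (7) may change with \<open>m\<close>, so this yields an infinite
    supremum and not yet a single tangent curve.\<close>
  have i72: "?C2" if C7: "?C7"
  proof (rule ccontr)
    assume "\<not> ?C2"
    then obtain k where k: "Delta1_reg p r = enat k" by (cases "Delta1_reg p r") auto
    obtain X \<phi> e where \<phi>: "complex_curve_param X p \<phi> e" "vord (r \<circ> \<phi>) \<ge> enat (Suc k)"
      using C7 unfolding BG_type_infinite_def by blast
    have "enat (Suc k) \<le> enat k"
      using order_trans[OF \<phi>(2) reg[OF complex_curve_param_imp_Gamma_reg[OF \<phi>(1)]]] k by simp
    then show False by simp
  qed
  have i34: "?C4" if "?C3" using that unfolding Gamma_reg_def by blast
  have i32: "?C2" if C3: "?C3"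
  proof -
    obtain \<gamma> where \<gamma>: "\<gamma> \<in> Gamma_reg p" "tangent_inf_order r \<gamma>" using C3 by blast
    show ?thesis using reg[OF \<gamma>(1)] flat[OF \<gamma>(2)] by simp
  qed
  have i21: "?C1" if "?C2" using that by (rule Delta1_reg_imp_Delta1)
  \<comment> \<open>The implications close up through the cycle 1, 5, 6, 3, 2, 1, with the detours
    3, 4, 5 and 6, 7, 2.\<close>
  show ?thesis using i15 i45 i56 i65 i63 i67 i72 i34 i32 i21 by argo
qed

end
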